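(* Let $p:M(\mathbb{C})^g\to M(\mathbb{C})^g$ be a free polynomial mapping with hypo-Jacobian matrix $J^{\mathrm{hyp}}_p\in M_g(\mathbb{C}\langle z\rangle\otimes\mathbb{C}\langle y\rangle)$. Then $p$ is injective if and only if $J^{\mathrm{hyp}}_p$ has a multiplicative inverse whose entries are bipartite polynomials, i.e. $J^{\mathrm{hyp}}_p$ is invertible in $M_g(\mathbb{C}\langle z\rangle\otimes\mathbb{C}\langle y\rangle)$.
   Context: $x,y,z$ are $g$-tuples of freely noncommuting indeterminates. A free polynomial mapping $p=(p^1,\dots,p^g)$ is a $g$-tuple of elements of the free algebra $\mathbb{C}\langle x_1,\dots,x_g\rangle$, inducing by evaluation maps $p[n]:M_n(\mathbb{C})^g\to M_n(\mathbb{C})^g$, $n\ge1$; $p$ is injective if every $p[n]$ is injective. Bipartite polynomials are elements of $\mathbb{C}\langle z\leftrightarrow y\rangle=\mathbb{C}\langle z\rangle\otimes\mathbb{C}\langle y\rangle$ (the $z_i$ commute with the $y_j$, but otherwise there are no relations). The free derivative $Dp(y)[x]$ is the $g$-tuple of polynomials in $\mathbb{C}\langle x,y\rangle$, linear in $x$, determined by linearity, $Dx_i(y)[x]=x_i$, $D1=0$ and the Leibniz rule $D(\eta\mu)(y)[x]=D\eta(y)[x]\mu(y)+\eta(y)D\mu(y)[x]$. For $A\in M_n(\mathbb{C})$, $\mathrm{vec}[n](A)$ is the row vector of length $n^2$ with $\mathrm{vec}[n](A)_{(i-1)n+j}=A_{i,j}$; for tuples it is applied coordinatewise and concatenated. The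 hypo-Jacobian matrix $J^{\mathrm{hyp}}_p$ is the unique matrix in $M_g(\mathbb{C}\langle z\leftrightarrow y\rangle)$ such that for all $n\ge1$ and $X,Y\in M_n(\mathbb{C})^g$, $$\mathrm{vec}[n](Dp(Y)[X])=\mathrm{vec}[n](X)\cdot J^{\mathrm{hyp}}_p(Y^T\otimes I_n,I_n\otimes Y),$$ where $Y^T\otimes I_n=(Y_1^T\otimes I_n,\dots,Y_g^T\otimes I_n)$ and $I_n\otimes Y=(I_n\otimes Y_1,\dots,I_n\otimes Y_g)$. Explicitly, if the $i$-th component of $Dp(y)[x]$ is $\sum_\ell\sum_{j=1}^g U^\ell_{i,j}(y)x_jV^\ell_{i,j}(y)$, then $(J^{\mathrm{hyp}}_p)_{j,i}=\sum_\ell (U^\ell_{i,j})^T(z)\otimes V^\ell_{i,j}(y)$, where $T$ reverses words and is extended linearly. *)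

theory Defs
  imports "HOL-Analysis.Analysis" "HOL-Library.Poly_Mapping" "HOL-Library.Product_Plus"
    "Jordan_Normal_Form.Matrix"
begin

no_notation Matrix.vec_index (infixl "$" 100)

text \<open>Words form the free monoid under concatenation, written additively so that
  \<^typ>\<open>'a list \<Rightarrow>\<^sub>0 complex\<close> carries the convolution product of the free algebra.\<close>

instantiation list :: (type) monoid_add
begin
definition zero_list :: "'a list" where "zero_list = []"
definition plus_list :: "'a list \<Rightarrow> 'a list \<Rightarrow> 'a list" where "plus_list = (@)"
instance by standard (simp_all add: zero_list_def plus_list_def)
end

type_synonym 'a free_poly = "'a list \<Rightarrow>\<^sub>0 complex"

text \<open>The tensor product of two free algebras is the monoid algebra of the product of the
  word monoids: the pair \<^term>\<open>(w, v)\<close> stands for \<open>w(z) \<otimes> v(y)\<close>.\<close>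

type_synonym 'a bipartite_poly = "('a list \<times> 'a list) \<Rightarrow>\<^sub>0 complex"

definition mat_tuples :: "nat \<Rightarrow> ('a \<Rightarrow> complex mat) set" where
  "mat_tuples n = {X. \<forall>i. X i \<in> carrier_mat n n}"

primrec word_eval :: "nat \<Rightarrow> ('a \<Rightarrow> complex mat) \<Rightarrow> 'a list \<Rightarrow> complex mat" where
  "word_eval n X [] = 1\<^sub>m n"
| "word_eval n X (i # w) = X i * word_eval n X w"

definition poly_eval :: "nat \<Rightarrow> ('a \<Rightarrow> complex mat) \<Rightarrow> 'a free_poly \<Rightarrow> complex mat" where
  "poly_eval n X f = mat n n (\<lambda>ab.
     \<Sum>w\<in>Poly_Mapping.keys f. Poly_Mapping.lookup f w * word_eval n X w $$ ab)"

definition bipartite_eval ::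
  "nat \<Rightarrow> ('a \<Rightarrow> complex mat) \<Rightarrow> ('a \<Rightarrow> complex mat) \<Rightarrow> 'a bipartite_poly \<Rightarrow> complex mat" where
  "bipartite_eval n Z Y f = mat n n (\<lambda>ab.
     \<Sum>(w, v)\<in>Poly_Mapping.keys f.
        Poly_Mapping.lookup f (w, v) * (word_eval n Z w * word_eval n Y v) $$ ab)"

definition poly_map_eval ::
  "nat \<Rightarrow> ('a \<Rightarrow> 'a free_poly) \<Rightarrow> ('a \<Rightarrow> complex mat) \<Rightarrow> ('a \<Rightarrow> complex mat)" where
  "poly_map_eval n p X = (\<lambda>i. poly_eval n X (p i))"

definition free_injective :: "('a \<Rightarrow> 'a free_poly) \<Rightarrow> bool" where
  "free_injective p \<longleftrightarrow> (\<forall>n\<ge>1. inj_on (poly_map_eval n p) (mat_tuples n))"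

definition linear_ext :: "('a list \<Rightarrow> 'b free_poly) \<Rightarrow> 'a free_poly \<Rightarrow> 'b free_poly" where
  "linear_ext h f =
     (\<Sum>w\<in>Poly_Mapping.keys f. Poly_Mapping.single 0 (Poly_Mapping.lookup f w) * h w)"

text \<open>In the alphabet \<^typ>\<open>'a + 'a\<close> the letter \<^term>\<open>Inl i\<close> is \<open>x\<^sub>i\<close> (the direction) and
  \<^term>\<open>Inr i\<close> is \<open>y\<^sub>i\<close> (the base point).\<close>

definition base_poly :: "'a free_poly \<Rightarrow> ('a + 'a) free_poly" where
  "base_poly = linear_ext (\<lambda>w. Poly_Mapping.single (map Inr w) 1)"

text \<open>The second equation is the Leibniz rule applied to the product of a letter and a word.\<close>

primrec word_deriv :: "'a list \<Rightarrow> ('a + 'a) free_poly" where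
  "word_deriv [] = 0"
| "word_deriv (i # w) =
     Poly_Mapping.single [Inl i] 1 * Poly_Mapping.single (map Inr w) 1
   + Poly_Mapping.single [Inr i] 1 * word_deriv w"

definition free_deriv :: "'a free_poly \<Rightarrow> ('a + 'a) free_poly" where
  "free_deriv = linear_ext word_deriv"

text \<open>The monomial \<open>c u(y) x\<^sub>j v(y)\<close> of the \<open>i\<close>-th component of the derivative contributes
  \<open>c u\<^sup>T(z) \<otimes> v(y)\<close> to the entry \<open>(j, i)\<close>; so the coefficient of \<open>w(z) \<otimes> v(y)\<close> in that entry is
  the coefficient of the following word.\<close>

definition hypo_word :: "'a \<Rightarrow> 'a list \<times> 'a list \<Rightarrow> ('a + 'a) list" where
  "hypo_word j = (\<lambda>(w, v). map Inr (rev w) @ Inl j # map Inr v)"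

definition hypo_Jacobian ::
  "('a::finite \<Rightarrow> 'a free_poly) \<Rightarrow> 'a bipartite_poly ^ 'a ^ 'a" where
  "hypo_Jacobian p = (\<chi> j i. Poly_Mapping.map_key (hypo_word j) (free_deriv (p i)))"

lemma linear_ext_superset:
  assumes "finite S" "Poly_Mapping.keys f \<subseteq> S"
  shows "linear_ext h f =
     (\<Sum>w\<in>S. Poly_Mapping.single 0 (Poly_Mapping.lookup f w) * h w)"
  unfolding linear_ext_def
  by (rule sum.mono_neutral_left) (use assms in \<open>auto simp: in_keys_iff\<close>)

lemma linear_ext_add: "linear_ext h (f + g) = linear_ext h f + linear_ext h g"
proof -
  let ?S = "Poly_Mapping.keys f \<union> Poly_Mapping.keys g"
  have "Poly_Mapping.keys (f + g) \<subseteq> ?S" by (rule Poly_Mapping.keys_add)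
  then show ?thesis
    by (simp add: linear_ext_superset[of ?S] lookup_add single_add distrib_right sum.distrib)
qed

lemma linear_ext_zero [simp]: "linear_ext h 0 = 0"
  by (simp add: linear_ext_def)

lemma linear_ext_single:
  "linear_ext h (Poly_Mapping.single w c) = Poly_Mapping.single 0 c * h w"
  by (simp add: linear_ext_superset[of "{w}"])

lemma poly_mapping_add_induct [case_names zero add]:
  fixes f :: "'k \<Rightarrow>\<^sub>0 'b::monoid_add"
  assumes "P 0" "\<And>w c f. P f \<Longrightarrow> P (Poly_Mapping.single w c + f)"
  shows "P f"
proof (induction f rule: update_induct)
  case (update f a b)
  have "Poly_Mapping.update a b f = Poly_Mapping.single a b + f"
    by (rule poly_mapping_eqI)
       (use update in \<open>auto simp: lookup_update lookup_add lookup_single when_def in_keys_iff\<close>)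
  then show ?case using update assms by simp
qed (use assms in simp)

lemma single_zero_commute:
  fixes f :: "'a free_poly"
  shows "f * Poly_Mapping.single 0 c = Poly_Mapping.single 0 c * f"
  by (induction f rule: poly_mapping_add_induct)
     (simp_all add: mult_single mult.commute distrib_left distrib_right)

lemma base_poly_single: "base_poly (Poly_Mapping.single w c) = Poly_Mapping.single (map Inr w) c"
  by (simp add: base_poly_def linear_ext_single mult_single)

lemma free_deriv_single:
  "free_deriv (Poly_Mapping.single w c) = Poly_Mapping.single 0 c * word_deriv w"
  by (simp add: free_deriv_def linear_ext_single)

lemma base_poly_add: "base_poly (f + g) = base_poly f + base_poly g"
  by (simp add: base_poly_def linear_ext_add)

lemma free_deriv_add: "free_deriv (f + g) = free_deriv f + free_deriv g"
  by (simp add: free_deriv_def linear_ext_add)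

lemma free_deriv_scale:
  "free_deriv (Poly_Mapping.single 0 c * f) = Poly_Mapping.single 0 c * free_deriv f"
  by (induction f rule: poly_mapping_add_induct)
     (simp_all add: free_deriv_add free_deriv_single distrib_left mult_single
        mult.assoc [symmetric], simp add: free_deriv_def)

lemma free_deriv_1: "free_deriv 1 = 0"
  unfolding single_one [symmetric] by (simp add: free_deriv_single zero_list_def)

lemma free_deriv_var:
  "free_deriv (Poly_Mapping.single [i] 1) = Poly_Mapping.single [Inl i] 1"
  by (simp add: free_deriv_single mult_single plus_list_def zero_list_def)

lemma word_deriv_append:
  "word_deriv (v @ w) = word_deriv v * Poly_Mapping.single (map Inr w) 1
                      + Poly_Mapping.single (map Inr v) 1 * word_deriv w"
proof (induction v)
  case Nil
  have "Poly_Mapping.single ([] :: ('a + 'a) list) (1 :: complex) = 1"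
    by (simp flip: single_one add: zero_list_def)
  then show ?case by simp
next
  case (Cons i v)
  have *: "Poly_Mapping.single (map Inr (v @ w)) (1 :: complex) =
      Poly_Mapping.single (map Inr v) 1 * Poly_Mapping.single (map Inr w) 1"
    "Poly_Mapping.single (map Inr (i # v)) (1 :: complex) =
      Poly_Mapping.single [Inr i] 1 * Poly_Mapping.single (map Inr v) 1"
    by (simp_all add: mult_single plus_list_def)
  show ?case
    unfolding append_Cons word_deriv.simps Cons.IH *
    by (simp add: distrib_left distrib_right mult.assoc add.assoc)
qed

theorem free_deriv_mult:
  "free_deriv (f * g) = free_deriv f * base_poly g + base_poly f * free_deriv g"
proof (induction f rule: poly_mapping_add_induct)
  case zero
  show ?case by (simp add: free_deriv_def base_poly_def)
next
  case (add v c f)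
  have "free_deriv (Poly_Mapping.single v c * g) =
      free_deriv (Poly_Mapping.single v c) * base_poly g
      + base_poly (Poly_Mapping.single v c) * free_deriv g"
  proof (induction g rule: poly_mapping_add_induct)
    case zero
    show ?case by (simp add: free_deriv_def base_poly_def)
  next
    case (add w d g)
    have s: "Poly_Mapping.single (map Inr u) a =
        Poly_Mapping.single 0 a * Poly_Mapping.single (map Inr u) 1"
      for u :: "'a list" and a :: complex
      by (simp add: mult_single)
    have m: "Poly_Mapping.single 0 (a * b) = Poly_Mapping.single 0 a * Poly_Mapping.single 0 b"
      for a b :: complex
      by (simp add: mult_single)
    have c1: "h * (Poly_Mapping.single 0 a * k) = Poly_Mapping.single 0 a * (h * k)"
      for h k :: "('a + 'a) free_poly" and a
      by (metis mult.assoc single_zero_commute)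
    have vw: "Poly_Mapping.single v c * Poly_Mapping.single w d =
        Poly_Mapping.single (v @ w) (c * d)"
      by (simp add: mult_single plus_list_def)
    have "free_deriv (Poly_Mapping.single v c * Poly_Mapping.single w d) =
       Poly_Mapping.single 0 c * (Poly_Mapping.single 0 d *
         (word_deriv v * Poly_Mapping.single (map Inr w) 1
          + Poly_Mapping.single (map Inr v) 1 * word_deriv w))"
      by (simp only: vw free_deriv_single word_deriv_append m mult.assoc)
    also have "\<dots> = free_deriv (Poly_Mapping.single v c) * base_poly (Poly_Mapping.single w d)
        + base_poly (Poly_Mapping.single v c) * free_deriv (Poly_Mapping.single w d)"
      unfolding free_deriv_single base_poly_single s[of v c] s[of w d]
      by (simp add: distrib_left mult.assoc c1[of "word_deriv v"]
          c1[of "Poly_Mapping.single (map Inr v) 1"])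
    finally show ?case using add
      by (simp add: free_deriv_add base_poly_add distrib_left add_ac)
  qed
  then show ?case using add
    by (simp add: free_deriv_add base_poly_add distrib_right add_ac)
qed

lemma hypo_word_eq_iff:
  "hypo_word j (w, v) = hypo_word j' (w', v') \<longleftrightarrow> j = j' \<and> w = w' \<and> v = v'"
proof -
  have "map Inr a @ Inl j # map Inr v = map Inr a' @ Inl j' # map Inr v' \<longleftrightarrow>
      a = a' \<and> j = j' \<and> v = v'" for a a' :: "'a list"
  proof (induction a arbitrary: a')
    case Nil
    show ?case by (cases a') (auto simp: inj_map_eq_map)
  next
    case (Cons x a)
    then show ?case by (cases a') auto
  qed
  then show ?thesis by (auto simp: hypo_word_def)
qed

lemma inj_hypo_word: "inj (hypo_word j)"
  by (auto simp: inj_on_def hypo_word_eq_iff)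

lemma lookup_hypo_Jacobian:
  "Poly_Mapping.lookup (hypo_Jacobian p $ j $ i) wv =
   Poly_Mapping.lookup (free_deriv (p i)) (hypo_word j wv)"
  by (simp add: hypo_Jacobian_def map_key.rep_eq[OF inj_hypo_word])

lemma keys_hypo_Jacobian:
  "Poly_Mapping.keys (hypo_Jacobian p $ j $ i) =
   hypo_word j -` Poly_Mapping.keys (free_deriv (p i))"
  by (simp add: hypo_Jacobian_def keys_map_key[OF inj_hypo_word])

lemma keys_word_deriv: "Poly_Mapping.keys (word_deriv w) \<subseteq> (\<Union>j. range (hypo_word j))"
proof (induction w)
  case (Cons i w)
  have 1: "Inl i # map Inr w = hypo_word i ([], w)" by (simp add: hypo_word_def)
  have 2: "Inr i # hypo_word j (u, v) = hypo_word j (u @ [i], v)" for j u v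
    by (simp add: hypo_word_def)
  have "Poly_Mapping.keys (Poly_Mapping.single [Inr i] 1 * word_deriv w)
      \<subseteq> (\<lambda>k. Inr i # k) ` Poly_Mapping.keys (word_deriv w)"
    using keys_mult[of "Poly_Mapping.single [Inr i] (1::complex)" "word_deriv w"]
    by (auto simp: plus_list_def)
  also have "\<dots> \<subseteq> (\<Union>j. range (hypo_word j))"
  proof
    fix k assume "k \<in> (\<lambda>k. Inr i # k) ` Poly_Mapping.keys (word_deriv w)"
    then obtain k' where k': "k' \<in> Poly_Mapping.keys (word_deriv w)" "k = Inr i # k'" by blast
    with Cons.IH obtain j u v where "k' = hypo_word j (u, v)" by (auto 0 3)
    with k' 2 have "k = hypo_word j (u @ [i], v)" by simp
    then show "k \<in> (\<Union>j. range (hypo_word j))" by blast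
  qed
  finally have "Poly_Mapping.keys (Poly_Mapping.single [Inr i] 1 * word_deriv w)
      \<subseteq> (\<Union>j. range (hypo_word j))" .
  moreover have "Poly_Mapping.keys (Poly_Mapping.single [Inl i] 1 *
      Poly_Mapping.single (map Inr w) (1::complex)) \<subseteq> (\<Union>j. range (hypo_word j))"
    using 1 by (auto simp: mult_single plus_list_def)
  ultimately show ?case
    unfolding word_deriv.simps by (intro subset_trans[OF Poly_Mapping.keys_add] Un_least)
qed simp

lemma keys_free_deriv: "Poly_Mapping.keys (free_deriv f) \<subseteq> (\<Union>j. range (hypo_word j))"
proof (induction f rule: poly_mapping_add_induct)
  case (add w c f)
  have "Poly_Mapping.keys (Poly_Mapping.single 0 c * word_deriv w) \<subseteq> (\<Union>j. range (hypo_word j))"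
  proof -
    have "Poly_Mapping.keys (Poly_Mapping.single 0 c * word_deriv w)
        \<subseteq> Poly_Mapping.keys (word_deriv w)"
      using keys_mult[of "Poly_Mapping.single 0 c" "word_deriv w"]
      by (auto split: if_splits)
    then show ?thesis using keys_word_deriv[of w] by (rule subset_trans)
  qed
  then show ?case
    using add unfolding free_deriv_add free_deriv_single
    by (intro subset_trans[OF Poly_Mapping.keys_add] Un_least)
qed (simp add: free_deriv_def)

text \<open>The evaluation identity that characterises the hypo-Jacobian matrix. Row vectors of length
  \<open>n\<^sup>2\<close> are \<open>1 \<times> n\<^sup>2\<close> matrices; the product of the concatenated row vector with the evaluated
  block matrix is written blockwise.\<close>

definition row_vec :: "nat \<Rightarrow> complex mat \<Rightarrow> complex mat" where
  "row_vec n A = mat 1 (n * n) (\<lambda>(_, r). A $$ (r div n, r mod n))"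

definition kron :: "complex mat \<Rightarrow> complex mat \<Rightarrow> complex mat" where
  "kron A B = mat (dim_row A * dim_row B) (dim_col A * dim_col B)
     (\<lambda>(r, s). A $$ (r div dim_row B, s div dim_col B) * B $$ (r mod dim_row B, s mod dim_col B))"

definition is_hypo_Jacobian ::
  "('a::finite \<Rightarrow> 'a free_poly) \<Rightarrow> 'a bipartite_poly ^ 'a ^ 'a \<Rightarrow> bool" where
  "is_hypo_Jacobian p J \<longleftrightarrow>
     (\<forall>n\<ge>1. \<forall>X\<in>mat_tuples n. \<forall>Y\<in>mat_tuples n. \<forall>i. \<forall>r<n * n.
        row_vec n (poly_eval n (case_sum X Y) (free_deriv (p i))) $$ (0, r) =
        (\<Sum>j\<in>UNIV. (row_vec n (X j) *
           bipartite_eval (n * n) (\<lambda>k. kron (transpose_mat (Y k)) (1\<^sub>m n))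
             (\<lambda>k. kron (1\<^sub>m n) (Y k)) (J $ j $ i)) $$ (0, r)))"

lemma word_eval_carrier:
  "X \<in> mat_tuples n \<Longrightarrow> word_eval n X w \<in> carrier_mat n n"
  by (induction w) (auto simp: mat_tuples_def intro!: mult_carrier_mat[of _ n n])

lemma word_eval_append:
  assumes "X \<in> mat_tuples n"
  shows "word_eval n X (v @ w) = word_eval n X v * word_eval n X w"
proof (induction v)
  case Nil
  show ?case using word_eval_carrier[OF assms, of w] by simp
next
  case (Cons i v)
  have "X i \<in> carrier_mat n n" using assms by (simp add: mat_tuples_def)
  then show ?case
    using Cons word_eval_carrier[OF assms] by (simp add: assoc_mult_mat[of _ n n _ n _ n])
qed

lemma case_sum_mat_tuples:
  "X \<in> mat_tuples n \<Longrightarrow> Y \<in> mat_tuples n \<Longrightarrow> case_sum X Y \<in> mat_tuples n"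
  by (auto simp: mat_tuples_def split: sum.splits)

lemma word_eval_map_Inr: "word_eval n (case_sum X Y) (map Inr w) = word_eval n Y w"
  by (induction w) auto

lemma word_eval_hypo_word:
  assumes "X \<in> mat_tuples n" "Y \<in> mat_tuples n"
  shows "word_eval n (case_sum X Y) (hypo_word j (w, v)) =
     word_eval n Y (rev w) * (X j * word_eval n Y v)"
  by (simp add: hypo_word_def word_eval_append[OF case_sum_mat_tuples[OF assms]]
      word_eval_map_Inr)

lemma div_mod_less_square:
  assumes "r < n * (n::nat)"
  shows "r div n < n" "r mod n < n" "0 < n"
proof -
  show "0 < n" using assms by (cases n) auto
  then show "r div n < n" "r mod n < n"
    using assms by (auto simp: less_mult_imp_div_less)
qed

lemma sum_div_mod:
  fixes n :: nat
  shows "(\<Sum>r<n * n. f (r div n) (r mod n)) = (\<Sum>k<n. \<Sum>l<n. f k l)"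
proof -
  have "(\<Sum>k<n. \<Sum>l<n. f k l) = (\<Sum>(k, l)\<in>{..<n} \<times> {..<n}. f k l)"
    by (simp add: sum.cartesian_product)
  also have "\<dots> = (\<Sum>r<n * n. f (r div n) (r mod n))"
  proof (rule sum.reindex_bij_witness[of _ "\<lambda>r. (r div n, r mod n)" "\<lambda>(k, l). k * n + l"])
    fix kl assume "kl \<in> {..<n} \<times> {..<n}"
    then obtain k l where kl: "kl = (k, l)" "k < n" "l < n" by auto
    have "k * n + l < Suc k * n" using kl by simp
    also have "\<dots> \<le> n * n" using kl by (intro mult_right_mono) auto
    finally show "(case kl of (k, l) \<Rightarrow> k * n + l) \<in> {..<n * n}" using kl by simp
  qed (auto simp: div_mod_less_square)
  finally show ?thesis by simp
qed

lemma kron_carrier: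
  "A \<in> carrier_mat n n \<Longrightarrow> B \<in> carrier_mat n n \<Longrightarrow> kron A B \<in> carrier_mat (n * n) (n * n)"
  by (rule carrier_matI) (auto simp: kron_def)

lemma kron_index:
  assumes "A \<in> carrier_mat n n" "B \<in> carrier_mat n n" "r < n * n" "s < n * n"
  shows "kron A B $$ (r, s) = A $$ (r div n, s div n) * B $$ (r mod n, s mod n)"
  using assms by (simp add: kron_def)

lemma mat_mult_index:
  fixes A B :: "complex mat"
  assumes "A \<in> carrier_mat m n" "B \<in> carrier_mat n k" "r < m" "s < k"
  shows "(A * B) $$ (r, s) = (\<Sum>t<n. A $$ (r, t) * B $$ (t, s))"
  using assms by (simp add: scalar_prod_def lessThan_atLeast0)

lemma kron_mult:
  assumes "A \<in> carrier_mat n n" "B \<in> carrier_mat n n" "C \<in> carrier_mat n n" "D \<in> carrier_mat n n"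
  shows "kron A B * kron C D = kron (A * C) (B * D)"
proof (rule eq_matI)
  note AC = mult_carrier_mat[OF assms(1,3)] and BD = mult_carrier_mat[OF assms(2,4)]
  note K = kron_carrier[OF assms(1,2)] kron_carrier[OF assms(3,4)] kron_carrier[OF AC BD]
  fix r s assume "r < dim_row (kron (A * C) (B * D))" "s < dim_col (kron (A * C) (B * D))"
  then have rs: "r < n * n" "s < n * n" using K by auto
  note dm = div_mod_less_square[OF rs(1)] div_mod_less_square[OF rs(2)]
  have "(kron A B * kron C D) $$ (r, s) =
      (\<Sum>t<n * n. A $$ (r div n, t div n) * B $$ (r mod n, t mod n) *
         (C $$ (t div n, s div n) * D $$ (t mod n, s mod n)))"
    using rs by (subst mat_mult_index[OF K(1,2) rs])
      (intro sum.cong refl, simp add: kron_index[OF assms(1,2)] kron_index[OF assms(3,4)])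
  also have "\<dots> = (\<Sum>k<n. \<Sum>l<n. A $$ (r div n, k) * B $$ (r mod n, l) *
         (C $$ (k, s div n) * D $$ (l, s mod n)))"
    by (rule sum_div_mod)
  also have "\<dots> = (\<Sum>k<n. A $$ (r div n, k) * C $$ (k, s div n)) *
       (\<Sum>l<n. B $$ (r mod n, l) * D $$ (l, s mod n))"
    unfolding sum_product by (intro sum.cong refl) (simp add: mult_ac)
  also have "\<dots> = kron (A * C) (B * D) $$ (r, s)"
    unfolding kron_index[OF AC BD rs]
    using dm by (simp add: mat_mult_index[OF assms(1,3)] mat_mult_index[OF assms(2,4)])
  finally show "(kron A B * kron C D) $$ (r, s) = kron (A * C) (B * D) $$ (r, s)" .
qed (use assms in \<open>auto simp: kron_def\<close>)

lemma kron_one: "kron (1\<^sub>m n) (1\<^sub>m n) = 1\<^sub>m (n * n)"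
proof (rule eq_matI)
  fix r s assume "r < dim_row (1\<^sub>m (n * n))" "s < dim_col (1\<^sub>m (n * n))"
  then have rs: "r < n * n" "s < n * n" by auto
  have "r = s \<longleftrightarrow> r div n = s div n \<and> r mod n = s mod n"
    by (metis div_mult_mod_eq)
  then show "kron (1\<^sub>m n) (1\<^sub>m n) $$ (r, s) = (1\<^sub>m (n * n) :: complex mat) $$ (r, s)"
    using rs div_mod_less_square[OF rs(1)] div_mod_less_square[OF rs(2)]
    by (auto simp: kron_index[of _ n])
qed (auto simp: kron_def)

lemma word_eval_kron_left:
  assumes Y: "Y \<in> mat_tuples n"
  shows "word_eval (n * n) (\<lambda>k. kron (transpose_mat (Y k)) (1\<^sub>m n)) w =
    kron (transpose_mat (word_eval n Y (rev w))) (1\<^sub>m n)"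
proof (induction w)
  case Nil
  show ?case by (simp add: kron_one)
next
  case (Cons i w)
  have Yi: "Y i \<in> carrier_mat n n" using Y by (simp add: mat_tuples_def)
  have W: "word_eval n Y (rev w) \<in> carrier_mat n n" by (rule word_eval_carrier[OF Y])
  have "word_eval n Y (rev w @ [i]) = word_eval n Y (rev w) * Y i"
    using Yi by (simp add: word_eval_append[OF Y])
  then show ?case
    using Cons Yi W by (simp add: kron_mult[of _ n] transpose_mult[OF W Yi])
qed

lemma word_eval_kron_right:
  assumes Y: "Y \<in> mat_tuples n"
  shows "word_eval (n * n) (\<lambda>k. kron (1\<^sub>m n) (Y k)) v = kron (1\<^sub>m n) (word_eval n Y v)"
proof (induction v)
  case Nil
  show ?case by (simp add: kron_one)
next
  case (Cons i v)
  have Yi: "Y i \<in> carrier_mat n n" using Y by (simp add: mat_tuples_def)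
  have W: "word_eval n Y v \<in> carrier_mat n n" by (rule word_eval_carrier[OF Y])
  show ?case using Cons Yi W by (simp add: kron_mult[of _ n])
qed

lemma bipartite_eval_kron_index:
  assumes Y: "Y \<in> mat_tuples n" and rs: "r < n * n" "s < n * n"
  shows "bipartite_eval (n * n) (\<lambda>k. kron (transpose_mat (Y k)) (1\<^sub>m n))
       (\<lambda>k. kron (1\<^sub>m n) (Y k)) f $$ (r, s) =
     (\<Sum>(w, v)\<in>Poly_Mapping.keys f. Poly_Mapping.lookup f (w, v) *
        (word_eval n Y (rev w) $$ (s div n, r div n) * word_eval n Y v $$ (r mod n, s mod n)))"
proof -
  have *: "(kron (transpose_mat (word_eval n Y (rev w))) (1\<^sub>m n) *
       kron (1\<^sub>m n) (word_eval n Y v)) $$ (r, s) =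
     word_eval n Y (rev w) $$ (s div n, r div n) * word_eval n Y v $$ (r mod n, s mod n)" for w v
    using rs div_mod_less_square[OF rs(1)] div_mod_less_square[OF rs(2)]
      word_eval_carrier[OF Y, of "rev w"] word_eval_carrier[OF Y, of v]
    by (simp add: kron_mult[of _ n] kron_index[of _ n])
  show ?thesis
    using rs by (simp add: bipartite_eval_def word_eval_kron_left[OF Y]
        word_eval_kron_right[OF Y] *)
qed

lemma row_vec_mult_index:
  assumes "A \<in> carrier_mat (n * n) (n * n)" "r < n * n"
  shows "(row_vec n X * A) $$ (0, r) = (\<Sum>t<n * n. X $$ (t div n, t mod n) * A $$ (t, r))"
  by (subst mat_mult_index[of _ 1 "n * n" _ "n * n"]) (use assms in \<open>auto simp: row_vec_def\<close>)

lemma bipartite_eval_carrier: "bipartite_eval n Z Y f \<in> carrier_mat n n"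
  by (simp add: bipartite_eval_def)

lemma hypo_Jacobian_identity:
  fixes p :: "'a::finite \<Rightarrow> 'a free_poly"
  shows "is_hypo_Jacobian p (hypo_Jacobian p)"
  unfolding is_hypo_Jacobian_def
proof (intro allI ballI impI)
  fix n r :: nat and X Y :: "'a \<Rightarrow> complex mat" and i :: 'a
  assume X: "X \<in> mat_tuples n" and Y: "Y \<in> mat_tuples n" and r: "r < n * n"
  let ?D = "free_deriv (p i)" and ?J = "\<lambda>j. hypo_Jacobian p $ j $ i"
  let ?e = "\<lambda>w. Poly_Mapping.lookup ?D w * word_eval n (case_sum X Y) w $$ (r div n, r mod n)"
  note dm = div_mod_less_square[OF r]
  have keys: "Poly_Mapping.keys ?D = (\<Union>j. hypo_word j ` Poly_Mapping.keys (?J j))"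
    using keys_free_deriv[of "p i"] by (auto simp: keys_hypo_Jacobian)
  have "row_vec n (poly_eval n (case_sum X Y) ?D) $$ (0, r) = (\<Sum>w\<in>Poly_Mapping.keys ?D. ?e w)"
    using r dm by (simp add: row_vec_def poly_eval_def)
  also have "\<dots> = (\<Sum>j\<in>UNIV. \<Sum>w\<in>hypo_word j ` Poly_Mapping.keys (?J j). ?e w)"
    unfolding keys by (rule sum.UNION_disjoint) (auto simp: hypo_word_eq_iff)
  also have "\<dots> = (\<Sum>j\<in>UNIV. \<Sum>wv\<in>Poly_Mapping.keys (?J j). ?e (hypo_word j wv))"
    by (intro sum.cong refl, subst sum.reindex) (auto intro: inj_on_subset[OF inj_hypo_word])
  also have "\<dots> = (\<Sum>j\<in>UNIV. (row_vec n (X j) *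
           bipartite_eval (n * n) (\<lambda>k. kron (transpose_mat (Y k)) (1\<^sub>m n))
             (\<lambda>k. kron (1\<^sub>m n) (Y k)) (?J j)) $$ (0, r))"
  proof (intro sum.cong refl)
    fix j
    have Xj: "X j \<in> carrier_mat n n" using X by (simp add: mat_tuples_def)
    have e: "word_eval n (case_sum X Y) (hypo_word j (w, v)) $$ (r div n, r mod n) =
      (\<Sum>t<n * n. X j $$ (t div n, t mod n) * (word_eval n Y (rev w) $$ (r div n, t div n) *
          word_eval n Y v $$ (t mod n, r mod n)))" for w v
    proof -
      note W = word_eval_carrier[OF Y, of "rev w"] and V = word_eval_carrier[OF Y, of v]
      have "word_eval n (case_sum X Y) (hypo_word j (w, v)) $$ (r div n, r mod n) =
        (\<Sum>k<n. word_eval n Y (rev w) $$ (r div n, k) *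
           (\<Sum>l<n. X j $$ (k, l) * word_eval n Y v $$ (l, r mod n)))"
        using dm by (simp add: word_eval_hypo_word[OF X Y]
            mat_mult_index[OF W mult_carrier_mat[OF Xj V]] mat_mult_index[OF Xj V])
      also have "\<dots> = (\<Sum>k<n. \<Sum>l<n. X j $$ (k, l) * (word_eval n Y (rev w) $$ (r div n, k) *
          word_eval n Y v $$ (l, r mod n)))"
        by (simp add: sum_distrib_left mult_ac)
      also have "\<dots> = (\<Sum>t<n * n. X j $$ (t div n, t mod n) *
          (word_eval n Y (rev w) $$ (r div n, t div n) * word_eval n Y v $$ (t mod n, r mod n)))"
        by (rule sum_div_mod[symmetric])
      finally show ?thesis .
    qed
    have "(\<Sum>wv\<in>Poly_Mapping.keys (?J j). ?e (hypo_word j wv)) =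
      (\<Sum>t<n * n. X j $$ (t div n, t mod n) * (\<Sum>(w, v)\<in>Poly_Mapping.keys (?J j).
         Poly_Mapping.lookup (?J j) (w, v) * (word_eval n Y (rev w) $$ (r div n, t div n) *
          word_eval n Y v $$ (t mod n, r mod n))))"
      unfolding sum_distrib_left
      by (subst sum.swap, intro sum.cong refl)
         (auto simp: e lookup_hypo_Jacobian sum_distrib_left mult_ac intro!: sum.cong)
    also have "\<dots> = (row_vec n (X j) *
           bipartite_eval (n * n) (\<lambda>k. kron (transpose_mat (Y k)) (1\<^sub>m n))
             (\<lambda>k. kron (1\<^sub>m n) (Y k)) (?J j)) $$ (0, r)"
      by (subst row_vec_mult_index[OF bipartite_eval_carrier r])
         (auto simp: bipartite_eval_kron_index[OF Y _ r])
    finally show "(\<Sum>wv\<in>Poly_Mapping.keys (?J j). ?e (hypo_word j wv)) = \<dots>" .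
  qed
  finally show "row_vec n (poly_eval n (case_sum X Y) ?D) $$ (0, r) = \<dots>" .
qed

text \<open>Uniqueness: the shift matrices along a word \<open>s\<close> separate the monomials.\<close>

definition path_tuple :: "'a list \<Rightarrow> 'a \<Rightarrow> complex mat" where
  "path_tuple s i = mat (Suc (length s)) (Suc (length s))
     (\<lambda>(a, b). if b = Suc a \<and> s ! a = i then 1 else 0)"

lemma path_tuple_in: "path_tuple s \<in> mat_tuples (Suc (length s))"
  by (simp add: path_tuple_def mat_tuples_def)

lemma word_eval_path_tuple:
  assumes "a \<le> length s" "b \<le> length s"
  shows "word_eval (Suc (length s)) (path_tuple s) v $$ (a, b) =
    (if b = a + length v \<and> v = take (length v) (drop a s) then 1 else 0)"
  using assms(1)
proof (induction v arbitrary: a)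
  case Nil
  then show ?case using assms(2) by auto
next
  case (Cons i v)
  let ?n = "Suc (length s)"
  let ?E = "word_eval ?n (path_tuple s) v"
  have P: "path_tuple s i \<in> carrier_mat ?n ?n" by (simp add: path_tuple_def)
  have E: "?E \<in> carrier_mat ?n ?n" by (rule word_eval_carrier[OF path_tuple_in])
  have "word_eval ?n (path_tuple s) (i # v) $$ (a, b) =
      (\<Sum>t<?n. path_tuple s i $$ (a, t) * ?E $$ (t, b))"
    using Cons.prems assms(2) by (simp only: word_eval.simps) (subst mat_mult_index[OF P E], auto)
  also have "\<dots> = (\<Sum>t<?n. if t = Suc a then (if s ! a = i then ?E $$ (Suc a, b) else 0) else 0)"
    using Cons.prems by (intro sum.cong refl) (auto simp: path_tuple_def)
  also have "\<dots> = (if a < length s \<and> s ! a = i then ?E $$ (Suc a, b) else 0)"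
    by (simp add: sum.delta)
  also have "\<dots> = (if b = a + length (i # v) \<and> i # v = take (length (i # v)) (drop a s)
      then 1 else 0)"
  proof (cases "a < length s")
    case True
    then have "drop a s = s ! a # drop (Suc a) s" by (simp add: Cons_nth_drop_Suc)
    then show ?thesis using Cons.IH[of "Suc a"] True by auto
  next
    case False
    then show ?thesis by simp
  qed
  finally show ?case .
qed

lemma bipartite_coeff:
  fixes w0 v0 :: "'a list"
  defines "s \<equiv> v0 @ rev w0"
  defines "n \<equiv> Suc (length s)"
  shows "bipartite_eval (n * n) (\<lambda>k. kron (transpose_mat (path_tuple s k)) (1\<^sub>m n))
       (\<lambda>k. kron (1\<^sub>m n) (path_tuple s k)) f $$ (length s * n, length v0 * n + length v0) =
     Poly_Mapping.lookup f (w0, v0)"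
proof -
  have Y: "path_tuple s \<in> mat_tuples n" unfolding n_def by (rule path_tuple_in)
  have l: "length v0 < n" "length s < n" "length v0 \<le> length s" by (auto simp: n_def s_def)
  have b: "k * n + m < n * n" if "k < n" "m < n" for k m
  proof -
    have "k * n + m < Suc k * n" using that by simp
    also have "\<dots> \<le> n * n" using that by (intro mult_right_mono) auto
    finally show ?thesis .
  qed
  have r: "length s * n < n * n" using b[of "length s" 0] l by simp
  have c: "length v0 * n + length v0 < n * n" using b l by simp
  have dm: "length s * n div n = length s" "length s * n mod n = 0"
    "(length v0 * n + length v0) div n = length v0" "(length v0 * n + length v0) mod n = length v0"
    using l by auto
  have W: "word_eval n (path_tuple s) (rev w) $$ (length v0, length s) =
      (if w = w0 then 1 else 0)" for w
  proof -
    have "drop (length v0) s = rev w0" "length s = length v0 + length w0" by (simp_all add: s_def)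
    moreover have "length w0 = length w \<and> rev w = take (length w) (rev w0) \<longleftrightarrow> w = w0"
      by auto
    ultimately show ?thesis
      unfolding n_def word_eval_path_tuple[OF l(3) order_refl] by auto
  qed
  have V: "word_eval n (path_tuple s) v $$ (0, length v0) = (if v = v0 then 1 else 0)" for v
    unfolding n_def word_eval_path_tuple[OF le0 l(3)] by (auto simp: s_def)
  have "bipartite_eval (n * n) (\<lambda>k. kron (transpose_mat (path_tuple s k)) (1\<^sub>m n))
       (\<lambda>k. kron (1\<^sub>m n) (path_tuple s k)) f $$ (length s * n, length v0 * n + length v0) =
     (\<Sum>wv\<in>Poly_Mapping.keys f. if wv = (w0, v0) then Poly_Mapping.lookup f wv else 0)"
    unfolding bipartite_eval_kron_index[OF Y r c] dm W V
    by (intro sum.cong refl) (auto split: if_splits)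
  also have "\<dots> = Poly_Mapping.lookup f (w0, v0)"
    by (simp add: sum.delta' in_keys_iff)
  finally show ?thesis .
qed

lemma is_hypo_Jacobian_eval:
  assumes J: "is_hypo_Jacobian p J" and n: "n \<ge> 1" and Y: "Y \<in> mat_tuples n"
    and t: "t < n * n" and r: "r < n * n"
  shows "bipartite_eval (n * n) (\<lambda>k. kron (transpose_mat (Y k)) (1\<^sub>m n))
       (\<lambda>k. kron (1\<^sub>m n) (Y k)) (J $ j $ i) $$ (t, r) =
     row_vec n (poly_eval n (case_sum (\<lambda>j'. mat n n (\<lambda>(a, b).
        if j' = j \<and> a = t div n \<and> b = t mod n then 1 else 0)) Y) (free_deriv (p i))) $$ (0, r)"
    (is "?B j $$ (t, r) = row_vec n (poly_eval n (case_sum ?X Y) _) $$ (0, r)")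
proof -
  have X: "?X \<in> mat_tuples n" by (simp add: mat_tuples_def)
  have *: "(row_vec n (?X j') * ?B j') $$ (0, r) = (if j' = j then ?B j $$ (t, r) else 0)" for j'
  proof -
    have "(row_vec n (?X j') * ?B j') $$ (0, r) =
        (\<Sum>u<n * n. if u = t then (if j' = j then ?B j $$ (t, r) else 0) else 0)"
      unfolding row_vec_mult_index[OF bipartite_eval_carrier r]
    proof (intro sum.cong refl)
      fix u assume "u \<in> {..<n * n}"
      then have u: "u div n < n" "u mod n < n" using div_mod_less_square by auto
      have "u = t \<longleftrightarrow> u div n = t div n \<and> u mod n = t mod n" by (metis div_mult_mod_eq)
      then show "?X j' $$ (u div n, u mod n) * ?B j' $$ (u, r) =
          (if u = t then (if j' = j then ?B j $$ (t, r) else 0) else 0)"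
        using u by auto
    qed
    then show ?thesis using t by (simp add: sum.delta)
  qed
  have "row_vec n (poly_eval n (case_sum ?X Y) (free_deriv (p i))) $$ (0, r) =
      (\<Sum>j'\<in>UNIV. (row_vec n (?X j') * ?B j') $$ (0, r))"
    using J n X Y r unfolding is_hypo_Jacobian_def by blast
  also have "\<dots> = ?B j $$ (t, r)" unfolding * by simp
  finally show ?thesis by simp
qed

theorem is_hypo_Jacobian_iff:
  fixes p :: "'a::finite \<Rightarrow> 'a free_poly"
  shows "is_hypo_Jacobian p J \<longleftrightarrow> J = hypo_Jacobian p"
proof
  assume J: "is_hypo_Jacobian p J"
  show "J = hypo_Jacobian p"
  proof (simp only: Finite_Cartesian_Product.vec_eq_iff, intro allI poly_mapping_eqI)
    fix j i :: 'a and wv :: "'a list \<times> 'a list"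
    obtain w v where wv: "wv = (w, v)" by (cases wv)
    let ?s = "v @ rev w"
    let ?n = "Suc (length ?s)"
    have n: "?n \<ge> 1" by simp
    have t: "length ?s * ?n < ?n * ?n" by simp
    have "length v * ?n + length v < Suc (length v) * ?n" by simp
    also have "\<dots> \<le> ?n * ?n" by (intro mult_right_mono) auto
    finally have r: "length v * ?n + length v < ?n * ?n" .
    show "Poly_Mapping.lookup (J $ j $ i) wv = Poly_Mapping.lookup (hypo_Jacobian p $ j $ i) wv"
      unfolding wv bipartite_coeff[symmetric]
        is_hypo_Jacobian_eval[OF J n path_tuple_in t r]
        is_hypo_Jacobian_eval[OF hypo_Jacobian_identity n path_tuple_in t r] ..
  qed
qed (simp add: hypo_Jacobian_identity)

end

theory Submission
  imports Defs "HOL-Library.Function_Algebras"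
begin

text \<open>Why injectivity and invertibility agree. At a block upper triangular tuple with diagonal blocks
\<open>Z\<close>, \<open>Y\<close> and corner \<open>h\<close>, the upper right block of \<open>p\<close> is linear in \<open>h\<close>; as a row vector it is
\<open>h\<close> times the value of the hypo-Jacobian at \<open>(Z\<^sup>T \<otimes> 1, 1 \<otimes> Y)\<close>, and for \<open>h = Z - Y\<close> it equals
\<open>p(Z) - p(Y)\<close>. So an inverse of the hypo-Jacobian forces \<open>h = 0\<close> whenever \<open>p(Z) = p(Y)\<close>
(\<open>injective_if_right_inverse\<close>), and conversely an injective \<open>p\<close> makes all values of the
hypo-Jacobian at tuples \<open>(Z \<otimes> 1, 1 \<otimes> Y)\<close>, of all sizes \<open>n\<close> and \<open>r\<close>, nonsingular
(\<open>row_nonsingular_if_injective\<close>).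

The work is to pass from pointwise nonsingularity to an inverse with polynomial entries. After
normalising the constant term to the identity, the matrix is linearized: it is invertible if and
only if a pencil \<open>L = 1 - \<Sum>\<^sub>i M\<^sub>i z\<^sub>i - \<Sum>\<^sub>j V\<^sub>j y\<^sub>j\<close> with complex coefficient matrices is, and \<open>L\<close> inherits
nonsingularity at all points (\<open>pencil_nonsingular\<close>).

A pencil \<open>1 - \<Sum>\<^sub>j T\<^sub>j y\<^sub>j\<close> over the complex numbers that is nonsingular at all points has jointly
nilpotent coefficients, all words of length the size \<open>d\<close> of the \<open>T\<^sub>j\<close> vanishing
(\<open>nilpotent_if_pencil_nonsingular\<close>), so its inverse is a finite geometric series. Putting \<open>y = 0\<close>
in \<open>L\<close>, this gives a polynomial inverse \<open>A\<close> of \<open>1 - \<Sum>\<^sub>i M\<^sub>i z\<^sub>i\<close>, and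
\<open>L = A\<^sup>-\<^sup>1 (1 - \<Sum>\<^sub>j T\<^sub>j y\<^sub>j)\<close> where \<open>T\<^sub>j = A V\<^sub>j\<close> has entries in the free algebra in \<open>z\<close>.

At \<open>z = Z\<close> with \<open>Z\<close> of size \<open>n\<close>, the same result only says that words of length \<open>d n\<close> in the
\<open>T\<^sub>j(Z)\<close> vanish, a bound that grows with \<open>n\<close>. The decisive step is that words of length \<open>d\<close> vanish
already (\<open>uniform_nilpotency\<close>). In a division ring this would be the usual count of independent
vectors in a space of dimension \<open>d\<close>. The role of the division ring is played by weighted cyclic
shifts of size \<open>n\<close>: on this family of tuples, a polynomial that does not vanish identically takes
an invertible value somewhere (\<open>exists_injective_shift\<close>), which turns one nonzero word of
length \<open>k\<close> into a block triangular matrix of rank \<open>(k + 1) n\<close> factoring through a space of dimension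
\<open>d n\<close>.\<close>

section \<open>Kernels of finite linear systems\<close>

text \<open>Unknowns and equations are indexed by arbitrary finite sets because the systems below live on sets
such as \<open>{..k} \<times> {..<n}\<close>, whose size is not that of a type. The induction uses each
equation to eliminate one unknown.\<close>

lemma nontrivial_kernel:
  fixes M :: "'e \<Rightarrow> 'i \<Rightarrow> 'f::field"
  assumes "finite E" "finite I" "card E < card I"
  shows "\<exists>c. (\<exists>i\<in>I. c i \<noteq> 0) \<and> (\<forall>e\<in>E. (\<Sum>i\<in>I. M e i * c i) = 0)"
  using assms
proof (induction E arbitrary: I M rule: finite_induct)
  case empty
  then have "I \<noteq> {}" by auto
  then show ?case by (intro exI[of _ "\<lambda>_. 1"]) auto
next
  case (insert e E)
  show ?case
  proof (cases "\<forall>i\<in>I. M e i = 0")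
    case True
    have "card E < card I" using insert.hyps insert.prems by simp
    with insert.IH[OF insert.prems(1)] obtain c
      where "\<exists>i\<in>I. c i \<noteq> 0" "\<forall>e\<in>E. (\<Sum>i\<in>I. M e i * c i) = 0" by metis
    with True show ?thesis by (intro exI[of _ c]) auto
  next
    case False
    then obtain k where k: "k \<in> I" "M e k \<noteq> 0" by blast
    let ?I = "I - {k}"
    have "card E < card ?I" using insert.hyps insert.prems k by simp
    then obtain c where c: "\<exists>i\<in>?I. c i \<noteq> 0"
      "\<And>e'. e' \<in> E \<Longrightarrow> (\<Sum>i\<in>?I. (M e' i - M e' k * M e i / M e k) * c i) = 0"
      using insert.IH[of ?I "\<lambda>e' i. M e' i - M e' k * M e i / M e k"] insert.prems by auto
    \<comment> \<open>The value of the eliminated unknown that satisfies equation \<open>e\<close>.\<close>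
    define ck where "ck = - (\<Sum>i\<in>?I. M e i * c i) / M e k"
    have split: "(\<Sum>i\<in>I. M e' i * (c(k := ck)) i) = M e' k * ck + (\<Sum>i\<in>?I. M e' i * c i)" for e'
      using k insert.prems(1) by (subst sum.remove[of _ k]) auto
    have "(\<Sum>i\<in>I. M e' i * (c(k := ck)) i) = 0" if e': "e' \<in> insert e E" for e'
    proof (cases "e' = e")
      case True
      show ?thesis using k unfolding True split by (simp add: ck_def)
    next
      case False
      have "(\<Sum>i\<in>?I. M e' i * c i) = (\<Sum>i\<in>?I. M e' k * M e i / M e k * c i)"
        using c(2)[of e'] False e' by (simp add: left_diff_distrib sum_subtractf)
      also have "\<dots> = M e' k / M e k * (\<Sum>i\<in>?I. M e i * c i)"
        by (simp add: sum_distrib_left mult_ac)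
      finally show ?thesis unfolding split by (simp add: ck_def)
    qed
    moreover have "\<exists>i\<in>I. (c(k := ck)) i \<noteq> 0" using c(1) by auto
    ultimately show ?thesis by blast
  qed
qed

text \<open>A relation \<open>x\<close> among the columns expresses column \<open>k\<close> through the others, so a row vector that
annihilates the others annihilates all of them; and such a row vector exists because there is one
equation less than there are unknowns.\<close>

lemma row_kernel_imp_column_kernel:
  fixes A :: "'d \<Rightarrow> 'd \<Rightarrow> 'f::field"
  assumes D: "finite D"
    and rows: "\<And>y. (\<And>j. j \<in> D \<Longrightarrow> (\<Sum>i\<in>D. y i * A i j) = 0) \<Longrightarrow> \<forall>i\<in>D. y i = 0"
    and x: "\<And>i. i \<in> D \<Longrightarrow> (\<Sum>j\<in>D. A i j * x j) = 0"
  shows "\<forall>i\<in>D. x i = 0"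
proof (rule ccontr)
  assume "\<not> ?thesis"
  then obtain k where k: "k \<in> D" "x k \<noteq> 0" by blast
  have "card (D - {k}) < card D" using k D by (intro card_Diff1_less)
  then obtain y where y: "\<exists>i\<in>D. y i \<noteq> 0" "\<And>j. j \<in> D - {k} \<Longrightarrow> (\<Sum>i\<in>D. A i j * y i) = 0"
    using nontrivial_kernel[of "D - {k}" D "\<lambda>j i. A i j"] D by auto
  have yj: "(\<Sum>i\<in>D. y i * A i j) = 0" if "j \<in> D - {k}" for j
    using y(2)[OF that] by (simp add: mult.commute)
  have "(\<Sum>i\<in>D. y i * A i k) * x k = (\<Sum>j\<in>D. (\<Sum>i\<in>D. y i * A i j) * x j)"
    using D k yj by (subst (2) sum.remove[of _ k]) auto
  also have "\<dots> = (\<Sum>i\<in>D. y i * (\<Sum>j\<in>D. A i j * x j))"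
    by (simp add: sum_distrib_left sum_distrib_right mult.assoc, subst sum.swap, rule refl)
  also have "\<dots> = 0" using x by simp
  finally have "(\<Sum>i\<in>D. y i * A i k) = 0" using k by simp
  with yj have "\<forall>i\<in>D. y i = 0" by (intro rows) auto
  with y(1) show False by blast
qed

section \<open>Words in matrices and evaluation\<close>

text \<open>The matrices are functions on an explicit index set \<open>D\<close>, so that their size may vary inside a
proof and their entries may lie in any ring.\<close>

primrec word_entry :: "'d set \<Rightarrow> ('l \<Rightarrow> 'd \<Rightarrow> 'd \<Rightarrow> 'r::semiring_1) \<Rightarrow> 'l list \<Rightarrow> 'd \<Rightarrow> 'd \<Rightarrow> 'r" where
  "word_entry D T [] x y = (if x = y then 1 else 0)"
| "word_entry D T (l # u) x y = (\<Sum>z\<in>D. T l x z * word_entry D T u z y)"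

lemma word_entry_append:
  assumes "finite D" "x \<in> D"
  shows "word_entry D T (u @ v) x y = (\<Sum>z\<in>D. word_entry D T u x z * word_entry D T v z y)"
  using assms(2)
proof (induction u arbitrary: x)
  case Nil
  then show ?case using assms(1) by (simp add: if_distrib[of "\<lambda>t. t * _"] sum.delta cong: if_cong)
next
  case (Cons l u)
  have "word_entry D T ((l # u) @ v) x y = (\<Sum>z\<in>D. \<Sum>w\<in>D. T l x z * (word_entry D T u z w * word_entry D T v w y))"
    using Cons.IH by (simp add: sum_distrib_left)
  also have "\<dots> = (\<Sum>w\<in>D. word_entry D T (l # u) x w * word_entry D T v w y)"
    by (subst sum.swap) (simp add: sum_distrib_right mult.assoc)
  finally show ?case .
qed

lemma word_entry_single:
  assumes "finite D" "y \<in> D"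
  shows "word_entry D T [l] x y = T l x y"
  using assms by (simp add: if_distrib[of "\<lambda>t. _ * t"] cong: if_cong)

lemma word_entry_snoc:
  assumes "finite D" "x \<in> D" "y \<in> D"
  shows "word_entry D T (u @ [l]) x y = (\<Sum>z\<in>D. word_entry D T u x z * T l z y)"
  unfolding word_entry_append[OF assms(1,2)] by (simp del: word_entry.simps add: word_entry_single[OF assms(1,3)])

lemma word_entry_long_zero:
  assumes D: "finite D" and z: "\<And>u x y. length u = k \<Longrightarrow> x \<in> D \<Longrightarrow> y \<in> D \<Longrightarrow> word_entry D T u x y = 0"
    and u: "length u \<ge> k" and xy: "x \<in> D" "y \<in> D"
  shows "word_entry D T u x y = 0"
proof -
  have "word_entry D T (take k u @ drop k u) x y = 0"
    unfolding word_entry_append[OF D xy(1)] using z[of "take k u"] u xy by simp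
  then show ?thesis by simp
qed

text \<open>If \<open>\<rho>\<close> is a matrix representation of the monoid \<open>'k\<close>, this is its linear extension to the monoid
algebra; free and bipartite polynomials are the cases of words and of pairs of words.\<close>

definition rep_eval :: "('k \<Rightarrow> 'x \<Rightarrow> 'x \<Rightarrow> complex) \<Rightarrow> ('k \<Rightarrow>\<^sub>0 complex) \<Rightarrow> 'x \<Rightarrow> 'x \<Rightarrow> complex" where
  "rep_eval \<rho> f x y = (\<Sum>k\<in>Poly_Mapping.keys f. Poly_Mapping.lookup f k * \<rho> k x y)"

lemma rep_eval_superset:
  assumes "finite S" "Poly_Mapping.keys f \<subseteq> S"
  shows "rep_eval \<rho> f x y = (\<Sum>k\<in>S. Poly_Mapping.lookup f k * \<rho> k x y)"
  unfolding rep_eval_def by (rule sum.mono_neutral_left) (use assms in \<open>auto simp: in_keys_iff\<close>)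

lemma rep_eval_add: "rep_eval \<rho> (f + g) x y = rep_eval \<rho> f x y + rep_eval \<rho> g x y"
proof -
  let ?S = "Poly_Mapping.keys f \<union> Poly_Mapping.keys g"
  have "Poly_Mapping.keys (f + g) \<subseteq> ?S" by (rule Poly_Mapping.keys_add)
  then show ?thesis
    by (simp add: rep_eval_superset[of ?S] lookup_add distrib_right sum.distrib)
qed

lemma rep_eval_zero [simp]: "rep_eval \<rho> 0 x y = 0"
  by (simp add: rep_eval_def)

lemma rep_eval_single: "rep_eval \<rho> (Poly_Mapping.single k c) x y = c * \<rho> k x y"
  by (simp add: rep_eval_superset[of "{k}"])

lemma rep_eval_sum: "rep_eval \<rho> (\<Sum>i\<in>I. f i) x y = (\<Sum>i\<in>I. rep_eval \<rho> (f i) x y)"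
  by (induction I rule: infinite_finite_induct) (simp_all add: rep_eval_add)

lemma rep_eval_mult:
  fixes f g :: "'k::monoid_add \<Rightarrow>\<^sub>0 complex"
  assumes \<rho>: "\<And>k l. \<rho> (k + l) x y = (\<Sum>z\<in>D. \<rho> k x z * \<rho> l z y)"
  shows "rep_eval \<rho> (f * g) x y = (\<Sum>z\<in>D. rep_eval \<rho> f x z * rep_eval \<rho> g z y)"
proof (induction f rule: poly_mapping_add_induct)
  case (add k c f)
  have "rep_eval \<rho> (Poly_Mapping.single k c * g) x y =
      (\<Sum>z\<in>D. rep_eval \<rho> (Poly_Mapping.single k c) x z * rep_eval \<rho> g z y)"
  proof (induction g rule: poly_mapping_add_induct)
    case (add l d g)
    then show ?case
      by (simp add: distrib_left rep_eval_add mult_single rep_eval_single \<rho> sum.distrib sum_distrib_left mult_ac)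
  qed simp
  with add show ?case by (simp add: distrib_right rep_eval_add sum.distrib)
qed simp

section \<open>Nilpotent coefficients of nonsingular pencils\<close>

lemma finite_words_length [simp]: "finite {u :: 'l::finite list. length u = k}"
  using finite_lists_length_eq[of "UNIV :: 'l set" k] by simp

lemma finite_words_less [simp]: "finite {u :: 'l::finite list. length u < k}"
  by (rule finite_subset[OF _ finite_lists_length_le[of "UNIV :: 'l set" k]]) auto

lemma sum_words_Cons:
  fixes f :: "'l::finite list \<Rightarrow> 'a::comm_monoid_add"
  shows "(\<Sum>u | length u = Suc k. f u) = (\<Sum>j\<in>UNIV. \<Sum>u | length u = k. f (j # u))"
proof -
  have "(\<Sum>j\<in>UNIV. \<Sum>u | length u = k. f (j # u)) =
      (\<Sum>(j, u)\<in>UNIV \<times> {u. length u = k}. f (j # u))"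
    by (simp add: sum.cartesian_product)
  also have "\<dots> = (\<Sum>u | length u = Suc k. f u)"
    by (rule sum.reindex_bij_witness[of _ "\<lambda>u. (hd u, tl u)" "\<lambda>(j, u). j # u"])
       (auto simp: length_Suc_conv)
  finally show ?thesis by simp
qed

lemma sum_words_snoc:
  fixes f :: "'l::finite list \<Rightarrow> 'a::comm_monoid_add"
  shows "(\<Sum>u | length u = Suc k. f u) = (\<Sum>j\<in>UNIV. \<Sum>u | length u = k. f (u @ [j]))"
proof -
  have "(\<Sum>j\<in>UNIV. \<Sum>u | length u = k. f (u @ [j])) =
      (\<Sum>(j, u)\<in>UNIV \<times> {u. length u = k}. f (u @ [j]))"
    by (simp add: sum.cartesian_product)
  also have "\<dots> = (\<Sum>u | length u = Suc k. f u)"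
    by (rule sum.reindex_bij_witness[of _ "\<lambda>u. (last u, butlast u)" "\<lambda>(j, u). u @ [j]"])
       (auto simp: length_Suc_conv_rev)
  finally show ?thesis by simp
qed

lemma sum_words_less_Suc:
  fixes f :: "'l::finite list \<Rightarrow> 'a::comm_monoid_add"
  shows "(\<Sum>u | length u < Suc k. f u) = (\<Sum>u | length u < k. f u) + (\<Sum>u | length u = k. f u)"
proof -
  have "{u :: 'l list. length u < Suc k} = {u. length u < k} \<union> {u. length u = k}" by auto
  then show ?thesis by (simp only:) (rule sum.union_disjoint, auto)
qed

lemma sum_words_less_Cons:
  fixes f :: "'l::finite list \<Rightarrow> 'a::comm_monoid_add"
  shows "(\<Sum>u | length u < Suc k. f u) = f [] + (\<Sum>j\<in>UNIV. \<Sum>u | length u < k. f (j # u))"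
  by (induction k)
     (simp_all add: sum_words_less_Suc sum_words_Cons sum.distrib add.assoc)

lemma sum_words_less_snoc:
  fixes f :: "'l::finite list \<Rightarrow> 'a::comm_monoid_add"
  shows "(\<Sum>u | length u < Suc k. f u) = f [] + (\<Sum>j\<in>UNIV. \<Sum>u | length u < k. f (u @ [j]))"
  by (induction k)
     (simp_all add: sum_words_less_Suc sum_words_snoc sum.distrib add.assoc)

text \<open>An argument in the manner of Nakayama's lemma. Let \<open>V k\<close> be the span of the columns of all words of
length \<open>k\<close>. These spaces decrease, hence \<open>V k = V (k + 1)\<close> for some \<open>k\<close> not exceeding the dimension.
Then \<open>V k = \<Sum>\<^sub>j T\<^sub>j V k\<close>, so every member \<open>\<xi>\<^sub>b\<close> of a finite spanning family of \<open>V k\<close> is a combination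
\<open>\<Sum>\<^sub>j \<Sum>\<^sub>c Y\<^sub>j(b, c) T\<^sub>j \<xi>\<^sub>c\<close>. The coefficients form matrices \<open>Y\<^sub>j\<close> for which the family \<open>\<xi>\<close> lies in the
kernel of \<open>1 - \<Sum>\<^sub>j T\<^sub>j \<otimes> Y\<^sub>j\<close>; so \<open>\<xi> = 0\<close> and \<open>V k = 0\<close>.\<close>

theorem nilpotent_if_pencil_nonsingular:
  fixes T :: "'l::finite \<Rightarrow> 'd \<Rightarrow> 'd \<Rightarrow> complex"
  assumes D: "finite D"
    and ns: "\<And>(r::nat) Y x. (\<And>\<gamma> b. \<gamma> \<in> D \<Longrightarrow> b < r \<Longrightarrow>
          x \<gamma> b = (\<Sum>j\<in>UNIV. \<Sum>\<delta>\<in>D. \<Sum>c<r. T j \<gamma> \<delta> * Y j b c * x \<delta> c)) \<Longrightarrow>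
        \<forall>\<gamma>\<in>D. \<forall>b<r. x \<gamma> b = 0"
    and u: "length u \<ge> card D" and \<gamma>\<delta>: "\<gamma> \<in> D" "\<delta> \<in> D"
  shows "word_entry D T u \<gamma> \<delta> = 0"
proof -
  define V where "V k = {v :: 'd \<Rightarrow> complex. \<exists>x. \<forall>\<gamma>\<in>D.
      v \<gamma> = (\<Sum>u | length u = k. \<Sum>\<delta>\<in>D. word_entry D T u \<gamma> \<delta> * x u \<delta>)}" for k
  have V_comb: "v \<in> V k"
    if w: "\<And>i. i \<in> I \<Longrightarrow> w i \<in> V k" and comb: "\<And>\<gamma>. \<gamma> \<in> D \<Longrightarrow> v \<gamma> = (\<Sum>i\<in>I. c i * w i \<gamma>)"
    for v k I w and c :: "nat \<Rightarrow> complex"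
  proof -
    have "\<forall>i\<in>I. \<exists>x. \<forall>\<gamma>\<in>D. w i \<gamma> = (\<Sum>u | length u = k. \<Sum>\<delta>\<in>D. word_entry D T u \<gamma> \<delta> * x u \<delta>)"
      using w by (auto simp: V_def)
    then obtain X where X: "\<And>i \<gamma>. i \<in> I \<Longrightarrow> \<gamma> \<in> D \<Longrightarrow>
        w i \<gamma> = (\<Sum>u | length u = k. \<Sum>\<delta>\<in>D. word_entry D T u \<gamma> \<delta> * X i u \<delta>)"
      unfolding bchoice_iff by blast
    have "v \<gamma> = (\<Sum>u | length u = k. \<Sum>\<delta>\<in>D. word_entry D T u \<gamma> \<delta> * (\<Sum>i\<in>I. c i * X i u \<delta>))"
      if \<gamma>: "\<gamma> \<in> D" for \<gamma>
    proof -
      have "v \<gamma> = (\<Sum>i\<in>I. \<Sum>u | length u = k. \<Sum>\<delta>\<in>D. word_entry D T u \<gamma> \<delta> * (c i * X i u \<delta>))"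
        unfolding comb[OF \<gamma>]
        by (intro sum.cong refl) (simp add: X[OF _ \<gamma>] sum_distrib_left mult_ac)
      also have "\<dots> = (\<Sum>u | length u = k. \<Sum>\<delta>\<in>D. \<Sum>i\<in>I. word_entry D T u \<gamma> \<delta> * (c i * X i u \<delta>))"
        by (subst sum.swap, intro sum.cong refl, rule sum.swap)
      finally show ?thesis by (simp add: sum_distrib_left)
    qed
    then show ?thesis
      unfolding V_def by (intro CollectI exI[of _ "\<lambda>u \<delta>. \<Sum>i\<in>I. c i * X i u \<delta>"] ballI)
  qed
  have V_step: "V (Suc k) \<subseteq> V k" for k
  proof
    fix v assume "v \<in> V (Suc k)"
    then obtain x where x: "\<And>\<gamma>. \<gamma> \<in> D \<Longrightarrow>
        v \<gamma> = (\<Sum>u | length u = Suc k. \<Sum>\<delta>\<in>D. word_entry D T u \<gamma> \<delta> * x u \<delta>)"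
      unfolding V_def by blast
    have "v \<gamma> = (\<Sum>u | length u = k. \<Sum>\<epsilon>\<in>D. word_entry D T u \<gamma> \<epsilon> *
        (\<Sum>j\<in>UNIV. \<Sum>\<delta>\<in>D. T j \<epsilon> \<delta> * x (u @ [j]) \<delta>))" if \<gamma>: "\<gamma> \<in> D" for \<gamma>
    proof -
      have "v \<gamma> = (\<Sum>j\<in>UNIV. \<Sum>u | length u = k. \<Sum>\<delta>\<in>D. \<Sum>\<epsilon>\<in>D.
          word_entry D T u \<gamma> \<epsilon> * (T j \<epsilon> \<delta> * x (u @ [j]) \<delta>))"
        by (simp add: x[OF \<gamma>] sum_words_snoc word_entry_snoc[OF D \<gamma>] sum_distrib_right mult.assoc)
      also have "\<dots> = (\<Sum>u | length u = k. \<Sum>j\<in>UNIV. \<Sum>\<epsilon>\<in>D. \<Sum>\<delta>\<in>D.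
          word_entry D T u \<gamma> \<epsilon> * (T j \<epsilon> \<delta> * x (u @ [j]) \<delta>))"
        by (rule trans[OF sum.swap], rule sum.cong[OF refl], rule sum.cong[OF refl], rule sum.swap)
      also have "\<dots> = (\<Sum>u | length u = k. \<Sum>\<epsilon>\<in>D. \<Sum>j\<in>UNIV. \<Sum>\<delta>\<in>D.
          word_entry D T u \<gamma> \<epsilon> * (T j \<epsilon> \<delta> * x (u @ [j]) \<delta>))"
        by (rule sum.cong[OF refl], rule sum.swap)
      finally show ?thesis by (simp add: sum_distrib_left)
    qed
    then show "v \<in> V k"
      unfolding V_def
      by (intro CollectI exI[of _ "\<lambda>u \<epsilon>. \<Sum>j\<in>UNIV. \<Sum>\<delta>\<in>D. T j \<epsilon> \<delta> * x (u @ [j]) \<delta>"] ballI)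
  qed
  have V_mono: "V l \<subseteq> V k" if "k \<le> l" for k l
    using that by (rule lift_Suc_antimono_le[of V, OF V_step])
  have "\<exists>k\<le>card D. V k \<subseteq> V (Suc k)"
  proof (rule ccontr)
    assume "\<not> ?thesis"
    then have "\<forall>k\<in>{..card D}. \<exists>v. v \<in> V k \<and> v \<notin> V (Suc k)" by blast
    then obtain v where v: "\<And>k. k \<le> card D \<Longrightarrow> v k \<in> V k" "\<And>k. k \<le> card D \<Longrightarrow> v k \<notin> V (Suc k)"
      unfolding bchoice_iff by auto
    obtain c where c: "\<exists>k\<in>{..card D}. c k \<noteq> 0"
        "\<And>\<gamma>. \<gamma> \<in> D \<Longrightarrow> (\<Sum>k\<le>card D. v k \<gamma> * c k) = 0"
      using nontrivial_kernel[of D "{..card D}" "\<lambda>\<gamma> k. v k \<gamma>"] D by auto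
    define k where "k = (LEAST k. k \<le> card D \<and> c k \<noteq> 0)"
    have k: "k \<le> card D" "c k \<noteq> 0"
      using c(1) LeastI_ex[of "\<lambda>k. k \<le> card D \<and> c k \<noteq> 0"] unfolding k_def by auto
    have less: "c l = 0" if "l < k" for l
      using not_less_Least[of l "\<lambda>k. k \<le> card D \<and> c k \<noteq> 0"] that k(1) unfolding k_def by auto
    have "v k \<in> V (Suc k)"
    proof (rule V_comb[of "{k<..card D}" v _ _ "\<lambda>l. - c l / c k"])
      fix l assume "l \<in> {k<..card D}"
      then show "v l \<in> V (Suc k)" using v(1)[of l] V_mono[of "Suc k" l] by auto
    next
      fix \<gamma> assume "\<gamma> \<in> D"
      have s: "{..card D} = {..<k} \<union> insert k {k<..card D}" using k by auto
      have "0 = (\<Sum>l<k. v l \<gamma> * c l) + (\<Sum>l\<in>insert k {k<..card D}. v l \<gamma> * c l)"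
        unfolding c(2)[OF \<open>\<gamma> \<in> D\<close>, symmetric] s by (rule sum.union_disjoint) auto
      also have "\<dots> = v k \<gamma> * c k + (\<Sum>l\<in>{k<..card D}. v l \<gamma> * c l)"
        using less by simp
      finally have "v k \<gamma> = - (\<Sum>l\<in>{k<..card D}. v l \<gamma> * c l) / c k"
        using k(2) by (simp add: field_simps eq_neg_iff_add_eq_0)
      then show "v k \<gamma> = (\<Sum>l\<in>{k<..card D}. - c l / c k * v l \<gamma>)"
        by (simp add: sum_divide_distrib sum_negf mult.commute)
    qed
    with v(2)[OF k(1)] show False ..
  qed
  then obtain k where k: "k \<le> card D" "V k \<subseteq> V (Suc k)" by blast
  \<comment> \<open>The spanning family of the stationary space: all columns of all words of length \<open>k\<close>.\<close>
  let ?I = "{u :: 'l list. length u = k} \<times> D"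
  have fI: "finite ?I" using D by simp
  have "(\<lambda>\<gamma>. word_entry D T (fst i) \<gamma> (snd i)) \<in> V (Suc k)" if "i \<in> ?I" for i
  proof -
    have "word_entry D T (fst i) \<gamma> (snd i) =
        (\<Sum>u | length u = k. \<Sum>\<delta>\<in>D. word_entry D T u \<gamma> \<delta> * (if (u, \<delta>) = i then 1 else 0))" for \<gamma>
    proof -
      have "(\<Sum>u | length u = k. \<Sum>\<delta>\<in>D. word_entry D T u \<gamma> \<delta> * (if (u, \<delta>) = i then 1 else 0)) =
        (\<Sum>i'\<in>?I. if i' = i then word_entry D T (fst i') \<gamma> (snd i') else 0)"
        unfolding sum.cartesian_product by (intro sum.cong refl) auto
      also have "\<dots> = word_entry D T (fst i) \<gamma> (snd i)" using that fI by simp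
      finally show ?thesis ..
    qed
    then have "(\<lambda>\<gamma>. word_entry D T (fst i) \<gamma> (snd i)) \<in> V k"
      unfolding V_def by (intro CollectI exI[of _ "\<lambda>u \<delta>. if (u, \<delta>) = i then 1 else 0"] ballI)
    with k(2) show ?thesis by blast
  qed
  then have "\<forall>i\<in>?I. \<exists>x. \<forall>\<gamma>\<in>D. word_entry D T (fst i) \<gamma> (snd i) =
      (\<Sum>u | length u = Suc k. \<Sum>\<delta>\<in>D. word_entry D T u \<gamma> \<delta> * x u \<delta>)"
    unfolding V_def by blast
  then obtain X where X: "\<And>i \<gamma>. i \<in> ?I \<Longrightarrow> \<gamma> \<in> D \<Longrightarrow> word_entry D T (fst i) \<gamma> (snd i) =
      (\<Sum>u | length u = Suc k. \<Sum>\<delta>\<in>D. word_entry D T u \<gamma> \<delta> * X i u \<delta>)"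
    unfolding bchoice_iff by blast
  define r where "r = card ?I"
  obtain e where e: "bij_betw e {..<r} ?I"
    using ex_bij_betw_nat_finite[OF fI] unfolding r_def lessThan_atLeast0 by blast
  have eI: "e b \<in> ?I" if "b < r" for b using e that by (auto simp: bij_betw_def)
  have "\<forall>\<gamma>\<in>D. \<forall>b<r. word_entry D T (fst (e b)) \<gamma> (snd (e b)) = 0"
  proof (rule ns[of r "\<lambda>\<gamma> b. word_entry D T (fst (e b)) \<gamma> (snd (e b))"
        "\<lambda>j b c. X (e b) (j # fst (e c)) (snd (e c))"])
    fix \<gamma> b assume \<gamma>: "\<gamma> \<in> D" and b: "b < r"
    have "word_entry D T (fst (e b)) \<gamma> (snd (e b)) =
        (\<Sum>j\<in>UNIV. \<Sum>u | length u = k. \<Sum>\<delta>\<in>D. \<Sum>\<epsilon>\<in>D.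
           T j \<gamma> \<epsilon> * word_entry D T u \<epsilon> \<delta> * X (e b) (j # u) \<delta>)"
      by (simp add: X[OF eI[OF b] \<gamma>] sum_words_Cons sum_distrib_right)
    also have "\<dots> = (\<Sum>j\<in>UNIV. \<Sum>i\<in>?I. \<Sum>\<epsilon>\<in>D.
           T j \<gamma> \<epsilon> * word_entry D T (fst i) \<epsilon> (snd i) * X (e b) (j # fst i) (snd i))"
      by (rule sum.cong[OF refl], rule trans[OF sum.cartesian_product]) (simp add: case_prod_beta)
    also have "\<dots> = (\<Sum>j\<in>UNIV. \<Sum>c<r. \<Sum>\<epsilon>\<in>D. T j \<gamma> \<epsilon> * word_entry D T (fst (e c)) \<epsilon> (snd (e c)) *
           X (e b) (j # fst (e c)) (snd (e c)))"
      by (intro sum.cong refl sum.reindex_bij_betw[OF e, symmetric])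
    also have "\<dots> = (\<Sum>j\<in>UNIV. \<Sum>\<epsilon>\<in>D. \<Sum>c<r. T j \<gamma> \<epsilon> * X (e b) (j # fst (e c)) (snd (e c)) *
           word_entry D T (fst (e c)) \<epsilon> (snd (e c)))"
      by (intro sum.cong refl, subst sum.swap) (simp add: mult_ac)
    finally show "word_entry D T (fst (e b)) \<gamma> (snd (e b)) = \<dots>" .
  qed
  moreover have "\<exists>b<r. e b = i" if "i \<in> ?I" for i
    using e that unfolding bij_betw_def by (metis imageE lessThan_iff)
  ultimately have z: "word_entry D T u \<gamma> \<delta> = 0" if uD: "length u = k" "\<gamma> \<in> D" "\<delta> \<in> D" for u \<gamma> \<delta>
  proof -
    obtain b where "b < r" "e b = (u, \<delta>)" using \<open>\<And>i. i \<in> ?I \<Longrightarrow> \<exists>b<r. e b = i\<close>[of "(u, \<delta>)"] uD by auto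
    with \<open>\<forall>\<gamma>\<in>D. \<forall>b<r. _ = 0\<close> uD show ?thesis by force
  qed
  show ?thesis
    by (rule word_entry_long_zero[OF D, where k = k]) (use z u k \<gamma>\<delta> in auto)
qed

definition word_monomial :: "('l \<Rightarrow> 's::monoid_mult) \<Rightarrow> 'l list \<Rightarrow> 's" where
  "word_monomial y u = prod_list (map y u)"

text \<open>The finite geometric series: multiplying by \<open>\<Sum>\<^sub>j T\<^sub>j y\<^sub>j\<close> on either side lengthens each word by one
letter, which loses the empty word and adds words of length \<open>N\<close>. It is used with scalars inside the
free algebra, and with the free algebra in \<open>z\<close> inside the bipartite polynomials.\<close>

theorem nilpotent_pencil_inverse:
  fixes T :: "'l::finite \<Rightarrow> 'd \<Rightarrow> 'd \<Rightarrow> 'r::ring_1" and \<iota> :: "'r \<Rightarrow> 's::ring_1"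
  assumes D: "finite D" and nil: "\<And>u \<alpha> \<beta>. length u = N \<Longrightarrow> \<alpha> \<in> D \<Longrightarrow> \<beta> \<in> D \<Longrightarrow> word_entry D T u \<alpha> \<beta> = 0"
    and hom: "\<iota> 0 = 0" "\<iota> 1 = 1" "\<And>a b. \<iota> (a + b) = \<iota> a + \<iota> b" "\<And>a b. \<iota> (a * b) = \<iota> a * \<iota> b"
    and comm: "\<And>a j. \<iota> a * y j = y j * \<iota> a"
    and \<alpha>\<beta>: "\<alpha> \<in> D" "\<beta> \<in> D"
  defines "E \<equiv> \<lambda>\<alpha> \<beta>. \<Sum>u | length u < N. \<iota> (word_entry D T u \<alpha> \<beta>) * word_monomial y u"
  shows "(\<Sum>j\<in>UNIV. \<Sum>\<gamma>\<in>D. \<iota> (T j \<alpha> \<gamma>) * y j * E \<gamma> \<beta>) = E \<alpha> \<beta> - (if \<alpha> = \<beta> then 1 else 0)" (is ?L)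
    and "(\<Sum>j\<in>UNIV. \<Sum>\<gamma>\<in>D. E \<alpha> \<gamma> * (\<iota> (T j \<gamma> \<beta>) * y j)) = E \<alpha> \<beta> - (if \<alpha> = \<beta> then 1 else 0)" (is ?R)
proof -
  have hom_sum: "\<iota> (sum f A) = (\<Sum>a\<in>A. \<iota> (f a))" for f and A :: "'d set"
    by (induction A rule: infinite_finite_induct) (simp_all add: hom)
  have word_comm: "\<iota> a * word_monomial y u = word_monomial y u * \<iota> a" for a u
    unfolding word_monomial_def by (induction u) (simp_all, metis comm mult.assoc)
  let ?t = "\<lambda>u. \<iota> (word_entry D T u \<alpha> \<beta>) * word_monomial y u"
  have E: "(\<Sum>u | length u < Suc N. ?t u) = E \<alpha> \<beta>"
    using nil \<alpha>\<beta> by (simp add: E_def sum_words_less_Suc hom)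
  have e: "?t [] = (if \<alpha> = \<beta> then 1 else 0)" by (simp add: hom word_monomial_def)
  have "(\<Sum>\<gamma>\<in>D. \<iota> (T j \<alpha> \<gamma>) * y j * E \<gamma> \<beta>) = (\<Sum>u | length u < N. ?t (j # u))" for j
  proof -
    have "\<iota> (T j \<alpha> \<gamma>) * y j * (\<iota> m * word_monomial y u) = \<iota> (T j \<alpha> \<gamma> * m) * word_monomial y (j # u)" for \<gamma> m u
      by (simp add: hom word_monomial_def) (metis comm mult.assoc)
    then show ?thesis
      unfolding E_def sum_distrib_left by (subst sum.swap) (simp add: hom_sum sum_distrib_right)
  qed
  then show ?L using E unfolding sum_words_less_Cons e by (simp add: algebra_simps)
  have "(\<Sum>\<gamma>\<in>D. E \<alpha> \<gamma> * (\<iota> (T j \<gamma> \<beta>) * y j)) = (\<Sum>u | length u < N. ?t (u @ [j]))" for j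
  proof -
    have "\<iota> m * word_monomial y u * (\<iota> (T j \<gamma> \<beta>) * y j) = \<iota> (m * T j \<gamma> \<beta>) * word_monomial y (u @ [j])" for \<gamma> m u
    proof -
      have "\<iota> m * word_monomial y u * (\<iota> (T j \<gamma> \<beta>) * y j) = \<iota> m * (word_monomial y u * \<iota> (T j \<gamma> \<beta>)) * y j"
        by (simp add: mult.assoc)
      then show ?thesis unfolding word_comm[symmetric] by (simp add: hom word_monomial_def mult.assoc)
    qed
    then show ?thesis
      unfolding E_def sum_distrib_right
      by (subst sum.swap) (simp add: hom_sum sum_distrib_right word_entry_snoc[OF D \<alpha>\<beta>])
  qed
  then show ?R using E unfolding sum_words_less_snoc e by (simp add: algebra_simps)
qed

section \<open>Weighted cyclic shifts\<close>

text \<open>Polynomials in many variables enter only through their restrictions to lines, which is enough to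
find a point where finitely many of them are nonzero.\<close>

definition line_poly :: "(('x \<Rightarrow> complex) \<Rightarrow> complex) \<Rightarrow> bool" where
  "line_poly f \<longleftrightarrow> (\<forall>a b. \<exists>q :: complex poly. \<forall>s. f (\<lambda>x. a x + s * b x) = poly q s)"

lemma line_poly_const: "line_poly (\<lambda>_. c)"
  unfolding line_poly_def by (auto intro!: exI[of _ "[:c:]"])

lemma line_poly_coord: "line_poly (\<lambda>a. a x)"
  unfolding line_poly_def by (auto intro!: exI[of _ "[:_, _:]"])

lemma line_poly_add: "line_poly f \<Longrightarrow> line_poly g \<Longrightarrow> line_poly (\<lambda>a. f a + g a)"
  unfolding line_poly_def by (metis poly_add)

lemma line_poly_mult: "line_poly f \<Longrightarrow> line_poly g \<Longrightarrow> line_poly (\<lambda>a. f a * g a)"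
  unfolding line_poly_def by (metis poly_mult)

lemma line_poly_sum: "(\<And>i. i \<in> I \<Longrightarrow> line_poly (f i)) \<Longrightarrow> line_poly (\<lambda>a. \<Sum>i\<in>I. f i a)"
  by (induction I rule: infinite_finite_induct) (simp_all add: line_poly_const line_poly_add)

lemma line_poly_prod: "(\<And>i. i \<in> I \<Longrightarrow> line_poly (f i)) \<Longrightarrow> line_poly (\<lambda>a. \<Prod>i\<in>I. f i a)"
  by (induction I rule: infinite_finite_induct) (simp_all add: line_poly_const line_poly_mult)

lemma common_nonzero_point:
  assumes "finite I" and "\<And>i. i \<in> I \<Longrightarrow> line_poly (f i)" and "\<And>i. i \<in> I \<Longrightarrow> \<exists>a. f i a \<noteq> 0"
  shows "\<exists>a. \<forall>i\<in>I. f i a \<noteq> 0"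
proof -
  have "\<exists>a. (\<Prod>i\<in>I. f i a) \<noteq> 0"
    using assms
  proof (induction I rule: finite_induct)
    case (insert i I)
    have "\<exists>a. (\<Prod>i\<in>I. f i a) \<noteq> 0" using insert by blast
    then obtain a where a: "(\<Prod>i\<in>I. f i a) \<noteq> 0" ..
    obtain b where b: "f i b \<noteq> 0" using insert.prems(2)[of i] by auto
    have "line_poly (\<lambda>a. \<Prod>i\<in>I. f i a)" using insert by (intro line_poly_prod) auto
    then obtain q where q: "\<And>s. (\<Prod>i\<in>I. f i (\<lambda>x. a x + s * (b x - a x))) = poly q s"
      unfolding line_poly_def by metis
    obtain r where r: "\<And>s. f i (\<lambda>x. a x + s * (b x - a x)) = poly r s"
      using insert.prems(1)[of i] unfolding line_poly_def by (metis insertI1)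
    have "q \<noteq> 0" using a q[of 0] by auto
    moreover have "r \<noteq> 0" using b r[of 1] by auto
    ultimately have "finite {s. poly (q * r) s = 0}" by (intro poly_roots_finite) auto
    then obtain s where "poly (q * r) s \<noteq> 0"
      using ex_new_if_finite[OF infinite_UNIV_char_0] by blast
    then show ?case
      using insert.hyps q r by (intro exI[of _ "\<lambda>x. a x + s * (b x - a x)"]) auto
  qed auto
  then show ?thesis using assms(1) by auto
qed

abbreviation matrix_eval :: "nat \<Rightarrow> ('g \<Rightarrow> nat \<Rightarrow> nat \<Rightarrow> complex) \<Rightarrow> 'g free_poly \<Rightarrow> nat \<Rightarrow> nat \<Rightarrow> complex" where
  "matrix_eval n Z \<equiv> rep_eval (word_entry {..<n} Z)"

lemma matrix_eval_mult:
  assumes "a < n"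
  shows "matrix_eval n Z (f * g) a b = (\<Sum>c<n. matrix_eval n Z f a c * matrix_eval n Z g c b)"
  by (rule rep_eval_mult) (use assms in \<open>simp add: plus_list_def word_entry_append\<close>)

text \<open>The weights take the place of independent commuting variables, and the cyclic permutation acts on
them as an automorphism of order \<open>n\<close>: the shifts generate a ring of twisted polynomials, which is
what makes the value of a polynomial at a generic shift either zero or invertible.\<close>

definition cyclic_shift :: "nat \<Rightarrow> ('g \<times> nat \<Rightarrow> complex) \<Rightarrow> 'g \<Rightarrow> nat \<Rightarrow> nat \<Rightarrow> complex" where
  "cyclic_shift n t i a b = (if b = Suc a mod n then t (i, a) else 0)"

definition path_weight :: "nat \<Rightarrow> ('g \<times> nat \<Rightarrow> complex) \<Rightarrow> 'g list \<Rightarrow> nat \<Rightarrow> complex" where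
  "path_weight n t w a = (\<Prod>k<length w. t (w ! k, (a + k) mod n))"

lemma word_entry_cyclic_shift:
  assumes "a < n" "b < n"
  shows "word_entry {..<n} (cyclic_shift n t) w a b =
    (if b = (a + length w) mod n then path_weight n t w a else 0)"
  using assms(1)
proof (induction w arbitrary: a)
  case Nil
  then show ?case using assms(2) by (auto simp: path_weight_def)
next
  case (Cons i w)
  have n: "Suc a mod n < n" using Cons.prems by simp
  have "word_entry {..<n} (cyclic_shift n t) (i # w) a b =
      (\<Sum>c<n. if c = Suc a mod n then t (i, a) * word_entry {..<n} (cyclic_shift n t) w c b else 0)"
    unfolding word_entry.simps by (intro sum.cong refl) (simp add: cyclic_shift_def)
  also have "\<dots> = t (i, a) * word_entry {..<n} (cyclic_shift n t) w (Suc a mod n) b"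
    using n by (subst sum.delta) auto
  also have "\<dots> = (if b = (a + length (i # w)) mod n
      then t (i, a) * path_weight n t w (Suc a mod n) else 0)"
    using Cons.IH[OF n] by (simp add: mod_simps)
  also have "t (i, a) * path_weight n t w (Suc a mod n) = path_weight n t (i # w) a"
    using Cons.prems unfolding path_weight_def
    by (simp add: prod.lessThan_Suc_shift mod_simps del: prod.lessThan_Suc)
  finally show ?case .
qed

text \<open>At a cyclic shift, the homogeneous part of degree \<open>k\<close> of \<open>f\<close> is supported on the cyclic diagonal
\<open>b = a + k\<close>; these are the entries there.\<close>

definition graded_weight :: "nat \<Rightarrow> 'g free_poly \<Rightarrow> nat \<Rightarrow> ('g \<times> nat \<Rightarrow> complex) \<Rightarrow> nat \<Rightarrow> complex" where
  "graded_weight n f k t a =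
     (\<Sum>w | w \<in> Poly_Mapping.keys f \<and> length w = k. Poly_Mapping.lookup f w * path_weight n t w a)"

lemma matrix_eval_cyclic_shift:
  assumes "a < n" "b < n" and m: "\<And>w. w \<in> Poly_Mapping.keys f \<Longrightarrow> length w \<le> m"
  shows "matrix_eval n (cyclic_shift n t) f a b =
    (\<Sum>k\<le>m. if b = (a + k) mod n then graded_weight n f k t a else 0)"
proof -
  let ?s = "\<lambda>w. Poly_Mapping.lookup f w * (if b = (a + length w) mod n then path_weight n t w a else 0)"
  have "matrix_eval n (cyclic_shift n t) f a b = (\<Sum>w\<in>Poly_Mapping.keys f. ?s w)"
    unfolding rep_eval_def word_entry_cyclic_shift[OF assms(1,2)] ..
  also have "\<dots> = (\<Sum>k\<le>m. \<Sum>w | w \<in> Poly_Mapping.keys f \<and> length w = k. ?s w)"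
    by (rule sum.group[symmetric]) (use m in auto)
  also have "\<dots> = (\<Sum>k\<le>m. if b = (a + k) mod n then graded_weight n f k t a else 0)"
    by (intro sum.cong refl) (auto simp: graded_weight_def)
  finally show ?thesis .
qed

lemma graded_weight_scale:
  "graded_weight n f k (\<lambda>x. c * t x) a = c ^ k * graded_weight n f k t a"
  unfolding graded_weight_def path_weight_def sum_distrib_left
  by (intro sum.cong refl) (auto simp: prod.distrib mult_ac)

lemma graded_weight_rotate:
  assumes "a < n"
  shows "graded_weight n f k (\<lambda>(i, b). t (i, (b + d) mod n)) a = graded_weight n f k t ((a + d) mod n)"
  unfolding graded_weight_def path_weight_def
  by (intro sum.cong arg_cong2[of _ _ _ _ times] refl prod.cong) (auto simp: mod_simps ac_simps)

lemma line_poly_graded_weight: "line_poly (\<lambda>t. graded_weight n f k t a)"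
  unfolding graded_weight_def path_weight_def
  by (intro line_poly_sum line_poly_mult line_poly_const line_poly_prod line_poly_coord)

text \<open>On the family of cyclic shifts, a value of \<open>f\<close> is generically invertible unless \<open>f\<close> vanishes on the
whole family. Let \<open>d\<close> be the highest degree whose homogeneous part does not vanish on the family.
Rotating the weights moves a nonzero entry to any position of the \<open>d\<close>-th cyclic diagonal, so by
genericity some weights make this whole diagonal nonzero. Multiplying the weights by a large \<open>s\<close>
multiplies the part of degree \<open>k\<close> by \<open>s\<^sup>k\<close>, after which the \<open>d\<close>-th cyclic diagonal dominates.\<close>

lemma exists_injective_shift:
  assumes nz: "matrix_eval n (cyclic_shift n t) f a0 b0 \<noteq> 0" and ab: "a0 < n" "b0 < n"
  obtains t' where "\<And>c. (\<And>a. a < n \<Longrightarrow> (\<Sum>b<n. matrix_eval n (cyclic_shift n t') f a b * c b) = 0) \<Longrightarrow>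
      \<forall>b<n. c b = 0"
proof -
  have n: "n > 0" using ab by simp
  obtain m where m: "\<And>w. w \<in> Poly_Mapping.keys f \<Longrightarrow> length w \<le> m"
    using finite_nat_set_iff_bounded_le[of "length ` Poly_Mapping.keys f"] by auto
  define K where "K = {k. k \<le> m \<and> (\<exists>t a. a < n \<and> graded_weight n f k t a \<noteq> 0)}"
  have "finite K" unfolding K_def by simp
  moreover have "K \<noteq> {}"
  proof
    assume "K = {}"
    then have z: "graded_weight n f k t a0 = 0" if "k \<le> m" for k
      using that ab unfolding K_def by blast
    have "matrix_eval n (cyclic_shift n t) f a0 b0 = 0"
      by (subst matrix_eval_cyclic_shift[OF ab, where m = m]) (auto simp: z m intro!: sum.neutral)
    with nz show False ..
  qed
  ultimately have "Max K \<in> K" and top: "\<And>k. k \<in> K \<Longrightarrow> k \<le> Max K" by simp_all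
  define d where "d = Max K"
  obtain t0 a1 where t0: "d \<le> m" "a1 < n" "graded_weight n f d t0 a1 \<noteq> 0"
    using \<open>Max K \<in> K\<close> unfolding d_def K_def by blast
  have "\<exists>t. graded_weight n f d t a \<noteq> 0" if a: "a < n" for a
  proof -
    have "(a + (a1 + n - a)) mod n = a1" using a t0 by simp
    then have "graded_weight n f d (\<lambda>(i, b). t0 (i, (b + (a1 + n - a)) mod n)) a \<noteq> 0"
      using t0 unfolding graded_weight_rotate[OF a] by simp
    then show ?thesis by blast
  qed
  then obtain t1 where t1: "\<And>a. a < n \<Longrightarrow> graded_weight n f d t1 a \<noteq> 0"
    using common_nonzero_point[of "{..<n}" "\<lambda>a t. graded_weight n f d t a"] line_poly_graded_weight
    by (metis finite_lessThan lessThan_iff)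
  define g where "g k a = graded_weight n f k t1 a" for k a
  define \<Phi> where "\<Phi> = (\<Sum>k<d. \<Sum>a<n. cmod (g k a))"
  define \<delta> where "\<delta> = Min ((\<lambda>a. cmod (g d a)) ` {..<n})"
  \<comment> \<open>Then \<open>s \<delta> > \<Phi>\<close>; an entry of degree \<open>d\<close> has at least one factor \<open>s\<close> more than all lower ones.\<close>
  define s where "s = 1 + \<Phi> / \<delta>"
  have \<delta>: "\<delta> \<le> cmod (g d a)" if "a < n" for a
    unfolding \<delta>_def using that by (intro Min_le) auto
  have "\<delta> > 0"
    unfolding \<delta>_def using n t1 by (subst Min_gr_iff) (auto simp: g_def)
  have "\<Phi> \<ge> 0" unfolding \<Phi>_def by (intro sum_nonneg) auto
  have s: "s \<ge> 1" "s * \<delta> > \<Phi>"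
    using \<open>\<delta> > 0\<close> \<open>\<Phi> \<ge> 0\<close> by (auto simp: s_def field_simps)
  have row_sum: "(\<Sum>b<n. matrix_eval n (cyclic_shift n (\<lambda>x. complex_of_real s * t1 x)) f a b * c b) =
      (\<Sum>k\<le>d. of_real s ^ k * g k a * c ((a + k) mod n))" if a: "a < n" for a c
  proof -
    have "(\<Sum>b<n. matrix_eval n (cyclic_shift n (\<lambda>x. complex_of_real s * t1 x)) f a b * c b) =
        (\<Sum>b<n. \<Sum>k\<le>m. if b = (a + k) mod n then of_real s ^ k * g k a * c b else 0)"
      using a by (intro sum.cong refl)
        (simp add: matrix_eval_cyclic_shift[OF _ _ m] graded_weight_scale g_def sum_distrib_right
          if_distrib[of "\<lambda>x. x * _"] cong: if_cong)
    also have "\<dots> = (\<Sum>k\<le>m. of_real s ^ k * g k a * c ((a + k) mod n))"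
      using n by (subst sum.swap) simp
    also have "\<dots> = (\<Sum>k\<le>d. of_real s ^ k * g k a * c ((a + k) mod n))"
    proof (rule sum.mono_neutral_right)
      have "g k a = 0" if "k \<le> m" "k > d" for k
      proof (rule ccontr)
        assume "g k a \<noteq> 0"
        then have "k \<in> K" unfolding K_def g_def using that a by blast
        from top[OF this] that show False unfolding d_def by simp
      qed
      then show "\<forall>k\<in>{..m} - {..d}. of_real s ^ k * g k a * c ((a + k) mod n) = 0" by auto
    qed (use t0 in auto)
    finally show ?thesis .
  qed
  show ?thesis
  proof (rule that[of "\<lambda>x. complex_of_real s * t1 x"])
    fix c :: "nat \<Rightarrow> complex"
    assume c: "\<And>a. a < n \<Longrightarrow>
        (\<Sum>b<n. matrix_eval n (cyclic_shift n (\<lambda>x. complex_of_real s * t1 x)) f a b * c b) = 0"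
    define M where "M = Max ((\<lambda>b. cmod (c b)) ` {..<n})"
    have M: "cmod (c b) \<le> M" if "b < n" for b
      unfolding M_def using that by (intro Max_ge) auto
    have "M \<in> (\<lambda>b. cmod (c b)) ` {..<n}" unfolding M_def using n by (intro Max_in) auto
    then obtain b where b: "b < n" "cmod (c b) = M" by auto
    \<comment> \<open>The row whose entry on the \<open>d\<close>-th cyclic diagonal meets the largest coordinate of \<open>c\<close>; subtracting \<open>d\<close> modulo \<open>n\<close>.\<close>
    define a where "a = (b + (n * d - d)) mod n"
    have a: "a < n" using n by (simp add: a_def)
    have "(a + d) mod n = (b + n * d) mod n"
    proof -
      have "n * d \<ge> d" using n by simp
      then have e: "b + (n * d - d) + d = b + n * d" by linarith
      show ?thesis unfolding a_def mod_add_left_eq e ..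
    qed
    then have ad: "(a + d) mod n = b" using b by simp
    have "of_real s ^ d * g d a * c b = - (\<Sum>k<d. of_real s ^ k * g k a * c ((a + k) mod n))"
      using c[OF a] unfolding row_sum[OF a] lessThan_Suc_atMost[symmetric]
      by (simp add: ad add_eq_0_iff)
    then have "s ^ d * cmod (g d a) * M = cmod (\<Sum>k<d. of_real s ^ k * g k a * c ((a + k) mod n))"
      using s b by (metis (no_types, lifting) norm_minus_cancel norm_mult norm_power norm_of_real
          abs_of_nonneg order_trans zero_le_one)
    also have "\<dots> \<le> (\<Sum>k<d. s ^ k * cmod (g k a) * M)"
      by (rule sum_norm_le) (use s n M in \<open>auto simp: norm_mult norm_power intro!: mult_left_mono\<close>)
    finally have "s * (s ^ d * cmod (g d a) * M) \<le> s * (\<Sum>k<d. s ^ k * cmod (g k a) * M)"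
      using s by (intro mult_left_mono) auto
    also have "\<dots> = (\<Sum>k<d. s ^ Suc k * (cmod (g k a) * M))"
      by (simp add: sum_distrib_left mult_ac)
    also have "\<dots> \<le> (\<Sum>k<d. s ^ d * (cmod (g k a) * M))"
      using s M[OF b(1)] norm_ge_zero[of "c b"]
      by (intro sum_mono mult_right_mono power_increasing) (auto simp: b)
    also have "\<dots> = s ^ d * M * (\<Sum>k<d. cmod (g k a))"
      by (simp add: sum_distrib_left mult_ac)
    also have "\<dots> \<le> s ^ d * M * \<Phi>"
    proof (rule mult_left_mono)
      show "(\<Sum>k<d. cmod (g k a)) \<le> \<Phi>"
        unfolding \<Phi>_def using a by (intro sum_mono member_le_sum[of a "{..<n}"]) auto
      show "0 \<le> s ^ d * M" using s b(2) norm_ge_zero[of "c b"] by auto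
    qed
    finally have "s ^ d * M * (s * cmod (g d a)) \<le> s ^ d * M * \<Phi>"
      by (simp add: mult_ac)
    moreover have "\<Phi> < s * cmod (g d a)"
      using s mult_left_mono[OF \<delta>[OF a], of s] by linarith
    ultimately have "\<not> s ^ d * M > 0" using mult_strict_left_mono by fastforce
    then have "M \<le> 0" using s by (simp add: zero_less_mult_iff not_less)
    then show "\<forall>b<n. c b = 0" using M by (meson norm_le_zero_iff order_trans)
  qed
qed

text \<open>The coefficient of \<open>w0\<close> is read off along a cycle with one vertex more than \<open>w0\<close> has letters: the
weights spell \<open>w0\<close> along a path, and the remaining edge has weight zero, which stops longer
words from running around the cycle.\<close>

lemma zero_if_vanishes_on_shifts:
  fixes f :: "'g free_poly"
  assumes "\<And>n t a b. a < n \<Longrightarrow> b < n \<Longrightarrow> matrix_eval n (cyclic_shift n t) f a b = 0"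
  shows "f = 0"
proof (rule poly_mapping_eqI)
  fix w0 :: "'g list"
  let ?n = "Suc (length w0)"
  define t :: "'g \<times> nat \<Rightarrow> complex" where "t = (\<lambda>(i, a). if a < length w0 \<and> w0 ! a = i then 1 else 0)"
  have *: "(if length w0 = (0 + length w) mod ?n then path_weight ?n t w 0 else 0) =
      (if w = w0 then 1 else 0)" for w
  proof (cases "w = w0")
    case True
    then show ?thesis by (auto simp: path_weight_def t_def)
  next
    case False
    have "path_weight ?n t w 0 = 0" if l: "length w0 = length w mod ?n"
    proof (cases "length w < ?n")
      case True
      then have "length w = length w0" using l by simp
      then obtain k where "k < length w" "w ! k \<noteq> w0 ! k" using False nth_equalityI by blast
      then show ?thesis unfolding path_weight_def
        using \<open>length w = length w0\<close> by (auto simp: t_def intro!: bexI[of _ k])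
    next
      case False
      then show ?thesis unfolding path_weight_def
        by (auto simp: t_def intro!: bexI[of _ "length w0"])
    qed
    then show ?thesis using False by auto
  qed
  have "0 = matrix_eval ?n (cyclic_shift ?n t) f 0 (length w0)" using assms[of 0 ?n] by simp
  also have "\<dots> = (\<Sum>w\<in>Poly_Mapping.keys f. Poly_Mapping.lookup f w * (if w = w0 then 1 else 0))"
    unfolding rep_eval_def by (intro sum.cong refl) (simp only: word_entry_cyclic_shift * zero_less_Suc lessI)
  also have "\<dots> = Poly_Mapping.lookup f w0"
    by (simp add: if_distrib[of "\<lambda>x. _ * x"] in_keys_iff cong: if_cong)
  finally show "Poly_Mapping.lookup f w0 = Poly_Mapping.lookup 0 w0" by simp
qed

section \<open>A nilpotency bound independent of the size of the matrices\<close>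

text \<open>Fix \<open>n\<close> and let \<open>k\<close> be the largest length of a word \<open>v\<close> in the \<open>T\<^sub>j\<close> that does not vanish on the shifts
of size \<open>n\<close>; it exists because of the bound \<open>card D * n\<close>. Choose an entry of \<open>v\<close> and a shift at which
this entry is invertible. For \<open>i, l \<le> k\<close> consider the same entry of the word
\<open>take i v @ drop l v\<close>: it is zero for \<open>l < i\<close>, since the word is longer than \<open>k\<close>, and it is the
invertible one for \<open>l = i\<close>. So these \<open>n \<times> n\<close> blocks form a matrix of rank \<open>(k + 1) n\<close>. It factors through
the columns of the words \<open>drop l v\<close>, which have height \<open>card D * n\<close>; hence \<open>k < card D\<close>. As this holds
for every \<open>n\<close>, words of length \<open>card D\<close> vanish.\<close>

theorem uniform_nilpotency:
  fixes T :: "'l \<Rightarrow> 'd \<Rightarrow> 'd \<Rightarrow> 'g free_poly"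
  assumes D: "finite D"
    and loc: "\<And>n Z u \<alpha> \<beta> a b. length u \<ge> card D * n \<Longrightarrow> \<alpha> \<in> D \<Longrightarrow> \<beta> \<in> D \<Longrightarrow> a < n \<Longrightarrow> b < n \<Longrightarrow>
        matrix_eval n Z (word_entry D T u \<alpha> \<beta>) a b = 0"
    and u: "length u \<ge> card D" "\<alpha> \<in> D" "\<beta> \<in> D"
  shows "word_entry D T u \<alpha> \<beta> = 0"
proof (rule zero_if_vanishes_on_shifts, rule ccontr)
  fix n t a b
  assume ab: "a < n" "b < n" and nz: "matrix_eval n (cyclic_shift n t) (word_entry D T u \<alpha> \<beta>) a b \<noteq> 0"
  define P where "P k \<longleftrightarrow> (\<exists>u \<alpha> \<beta> t a b. length u = k \<and> \<alpha> \<in> D \<and> \<beta> \<in> D \<and> a < n \<and> b < n \<and>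
      matrix_eval n (cyclic_shift n t) (word_entry D T u \<alpha> \<beta>) a b \<noteq> 0)" for k
  have P_u: "P (length u)" unfolding P_def using ab nz u by blast
  have bound: "\<forall>k. P k \<longrightarrow> k \<le> card D * n"
    unfolding P_def using loc by (metis linorder_le_cases)
  define k where "k = (GREATEST k. P k)"
  have "P k" unfolding k_def using GreatestI_nat[of P, OF P_u bound[rule_format]] .
  have top: "\<not> P l" if "l > k" for l
    using Greatest_le_nat[of P l, OF _ bound[rule_format]] that unfolding k_def by auto
  have "k \<ge> card D" using Greatest_le_nat[of P, OF P_u bound[rule_format]] u(1) unfolding k_def by simp
  obtain v \<gamma> \<delta> t0 a0 b0 where v: "length v = k" "\<gamma> \<in> D" "\<delta> \<in> D" "a0 < n" "b0 < n"
    "matrix_eval n (cyclic_shift n t0) (word_entry D T v \<gamma> \<delta>) a0 b0 \<noteq> 0"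
    using \<open>P k\<close> unfolding P_def by blast
  obtain s where s: "\<And>c. (\<And>a. a < n \<Longrightarrow>
      (\<Sum>b<n. matrix_eval n (cyclic_shift n s) (word_entry D T v \<gamma> \<delta>) a b * c b) = 0) \<Longrightarrow> \<forall>b<n. c b = 0"
    by (rule exists_injective_shift[OF v(6,4,5)], rule that, blast)
  define e where "e w \<epsilon> \<zeta> = matrix_eval n (cyclic_shift n s) (word_entry D T w \<epsilon> \<zeta>)" for w \<epsilon> \<zeta>
  have e_append: "e (w @ w') \<epsilon> \<zeta> a b = (\<Sum>\<eta>\<in>D. \<Sum>c<n. e w \<epsilon> \<eta> a c * e w' \<eta> \<zeta> c b)"
    if "a < n" "\<epsilon> \<in> D" for w w' \<epsilon> \<zeta> a b
    unfolding e_def word_entry_append[OF D that(2)] rep_eval_sum matrix_eval_mult[OF that(1)] ..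
  have e_long: "e w \<epsilon> \<zeta> a b = 0" if "length w > k" "\<epsilon> \<in> D" "\<zeta> \<in> D" "a < n" "b < n" for w \<epsilon> \<zeta> a b
    using top[OF that(1)] that(2-) unfolding P_def e_def by blast
  have "card (D \<times> {..<n}) < card ({..k} \<times> {..<n})"
    using mult_less_mono1[of "card D" "Suc k" n] \<open>k \<ge> card D\<close> ab
    unfolding card_cartesian_product card_atMost card_lessThan by linarith
  then obtain c where c: "\<exists>i\<in>{..k} \<times> {..<n}. c i \<noteq> 0"
    "\<And>\<eta> a'. \<eta> \<in> D \<Longrightarrow> a' < n \<Longrightarrow>
       (\<Sum>i\<in>{..k} \<times> {..<n}. e (drop (fst i) v) \<eta> \<delta> a' (snd i) * c i) = 0"
    using nontrivial_kernel[of "D \<times> {..<n}" "{..k} \<times> {..<n}"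
        "\<lambda>x i. e (drop (fst i) v) (fst x) \<delta> (snd x) (snd i)"] D by auto
  \<comment> \<open>The last block of the dependence that is nonzero is isolated by the word \<open>take i v\<close>.\<close>
  define L where "L = {l. l \<le> k \<and> (\<exists>b<n. c (l, b) \<noteq> 0)}"
  have "finite L" "L \<noteq> {}" using c(1) unfolding L_def by auto
  define i where "i = Max L"
  have "i \<in> L" using Max_in[OF \<open>finite L\<close> \<open>L \<noteq> {}\<close>] unfolding i_def .
  have later: "c (l, b) = 0" if "l \<le> k" "l > i" "b < n" for l b
  proof (rule ccontr)
    assume "c (l, b) \<noteq> 0"
    then have "l \<in> L" unfolding L_def using that by blast
    from Max_ge[OF \<open>finite L\<close> this] that show False unfolding i_def by simp
  qed
  have "\<forall>b<n. c (i, b) = 0"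
  proof (rule s)
    fix a' assume a': "a' < n"
    have "0 = (\<Sum>\<eta>\<in>D. \<Sum>d<n. e (take i v) \<gamma> \<eta> a' d *
        (\<Sum>x\<in>{..k} \<times> {..<n}. e (drop (fst x) v) \<eta> \<delta> d (snd x) * c x))"
      using c(2) by simp
    also have "\<dots> = (\<Sum>\<eta>\<in>D. \<Sum>d<n. \<Sum>x\<in>{..k} \<times> {..<n}.
        e (take i v) \<gamma> \<eta> a' d * e (drop (fst x) v) \<eta> \<delta> d (snd x) * c x)"
      by (simp add: sum_distrib_left mult.assoc)
    also have "\<dots> = (\<Sum>\<eta>\<in>D. \<Sum>x\<in>{..k} \<times> {..<n}. \<Sum>d<n.
        e (take i v) \<gamma> \<eta> a' d * e (drop (fst x) v) \<eta> \<delta> d (snd x) * c x)"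
      by (rule sum.cong[OF refl], rule sum.swap)
    also have "\<dots> = (\<Sum>x\<in>{..k} \<times> {..<n}. \<Sum>\<eta>\<in>D. \<Sum>d<n.
        e (take i v) \<gamma> \<eta> a' d * e (drop (fst x) v) \<eta> \<delta> d (snd x) * c x)"
      by (rule sum.swap)
    also have "\<dots> = (\<Sum>x\<in>{..k} \<times> {..<n}. e (take i v @ drop (fst x) v) \<gamma> \<delta> a' (snd x) * c x)"
      by (simp add: e_append[OF a' v(2)] sum_distrib_right)
    also have "\<dots> = (\<Sum>l\<le>k. \<Sum>b<n. e (take i v @ drop l v) \<gamma> \<delta> a' b * c (l, b))"
      by (simp add: sum.cartesian_product case_prod_beta)
    also have "\<dots> = (\<Sum>l\<le>k. if l = i then \<Sum>b<n. e v \<gamma> \<delta> a' b * c (i, b) else 0)"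
    proof (rule sum.cong[OF refl])
      fix l assume l: "l \<in> {..k}"
      consider "l < i" | "l = i" | "l > i" by linarith
      then show "(\<Sum>b<n. e (take i v @ drop l v) \<gamma> \<delta> a' b * c (l, b)) =
          (if l = i then \<Sum>b<n. e v \<gamma> \<delta> a' b * c (i, b) else 0)"
      proof cases
        case 1
        have "length (take i v @ drop l v) > k"
          using 1 \<open>i \<in> L\<close> v(1) unfolding L_def by simp
        from e_long[OF this v(2,3) a'] 1 show ?thesis by simp
      next
        case 3
        then show ?thesis using later l by simp
      qed simp
    qed
    also have "\<dots> = (\<Sum>b<n. e v \<gamma> \<delta> a' b * c (i, b))"
      using \<open>i \<in> L\<close> unfolding L_def by simp
    finally show "(\<Sum>b<n. matrix_eval n (cyclic_shift n s) (word_entry D T v \<gamma> \<delta>) a' b * c (i, b)) = 0"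
      by (simp add: e_def)
  qed
  with \<open>i \<in> L\<close> show False unfolding L_def by blast
qed

section \<open>Linearization\<close>

fun pair_word :: "'g list \<times> 'g list \<Rightarrow> ('g + 'g) list" where
  "pair_word (w, v) = map Inl w @ map Inr v"

lemma inj_pair_word: "inj pair_word"
proof (rule injI)
  fix x y :: "'a list \<times> 'a list"
  assume eq: "pair_word x = pair_word y"
  have inv: "(concat (map (case_sum (\<lambda>i. [i]) (\<lambda>_. [])) (pair_word z)),
      concat (map (case_sum (\<lambda>_. []) (\<lambda>i. [i])) (pair_word z))) = z" for z :: "'a list \<times> 'a list"
    by (cases z) (simp add: comp_def)
  show "x = y" using inv[of x] inv[of y] eq by metis
qed

definition word_coeff :: "'g bipartite_poly \<Rightarrow> ('g + 'g) list \<Rightarrow> complex" where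
  "word_coeff f u = (if u \<in> range pair_word then Poly_Mapping.lookup f (inv_into UNIV pair_word u) else 0)"

lemma word_coeff_pair_word: "word_coeff f (pair_word z) = Poly_Mapping.lookup f z"
  by (simp add: word_coeff_def inj_pair_word)

text \<open>Both families of variables are treated as letters, \<open>Inl i\<close> for \<open>z\<^sub>i\<close> and \<open>Inr j\<close> for \<open>y\<^sub>j\<close>, and the pencil is
\<open>1 - \<Sum>\<^sub>l pencil J l \<cdot> l\<close>. The unknown with index \<open>(s, j)\<close> stands for the word \<open>s\<close> applied to an unknown
\<open>x\<^sub>j\<close>: the row of a nonempty word \<open>l # t\<close> states \<open>x(l # t, j) = l \<cdot> x(t, j)\<close>, and the rows of the empty
word spell out \<open>J x\<close>, which has become linear in the letters. The first
letter of a monomial is the variable of the pencil, so words of length less than the degree of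
\<open>J\<close> suffice as states.\<close>

definition pencil ::
  "('g \<Rightarrow> 'g \<Rightarrow> 'g bipartite_poly) \<Rightarrow> 'g + 'g \<Rightarrow> ('g + 'g) list \<times> 'g \<Rightarrow> ('g + 'g) list \<times> 'g \<Rightarrow> complex"
  where
  "pencil J l = (\<lambda>(s, j) (t, i).
     if s = [] then - word_coeff (J j i) (l # t) else if s = l # t \<and> j = i then 1 else 0)"

definition states :: "nat \<Rightarrow> (('g + 'g) list \<times> 'g) set" where
  "states m = {s. length s < m} \<times> UNIV"

lemma finite_states [simp]: "finite (states m :: (('g::finite + 'g) list \<times> 'g) set)"
  by (simp add: states_def)

text \<open>The letters act on an arbitrary group \<open>'v\<close> with scalars, because the pencil is used twice: for
bipartite polynomials, and for functions on \<open>{..<n} \<times> {..<r}\<close>, where the letters act through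
matrices.\<close>

locale linearization =
  fixes J :: "'g::finite \<Rightarrow> 'g \<Rightarrow> 'g bipartite_poly" and m :: nat
    and sc :: "complex \<Rightarrow> 'v \<Rightarrow> 'v::ab_group_add" and act :: "'g + 'g \<Rightarrow> 'v \<Rightarrow> 'v"
  assumes sc: "sc 0 v = 0" "sc 1 v = v" "sc (- c) v = - sc c v"
    and J_const: "Poly_Mapping.lookup (J j i) ([], []) = (if j = i then 1 else 0)"
    and J_deg: "z \<in> Poly_Mapping.keys (J j i) \<Longrightarrow> length (pair_word z) \<le> m"
begin

lemma pencil_lower_row:
  assumes "l # t \<in> {s. length s < m}"
  shows "(\<Sum>l'\<in>UNIV. \<Sum>\<tau>\<in>states m. sc (pencil J l' (l # t, j) \<tau>) (act l' (x \<tau>))) = act l (x (t, j))"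
proof -
  have "(\<Sum>l'\<in>UNIV. \<Sum>\<tau>\<in>states m. sc (pencil J l' (l # t, j) \<tau>) (act l' (x \<tau>))) =
      (\<Sum>y\<in>UNIV \<times> states m. if y = (l, (t, j)) then act l (x (t, j)) else 0)"
    unfolding sum.cartesian_product by (intro sum.cong refl) (auto simp: pencil_def sc split: if_splits)
  also have "\<dots> = act l (x (t, j))"
    using assms by (subst sum.delta) (auto simp: states_def)
  finally show ?thesis .
qed

lemma pencil_top_row:
  assumes x: "\<And>s i. length s < m \<Longrightarrow> x (s, i) = foldr act s (f i)"
  shows "f j - (\<Sum>l\<in>UNIV. \<Sum>\<tau>\<in>states m. sc (pencil J l ([], j) \<tau>) (act l (x \<tau>))) =
    (\<Sum>i\<in>UNIV. \<Sum>z\<in>Poly_Mapping.keys (J j i).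
       sc (Poly_Mapping.lookup (J j i) z) (foldr act (pair_word z) (f i)))"
proof -
  let ?\<phi> = "\<lambda>i u. sc (word_coeff (J j i) u) (foldr act u (f i))"
  have words: "(\<Sum>u | length u < Suc m. ?\<phi> i u) = (\<Sum>z\<in>Poly_Mapping.keys (J j i).
       sc (Poly_Mapping.lookup (J j i) z) (foldr act (pair_word z) (f i)))" for i
  proof -
    have "(\<Sum>u | length u < Suc m. ?\<phi> i u) = (\<Sum>u\<in>pair_word ` Poly_Mapping.keys (J j i). ?\<phi> i u)"
    proof (rule sum.mono_neutral_right)
      show "\<forall>u\<in>{u. length u < Suc m} - pair_word ` Poly_Mapping.keys (J j i). ?\<phi> i u = 0"
      proof
        fix u assume u: "u \<in> {u. length u < Suc m} - pair_word ` Poly_Mapping.keys (J j i)"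
        have "word_coeff (J j i) u = 0"
        proof (cases "u \<in> range pair_word")
          case True
          then obtain z where z: "u = pair_word z" by blast
          then have "z \<notin> Poly_Mapping.keys (J j i)" using u by blast
          then show ?thesis by (simp add: z word_coeff_pair_word in_keys_iff)
        qed (simp add: word_coeff_def)
        then show "?\<phi> i u = 0" by (simp add: sc)
      qed
    qed (use J_deg in \<open>auto intro!: le_imp_less_Suc\<close>)
    also have "\<dots> = (\<Sum>z\<in>Poly_Mapping.keys (J j i). ?\<phi> i (pair_word z))"
      by (subst sum.reindex) (auto intro: inj_on_subset[OF inj_pair_word])
    finally show ?thesis by (simp add: word_coeff_pair_word)
  qed
  have "(\<Sum>l\<in>UNIV. \<Sum>\<tau>\<in>states m. sc (pencil J l ([], j) \<tau>) (act l (x \<tau>))) =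
      (\<Sum>l\<in>UNIV. \<Sum>t | length t < m. \<Sum>i\<in>UNIV. - ?\<phi> i (l # t))"
    by (rule sum.cong[OF refl], subst sum.cartesian_product)
       (auto simp: states_def pencil_def x sc intro!: sum.cong)
  also have "\<dots> = (\<Sum>l\<in>UNIV. \<Sum>i\<in>UNIV. \<Sum>t | length t < m. - ?\<phi> i (l # t))"
    by (rule sum.cong[OF refl], rule sum.swap)
  also have "\<dots> = - (\<Sum>i\<in>UNIV. \<Sum>l\<in>UNIV. \<Sum>t | length t < m. ?\<phi> i (l # t))"
    by (subst sum.swap) (simp add: sum_negf)
  also have "\<dots> = f j - (\<Sum>i\<in>UNIV. \<Sum>u | length u < Suc m. ?\<phi> i u)"
  proof -
    have "?\<phi> i [] = (if i = j then f j else 0)" for i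
      using word_coeff_pair_word[of "J j i" "([], [])"] J_const[of j i] by (auto simp: sc)
    then show ?thesis
      by (simp add: sum_words_less_Cons sum.distrib)
  qed
  also have "\<dots> = f j - (\<Sum>i\<in>UNIV. \<Sum>z\<in>Poly_Mapping.keys (J j i).
       sc (Poly_Mapping.lookup (J j i) z) (foldr act (pair_word z) (f i)))"
    unfolding words ..
  finally show ?thesis by simp
qed

lemma pencil_solution:
  assumes eq: "\<And>s j. length s < m \<Longrightarrow> x (s, j) = (if s = [] then e j else 0) +
      (\<Sum>l\<in>UNIV. \<Sum>\<tau>\<in>states m. sc (pencil J l (s, j) \<tau>) (act l (x \<tau>)))"
  shows "length s < m \<Longrightarrow> x (s, j) = foldr act s (x ([], j))"
    and "m > 0 \<Longrightarrow> (\<Sum>i\<in>UNIV. \<Sum>z\<in>Poly_Mapping.keys (J j i).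
       sc (Poly_Mapping.lookup (J j i) z) (foldr act (pair_word z) (x ([], i)))) = e j"
proof -
  show *: "length s < m \<Longrightarrow> x (s, j) = foldr act s (x ([], j))" for s j
  proof (induction s)
    case (Cons l t)
    then show ?case using eq[of "l # t" j] pencil_lower_row[of l t j x] by simp
  qed simp
  assume "m > 0"
  then show "(\<Sum>i\<in>UNIV. \<Sum>z\<in>Poly_Mapping.keys (J j i).
       sc (Poly_Mapping.lookup (J j i) z) (foldr act (pair_word z) (x ([], i)))) = e j"
    using pencil_top_row[of x "\<lambda>i. x ([], i)" j, OF *] eq[of "[]" j] by simp
qed

text \<open>The converse of the preceding lemma in the homogeneous case: solutions of \<open>J f = 0\<close> extend to
solutions of the pencil. It shows that a left inverse of the pencil makes \<open>J\<close> left cancellable.\<close>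

lemma pencil_solution_words:
  assumes f: "(\<Sum>i\<in>UNIV. \<Sum>z\<in>Poly_Mapping.keys (J j i).
       sc (Poly_Mapping.lookup (J j i) z) (foldr act (pair_word z) (f i))) = 0"
    and s: "length s < m"
  shows "foldr act s (f j) = (\<Sum>l\<in>UNIV. \<Sum>(t, i)\<in>states m.
      sc (pencil J l (s, j) (t, i)) (act l (foldr act t (f i))))"
proof (cases s)
  case Nil
  then show ?thesis
    using pencil_top_row[of "\<lambda>(t, i). foldr act t (f i)" f j] f by (simp add: case_prod_beta)
next
  case (Cons l t)
  then show ?thesis
    using pencil_lower_row[of l t j "\<lambda>(t, i). foldr act t (f i)"] s by (simp add: case_prod_beta)
qed

end

lemma sum_fun_apply: "(\<Sum>i\<in>I. f i) x = (\<Sum>i\<in>I. f i x)"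
  by (induction I rule: infinite_finite_induct) simp_all

abbreviation grid :: "nat \<Rightarrow> nat \<Rightarrow> (nat \<times> nat) set" where
  "grid n r \<equiv> {..<n} \<times> {..<r}"

text \<open>The tuples \<open>Z \<otimes> 1\<close> and \<open>1 \<otimes> Y\<close> in sizes \<open>n\<close> and \<open>r\<close>, without encoding pairs of indices as numbers.\<close>

definition grid_rep :: "nat \<Rightarrow> nat \<Rightarrow> ('g \<Rightarrow> nat \<Rightarrow> nat \<Rightarrow> complex) \<Rightarrow> ('g \<Rightarrow> nat \<Rightarrow> nat \<Rightarrow> complex) \<Rightarrow>
    'g list \<times> 'g list \<Rightarrow> nat \<times> nat \<Rightarrow> nat \<times> nat \<Rightarrow> complex" where
  "grid_rep n r Z Y z x y = word_entry {..<n} Z (fst z) (fst x) (fst y) * word_entry {..<r} Y (snd z) (snd x) (snd y)"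

abbreviation grid_eval where "grid_eval n r Z Y \<equiv> rep_eval (grid_rep n r Z Y)"

text \<open>All values are invertible, in terms of kernels of column vectors: for columns, linearization is the
substitution of unknowns for words. The two sizes are independent.\<close>

definition column_nonsingular :: "('g::finite \<Rightarrow> 'g \<Rightarrow> 'g bipartite_poly) \<Rightarrow> bool" where
  "column_nonsingular J \<longleftrightarrow> (\<forall>n r Z Y h.
     (\<forall>j. \<forall>x\<in>grid n r. (\<Sum>i\<in>UNIV. \<Sum>y\<in>grid n r. grid_eval n r Z Y (J j i) x y * h i y) = 0) \<longrightarrow>
     (\<forall>i. \<forall>y\<in>grid n r. h i y = 0))"

text \<open>Values outside the grid are set to zero, so that the equations of the pencil, which hold on the grid,
hold as equations between functions.\<close>

definition grid_act :: "nat \<Rightarrow> nat \<Rightarrow> ('g \<Rightarrow> nat \<Rightarrow> nat \<Rightarrow> complex) \<Rightarrow> ('g \<Rightarrow> nat \<Rightarrow> nat \<Rightarrow> complex) \<Rightarrow>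
    'g + 'g \<Rightarrow> (nat \<times> nat \<Rightarrow> complex) \<Rightarrow> nat \<times> nat \<Rightarrow> complex" where
  "grid_act n r Z Y l h = (\<lambda>(a, b). if a < n \<and> b < r then
     (case l of Inl i \<Rightarrow> \<Sum>a'<n. Z i a a' * h (a', b) | Inr j \<Rightarrow> \<Sum>b'<r. Y j b b' * h (a, b')) else 0)"

lemma grid_act_letter:
  assumes "a < n" "b < r"
  shows "grid_act n r Z Y (Inl i) h (a, b) = (\<Sum>a'<n. Z i a a' * h (a', b))"
    and "grid_act n r Z Y (Inr i) h (a, b) = (\<Sum>b'<r. Y i b b' * h (a, b'))"
  using assms by (simp_all add: grid_act_def)

lemma grid_act_Inl_word:
  assumes "a < n" "b < r"
  shows "foldr (grid_act n r Z Y) (map Inl w) h (a, b) = (\<Sum>a'<n. word_entry {..<n} Z w a a' * h (a', b))"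
  using assms(1)
proof (induction w arbitrary: a)
  case Nil
  then show ?case by (simp add: if_distrib[of "\<lambda>t. t * _"] cong: if_cong)
next
  case (Cons i w)
  have "foldr (grid_act n r Z Y) (map Inl (i # w)) h (a, b) =
      (\<Sum>c<n. \<Sum>a'<n. Z i a c * (word_entry {..<n} Z w c a' * h (a', b)))"
    using Cons assms(2) by (simp add: grid_act_letter sum_distrib_left)
  also have "\<dots> = (\<Sum>a'<n. word_entry {..<n} Z (i # w) a a' * h (a', b))"
    by (subst sum.swap) (simp add: sum_distrib_right mult.assoc)
  finally show ?case .
qed

lemma grid_act_Inr_word:
  assumes "a < n" "b < r"
  shows "foldr (grid_act n r Z Y) (map Inr v) h (a, b) = (\<Sum>b'<r. word_entry {..<r} Y v b b' * h (a, b'))"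
  using assms(2)
proof (induction v arbitrary: b)
  case Nil
  then show ?case by (simp add: if_distrib[of "\<lambda>t. t * _"] cong: if_cong)
next
  case (Cons i v)
  have "foldr (grid_act n r Z Y) (map Inr (i # v)) h (a, b) =
      (\<Sum>c<r. \<Sum>b'<r. Y i b c * (word_entry {..<r} Y v c b' * h (a, b')))"
    using Cons assms(1) by (simp add: grid_act_letter sum_distrib_left)
  also have "\<dots> = (\<Sum>b'<r. word_entry {..<r} Y (i # v) b b' * h (a, b'))"
    by (subst sum.swap) (simp add: sum_distrib_right mult.assoc)
  finally show ?case .
qed

lemma grid_act_pair_word:
  assumes "x \<in> grid n r"
  shows "foldr (grid_act n r Z Y) (pair_word z) h x = (\<Sum>y\<in>grid n r. grid_rep n r Z Y z x y * h y)"
proof -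
  obtain a b w v where xz: "x = (a, b)" "z = (w, v)" "a < n" "b < r" using assms by (cases x, cases z) auto
  have "foldr (grid_act n r Z Y) (pair_word z) h x =
      (\<Sum>a'<n. \<Sum>b'<r. word_entry {..<n} Z w a a' * (word_entry {..<r} Y v b b' * h (a', b')))"
    using xz by (simp add: grid_act_Inl_word grid_act_Inr_word sum_distrib_left)
  then show ?thesis
    unfolding sum.cartesian_product by (simp add: xz grid_rep_def case_prod_beta mult.assoc)
qed

lemma sum_letters:
  fixes F :: "'g::finite + 'g \<Rightarrow> 'a::comm_monoid_add"
  shows "(\<Sum>l\<in>UNIV. F l) = (\<Sum>i\<in>UNIV. F (Inl i)) + (\<Sum>j\<in>UNIV. F (Inr j))"
  by (simp add: UNIV_Plus_UNIV[symmetric] sum.Plus del: UNIV_Plus_UNIV)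

text \<open>A kernel vector of the pencil at \<open>(Z, Y)\<close> consists of the words applied to a kernel vector of \<open>J\<close>, by
linearization over the functions on the grid.\<close>

lemma pencil_nonsingular:
  fixes J :: "'g::finite \<Rightarrow> 'g \<Rightarrow> 'g bipartite_poly" and n r :: nat
  assumes ns: "column_nonsingular J" and "m > 0"
    and J_const: "\<And>j i. Poly_Mapping.lookup (J j i) ([], []) = (if j = i then 1 else 0)"
    and J_deg: "\<And>j i z. z \<in> Poly_Mapping.keys (J j i) \<Longrightarrow> length (pair_word z) \<le> m"
    and eq: "\<And>\<sigma> a b. \<sigma> \<in> states m \<Longrightarrow> a < n \<Longrightarrow> b < r \<Longrightarrow> x \<sigma> a b =
        (\<Sum>i\<in>UNIV. \<Sum>\<tau>\<in>states m. \<Sum>a'<n. pencil J (Inl i) \<sigma> \<tau> * Z i a a' * x \<tau> a' b) +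
        (\<Sum>j\<in>UNIV. \<Sum>\<tau>\<in>states m. \<Sum>b'<r. pencil J (Inr j) \<sigma> \<tau> * Y j b b' * x \<tau> a b')"
    and \<sigma>: "\<sigma> \<in> states m" "a < n" "b < r"
  shows "x \<sigma> a b = 0"
proof -
  define X where "X \<sigma> = (\<lambda>(a, b). if a < n \<and> b < r then x \<sigma> a b else 0)" for \<sigma>
  let ?act = "grid_act n r Z Y"
  interpret linearization J m "\<lambda>c h y. c * h y" ?act
    by unfold_locales (auto simp: fun_eq_iff J_const intro: J_deg)
  have X: "X (s, j) = (if s = [] then 0 else 0) +
      (\<Sum>l\<in>UNIV. \<Sum>\<tau>\<in>states m. (\<lambda>y. pencil J l (s, j) \<tau> * ?act l (X \<tau>) y))" if "length s < m" for s j
  proof (rule ext)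
    fix y :: "nat \<times> nat"
    obtain a b where y: "y = (a, b)" by (cases y)
    show "X (s, j) y = ((if s = [] then 0 else 0) +
        (\<Sum>l\<in>UNIV. \<Sum>\<tau>\<in>states m. (\<lambda>y. pencil J l (s, j) \<tau> * ?act l (X \<tau>) y))) y"
    proof (cases "a < n \<and> b < r")
      case True
      have "(s, j) \<in> states m" using that by (simp add: states_def)
      then have "X (s, j) y =
          (\<Sum>i\<in>UNIV. \<Sum>\<tau>\<in>states m. \<Sum>a'<n. pencil J (Inl i) (s, j) \<tau> * Z i a a' * x \<tau> a' b) +
          (\<Sum>i\<in>UNIV. \<Sum>\<tau>\<in>states m. \<Sum>b'<r. pencil J (Inr i) (s, j) \<tau> * Y i b b' * x \<tau> a b')"
        using True eq[of "(s, j)" a b] by (simp add: X_def y)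
      also have "\<dots> = (\<Sum>l\<in>UNIV. \<Sum>\<tau>\<in>states m. pencil J l (s, j) \<tau> * ?act l (X \<tau>) y)"
        using True by (simp add: sum_letters y grid_act_letter X_def sum_distrib_left mult.assoc)
      finally show ?thesis by (simp add: sum_fun_apply)
    next
      case False
      then have "?act l h y = 0" "X (s, j) y = 0" for l h by (auto simp: y X_def grid_act_def)
      then show ?thesis by (simp add: sum_fun_apply)
    qed
  qed
  have sol1: "X (s, j) = foldr ?act s (X ([], j))" if "length s < m" for s j
    by (rule pencil_solution(1)[where x = X and e = "\<lambda>_. 0"], rule X) (use that in auto)
  have sol2: "(\<Sum>i\<in>UNIV. \<Sum>z\<in>Poly_Mapping.keys (J j i).
      (\<lambda>y. Poly_Mapping.lookup (J j i) z * foldr ?act (pair_word z) (X ([], i)) y)) = 0" for j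
    by (rule pencil_solution(2)[where x = X and e = "\<lambda>_. 0"], rule X) (use \<open>m > 0\<close> in auto)
  have "\<forall>i. \<forall>y\<in>grid n r. X ([], i) y = 0"
  proof (rule ns[unfolded column_nonsingular_def, THEN spec[of _ n], THEN spec[of _ r], THEN spec[of _ Z],
        THEN spec[of _ Y], THEN spec[of _ "\<lambda>i. X ([], i)"], THEN mp], intro allI ballI)
    fix j x assume ab: "x \<in> grid n r"
    have "(\<Sum>y\<in>grid n r. grid_eval n r Z Y (J j i) x y * X ([], i) y) =
        (\<Sum>z\<in>Poly_Mapping.keys (J j i). Poly_Mapping.lookup (J j i) z *
           foldr ?act (pair_word z) (X ([], i)) x)" for i
      unfolding rep_eval_def sum_distrib_right
      by (subst sum.swap) (use ab in \<open>simp add: grid_act_pair_word sum_distrib_left mult.assoc\<close>)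
    then show "(\<Sum>i\<in>UNIV. \<Sum>y\<in>grid n r. grid_eval n r Z Y (J j i) x y * X ([], i) y) = 0"
      using fun_cong[OF sol2, of j x] by (simp add: sum_fun_apply)
  qed
  then have "X ([], i) = 0" for i by (auto simp: fun_eq_iff X_def)
  moreover have "foldr ?act s 0 = 0" for s
    by (induction s) (auto simp: grid_act_def fun_eq_iff split: sum.splits)
  ultimately have "X \<sigma> = 0"
    using sol1[of "fst \<sigma>" "snd \<sigma>"] \<sigma>(1) by (auto simp: states_def)
  then have "X \<sigma> (a, b) = 0" by simp
  then show ?thesis using \<sigma> by (simp add: X_def)
qed

section \<open>From nonsingular values to an inverse\<close>

abbreviation const_poly :: "complex \<Rightarrow> 'k::zero \<Rightarrow>\<^sub>0 complex" where
  "const_poly \<equiv> Poly_Mapping.single 0"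

text \<open>Evaluating a matrix over the free algebra at \<open>n \<times> n\<close> matrices gives a matrix indexed by
\<open>D \<times> {..<n}\<close>, multiplicatively.\<close>

lemma word_entry_matrix_eval:
  fixes T :: "'l \<Rightarrow> 'd \<Rightarrow> 'd \<Rightarrow> 'g free_poly"
  assumes "a < n" "b < n"
  shows "word_entry (D \<times> {..<n}) (\<lambda>j x y. matrix_eval n Z (T j (fst x) (fst y)) (snd x) (snd y)) u (\<alpha>, a) (\<beta>, b) =
    matrix_eval n Z (word_entry D T u \<alpha> \<beta>) a b"
  using assms(1)
proof (induction u arbitrary: \<alpha> a)
  case Nil
  have "matrix_eval n Z (1 :: 'g free_poly) a b = (if a = b then 1 else 0)" for a b
    unfolding single_one[symmetric] rep_eval_single by (simp add: zero_list_def)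
  then show ?case by simp
next
  case (Cons j u)
  then show ?case
    by (simp add: sum.cartesian_product' rep_eval_sum matrix_eval_mult)
qed

lemma single_commute:
  fixes f :: "'k::monoid_add \<Rightarrow>\<^sub>0 complex"
  shows "const_poly c * f = f * const_poly c"
  by (induction f rule: poly_mapping_add_induct)
     (simp_all add: mult_single mult.commute distrib_left distrib_right)

lemma const_poly_hom:
  "const_poly 0 = (0 :: 'k::monoid_add \<Rightarrow>\<^sub>0 complex)" "const_poly 1 = (1 :: 'k \<Rightarrow>\<^sub>0 complex)"
  "const_poly (a + b) = (const_poly a + const_poly b :: 'k \<Rightarrow>\<^sub>0 complex)"
  "const_poly (a * b) = (const_poly a * const_poly b :: 'k \<Rightarrow>\<^sub>0 complex)"
  by (simp_all add: single_add mult_single)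

definition lift_left :: "'g free_poly \<Rightarrow> 'g bipartite_poly" where
  "lift_left f = (\<Sum>w\<in>Poly_Mapping.keys f. Poly_Mapping.single (w, 0) (Poly_Mapping.lookup f w))"

lemma lift_left_superset:
  assumes "finite S" "Poly_Mapping.keys f \<subseteq> S"
  shows "lift_left f = (\<Sum>w\<in>S. Poly_Mapping.single (w, 0) (Poly_Mapping.lookup f w))"
  unfolding lift_left_def by (rule sum.mono_neutral_left) (use assms in \<open>auto simp: in_keys_iff\<close>)

lemma lift_left_zero [simp]: "lift_left 0 = 0"
  by (simp add: lift_left_def)

lemma lift_left_add: "lift_left (f + g) = lift_left f + lift_left g"
proof -
  let ?S = "Poly_Mapping.keys f \<union> Poly_Mapping.keys g"
  have "Poly_Mapping.keys (f + g) \<subseteq> ?S" by (rule Poly_Mapping.keys_add)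
  then show ?thesis
    by (simp add: lift_left_superset[of ?S] lookup_add single_add sum.distrib)
qed

lemma lift_left_single: "lift_left (Poly_Mapping.single w c) = Poly_Mapping.single (w, 0) c"
  by (simp add: lift_left_superset[of "{w}"])

lemma lift_left_one [simp]: "lift_left 1 = 1"
  unfolding single_one[symmetric] lift_left_single by (simp add: zero_prod_def)

lemma lift_left_mult: "lift_left (f * g) = lift_left f * lift_left g"
proof (induction f rule: poly_mapping_add_induct)
  case (add k c f)
  have "lift_left (Poly_Mapping.single k c * g) = lift_left (Poly_Mapping.single k c) * lift_left g"
  proof (induction g rule: poly_mapping_add_induct)
    case (add l d g)
    then show ?case
      by (simp add: distrib_left lift_left_add mult_single lift_left_single)
  qed simp
  with add show ?case by (simp add: distrib_right lift_left_add)
qed simp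

lemma lift_left_diff: "lift_left (f - g) = lift_left f - lift_left g"
  by (metis add_diff_cancel_right' diff_add_cancel lift_left_add)

lemma lift_left_sum: "lift_left (\<Sum>i\<in>I. f i) = (\<Sum>i\<in>I. lift_left (f i))"
  by (induction I rule: infinite_finite_induct) (simp_all add: lift_left_add)

lemma lift_left_commute:
  "lift_left f * Poly_Mapping.single (0, v) c = Poly_Mapping.single (0, v) c * lift_left f"
  by (induction f rule: poly_mapping_add_induct)
     (simp_all add: lift_left_add lift_left_single mult_single mult.commute distrib_left distrib_right)

text \<open>Products are taken over an explicit index set; identities of matrices are stated on that set only.\<close>

definition mat_prod :: "'d set \<Rightarrow> ('d \<Rightarrow> 'd \<Rightarrow> 'r::ring_1) \<Rightarrow> ('d \<Rightarrow> 'd \<Rightarrow> 'r) \<Rightarrow> 'd \<Rightarrow> 'd \<Rightarrow> 'r" where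
  "mat_prod S A B = (\<lambda>x y. \<Sum>z\<in>S. A x z * B z y)"

definition unit_mat :: "'d \<Rightarrow> 'd \<Rightarrow> 'r::ring_1" where
  "unit_mat x y = (if x = y then 1 else 0)"

lemma mat_prod_assoc: "mat_prod S (mat_prod S A B) C = mat_prod S A (mat_prod S B C)"
proof (intro ext)
  fix x y
  have "mat_prod S (mat_prod S A B) C x y = (\<Sum>z\<in>S. \<Sum>w\<in>S. A x w * (B w z * C z y))"
    by (simp add: mat_prod_def sum_distrib_right mult.assoc)
  also have "\<dots> = mat_prod S A (mat_prod S B C) x y"
    by (subst sum.swap) (simp add: mat_prod_def sum_distrib_left)
  finally show "mat_prod S (mat_prod S A B) C x y = mat_prod S A (mat_prod S B C) x y" .
qed

lemma mat_prod_cong: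
  "(\<And>x y. x \<in> S \<Longrightarrow> y \<in> S \<Longrightarrow> A x y = A' x y) \<Longrightarrow> (\<And>x y. x \<in> S \<Longrightarrow> y \<in> S \<Longrightarrow> B x y = B' x y) \<Longrightarrow>
    x \<in> S \<Longrightarrow> y \<in> S \<Longrightarrow> mat_prod S A B x y = mat_prod S A' B' x y"
  by (simp add: mat_prod_def)

lemma mat_prod_distrib:
  "mat_prod S (A - A') B = mat_prod S A B - mat_prod S A' B" "mat_prod S A (B - B') = mat_prod S A B - mat_prod S A B'"
  by (simp_all add: mat_prod_def fun_eq_iff left_diff_distrib right_diff_distrib sum_subtractf)

lemma mat_prod_unit:
  assumes "finite S"
  shows "x \<in> S \<Longrightarrow> mat_prod S unit_mat A x y = A x y" "y \<in> S \<Longrightarrow> mat_prod S A unit_mat x y = A x y"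
  using assms by (simp_all add: mat_prod_def unit_mat_def if_distrib[of "\<lambda>t. t * _"]
      if_distrib[of "\<lambda>t. _ * t"] cong: if_cong)

text \<open>The factorization \<open>C - N = C (1 - B N)\<close> with \<open>B\<close> inverse to \<open>C\<close>; the hypotheses on \<open>E\<close> say that it
is inverse to \<open>1 - B N\<close>.\<close>

lemma perturbed_inverse:
  fixes C B N E :: "'d \<Rightarrow> 'd \<Rightarrow> 'r::ring_1"
  assumes S: "finite S"
    and CB: "\<And>x y. x \<in> S \<Longrightarrow> y \<in> S \<Longrightarrow> mat_prod S C B x y = unit_mat x y"
    and BC: "\<And>x y. x \<in> S \<Longrightarrow> y \<in> S \<Longrightarrow> mat_prod S B C x y = unit_mat x y"
    and PE: "\<And>x y. x \<in> S \<Longrightarrow> y \<in> S \<Longrightarrow> mat_prod S (mat_prod S B N) E x y = E x y - unit_mat x y"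
    and EP: "\<And>x y. x \<in> S \<Longrightarrow> y \<in> S \<Longrightarrow> mat_prod S E (mat_prod S B N) x y = E x y - unit_mat x y"
    and xy: "x \<in> S" "y \<in> S"
  shows "mat_prod S (C - N) (mat_prod S E B) x y = unit_mat x y"
    and "mat_prod S (mat_prod S E B) (C - N) x y = unit_mat x y"
proof -
  have NE: "mat_prod S N E x y = mat_prod S C E x y - C x y" if "x \<in> S" "y \<in> S" for x y
  proof -
    have "mat_prod S N E x y = mat_prod S unit_mat (mat_prod S N E) x y" using that by (simp add: mat_prod_unit S)
    also have "\<dots> = mat_prod S (mat_prod S C B) (mat_prod S N E) x y" using that by (intro mat_prod_cong) (simp_all add: CB)
    also have "\<dots> = mat_prod S C (mat_prod S (mat_prod S B N) E) x y" by (simp add: mat_prod_assoc)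
    also have "\<dots> = mat_prod S C (E - unit_mat) x y" using that by (intro mat_prod_cong) (simp_all add: PE)
    finally show ?thesis using that by (simp add: mat_prod_distrib mat_prod_unit S)
  qed
  have "mat_prod S (C - N) (mat_prod S E B) x y = mat_prod S (mat_prod S C E - mat_prod S N E) B x y"
    by (simp add: mat_prod_assoc mat_prod_distrib)
  also have "\<dots> = mat_prod S C B x y" using xy by (intro mat_prod_cong) (simp_all add: NE)
  finally show "mat_prod S (C - N) (mat_prod S E B) x y = unit_mat x y" using xy by (simp add: CB)
  have "mat_prod S (mat_prod S E B) (C - N) x y = mat_prod S E (mat_prod S B C - mat_prod S B N) x y"
    by (simp add: mat_prod_assoc mat_prod_distrib)
  also have "\<dots> = mat_prod S E (unit_mat - mat_prod S B N) x y" using xy by (intro mat_prod_cong) (simp_all add: BC)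
  also have "\<dots> = unit_mat x y" using xy by (simp add: mat_prod_distrib mat_prod_unit S EP)
  finally show "mat_prod S (mat_prod S E B) (C - N) x y = unit_mat x y" .
qed

lemma rep_eval_const_mult:
  fixes f :: "'k::monoid_add \<Rightarrow>\<^sub>0 complex"
  shows "rep_eval \<rho> (const_poly c * f) x y = c * rep_eval \<rho> f x y"
  by (induction f rule: poly_mapping_add_induct)
     (simp_all add: distrib_left rep_eval_add mult_single rep_eval_single)

lemma monomial_expansion: "(\<Sum>z\<in>Poly_Mapping.keys f. Poly_Mapping.single z (Poly_Mapping.lookup f z)) = f"
  by (rule poly_mapping_eqI) (auto simp: lookup_sum lookup_single when_def in_keys_iff)

fun letter :: "'g + 'g \<Rightarrow> 'g bipartite_poly" where
  "letter (Inl i) = Poly_Mapping.single ([i], 0) 1"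
| "letter (Inr j) = Poly_Mapping.single (0, [j]) 1"

lemma foldr_letter_pair_word:
  fixes f :: "'g bipartite_poly"
  shows "foldr (\<lambda>l v. letter l * v) (pair_word z) f = Poly_Mapping.single z 1 * f"
proof -
  have one: "Poly_Mapping.single ([], []) 1 = (1 :: 'g bipartite_poly)"
    unfolding single_one[symmetric] by (simp add: zero_prod_def zero_list_def)
  have right: "foldr (\<lambda>l v. letter l * v) (map Inr v) f = Poly_Mapping.single ([], v) 1 * f" for v
    by (induction v) (simp_all add: one mult_single plus_list_def zero_list_def mult.assoc[symmetric])
  have left: "foldr (\<lambda>l v. letter l * v) (map Inl w) f = Poly_Mapping.single (w, []) 1 * f" for w and f :: "'g bipartite_poly"
    by (induction w) (simp_all add: one mult_single plus_list_def zero_list_def mult.assoc[symmetric])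
  obtain w v where "z = (w, v)" by (cases z)
  then show ?thesis
    by (simp add: right left mult_single plus_list_def mult.assoc[symmetric])
qed

text \<open>The coefficient matrices of the pencil are \<open>M\<^sub>i\<close> at \<open>z\<^sub>i\<close> and \<open>V\<^sub>j\<close> at \<open>y\<^sub>j\<close>. The \<open>M\<^sub>i\<close> are jointly nilpotent,
which gives the inverse \<open>A\<close> of \<open>1 - \<Sum>\<^sub>i M\<^sub>i z\<^sub>i\<close>. For fixed \<open>Z\<close>, a kernel vector of
\<open>1 - \<Sum>\<^sub>j T\<^sub>j(Z) \<otimes> Y\<^sub>j\<close> with \<open>T\<^sub>j = A V\<^sub>j\<close> is one of the pencil, so the \<open>T\<^sub>j(Z)\<close> are jointly nilpotent as well,
and uniformly so. The inverse of the pencil that results yields the inverse of \<open>J\<close>: its columns at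
the empty word form a right inverse, and its left inverse property makes \<open>J\<close> left cancellable.\<close>

theorem column_nonsingular_imp_invertible:
  fixes J :: "'g::finite \<Rightarrow> 'g \<Rightarrow> 'g bipartite_poly"
  assumes ns: "column_nonsingular J"
    and J_const: "\<And>j i. Poly_Mapping.lookup (J j i) ([], []) = (if j = i then 1 else 0)"
  obtains K where "\<And>j k. (\<Sum>i\<in>UNIV. J j i * K i k) = unit_mat j k"
    "\<And>j k. (\<Sum>i\<in>UNIV. K j i * J i k) = unit_mat j k"
proof -
  have "finite (\<Union>j i. (\<lambda>z. length (pair_word z)) ` Poly_Mapping.keys (J j i))" by simp
  then obtain m0 where "\<forall>l\<in>(\<Union>j i. (\<lambda>z. length (pair_word z)) ` Poly_Mapping.keys (J j i)). l \<le> m0"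
    unfolding finite_nat_set_iff_bounded_le ..
  then have m0: "length (pair_word z) \<le> m0" if "z \<in> Poly_Mapping.keys (J j i)" for z j i
    using that by auto
  define m where "m = Suc m0"
  have J_deg: "z \<in> Poly_Mapping.keys (J j i) \<Longrightarrow> length (pair_word z) \<le> m" for z j i
    using m0 unfolding m_def by (rule le_SucI)
  have "m > 0" by (simp add: m_def)
  note pencil_ns = pencil_nonsingular[OF ns \<open>m > 0\<close> J_const J_deg]
  define S :: "(('g + 'g) list \<times> 'g) set" where "S = states m"
  have fS: "finite S" by (simp add: S_def)
  define M where "M i = pencil J (Inl i)" for i
  define V where "V j = pencil J (Inr j)" for j
  define N where "N = card S"

  have M_nil: "word_entry S M w \<alpha> \<beta> = 0" if "length w \<ge> N" "\<alpha> \<in> S" "\<beta> \<in> S" for w \<alpha> \<beta>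
  proof (rule nilpotent_if_pencil_nonsingular[OF fS _ that[unfolded N_def]])
    fix r :: nat and Y :: "'g \<Rightarrow> nat \<Rightarrow> nat \<Rightarrow> complex" and x
    assume eq: "\<And>\<gamma> b. \<gamma> \<in> S \<Longrightarrow> b < r \<Longrightarrow>
        x \<gamma> b = (\<Sum>j\<in>UNIV. \<Sum>\<delta>\<in>S. \<Sum>c<r. M j \<gamma> \<delta> * Y j b c * x \<delta> c)"
    show "\<forall>\<gamma>\<in>S. \<forall>b<r. x \<gamma> b = 0"
    proof (intro ballI allI impI)
      fix \<gamma> b assume "\<gamma> \<in> S" "b < r"
      then show "x \<gamma> b = 0"
        by (intro pencil_ns[where x = "\<lambda>\<sigma> a _. x \<sigma> a" and n = r and r = 1 and Z = Y
              and Y = "\<lambda>_ _ _. 0" and a = b and b = 0])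
           (auto simp: eq S_def[symmetric] M_def[symmetric])
    qed
  qed

  define zl :: "'g \<Rightarrow> 'g free_poly" where "zl i = Poly_Mapping.single [i] 1" for i
  define A where "A \<alpha> \<beta> = (\<Sum>w | length w < N. const_poly (word_entry S M w \<alpha> \<beta>) * word_monomial zl w)" for \<alpha> \<beta>
  have A: "(\<Sum>i\<in>UNIV. \<Sum>\<gamma>\<in>S. const_poly (M i \<alpha> \<gamma>) * zl i * A \<gamma> \<beta>) = A \<alpha> \<beta> - (if \<alpha> = \<beta> then 1 else 0)"
      "(\<Sum>i\<in>UNIV. \<Sum>\<gamma>\<in>S. A \<alpha> \<gamma> * (const_poly (M i \<gamma> \<beta>) * zl i)) = A \<alpha> \<beta> - (if \<alpha> = \<beta> then 1 else 0)"
    if "\<alpha> \<in> S" "\<beta> \<in> S" for \<alpha> \<beta>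
    unfolding A_def
    by (rule nilpotent_pencil_inverse[OF fS _ const_poly_hom single_commute that]; simp add: M_nil)+
  define T where "T j \<alpha> \<beta> = (\<Sum>\<gamma>\<in>S. A \<alpha> \<gamma> * const_poly (V j \<gamma> \<beta>))" for j \<alpha> \<beta>

  have T_local: "matrix_eval n Z (word_entry S T u \<alpha> \<beta>) a b = 0"
    if u: "length u \<ge> card S * n" "\<alpha> \<in> S" "\<beta> \<in> S" "a < n" "b < n" for n Z u \<alpha> \<beta> a b
  proof -
    let ?T = "\<lambda>j x y. matrix_eval n Z (T j (fst x) (fst y)) (snd x) (snd y)"
    have "word_entry (S \<times> {..<n}) ?T u (\<alpha>, a) (\<beta>, b) = 0"
    proof (rule nilpotent_if_pencil_nonsingular)
      fix r :: nat and Y :: "'g \<Rightarrow> nat \<Rightarrow> nat \<Rightarrow> complex" and x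
      assume eq: "\<And>\<gamma> b. \<gamma> \<in> S \<times> {..<n} \<Longrightarrow> b < r \<Longrightarrow> x \<gamma> b =
          (\<Sum>j\<in>UNIV. \<Sum>\<delta>\<in>S \<times> {..<n}. \<Sum>c<r. ?T j \<gamma> \<delta> * Y j b c * x \<delta> c)"
      \<comment> \<open>Since \<open>T\<^sub>j = A V\<^sub>j\<close>, the kernel equation reads \<open>x = A y\<close>; applying the inverse of \<open>A\<close> gives the pencil.\<close>
      define y where "y \<gamma> a b = (\<Sum>j\<in>UNIV. \<Sum>\<delta>\<in>S. \<Sum>c<r. V j \<gamma> \<delta> * Y j b c * x (\<delta>, a) c)" for \<gamma> a b
      have T_ev: "matrix_eval n Z (T j \<alpha> \<beta>) a a' = (\<Sum>\<gamma>\<in>S. V j \<gamma> \<beta> * matrix_eval n Z (A \<alpha> \<gamma>) a a')" for j \<alpha> \<beta> a a'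
        unfolding T_def by (subst single_commute[symmetric]) (simp add: rep_eval_sum rep_eval_const_mult)
      have xy: "x (\<alpha>, a) b = (\<Sum>\<gamma>\<in>S. \<Sum>a'<n. matrix_eval n Z (A \<alpha> \<gamma>) a a' * y \<gamma> a' b)"
        if "\<alpha> \<in> S" "a < n" "b < r" for \<alpha> a b
      proof -
        have "x (\<alpha>, a) b = (\<Sum>j\<in>UNIV. \<Sum>\<delta>\<in>S. \<Sum>a'<n. \<Sum>c<r. \<Sum>\<gamma>\<in>S.
            matrix_eval n Z (A \<alpha> \<gamma>) a a' * (V j \<gamma> \<delta> * Y j b c * x (\<delta>, a') c))"
          using that by (subst eq) (simp_all add: sum.cartesian_product' T_ev sum_distrib_left mult_ac)
        also have "\<dots> = (\<Sum>(j, \<delta>, a', c, \<gamma>)\<in>UNIV \<times> S \<times> {..<n} \<times> {..<r} \<times> S.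
            matrix_eval n Z (A \<alpha> \<gamma>) a a' * (V j \<gamma> \<delta> * Y j b c * x (\<delta>, a') c))"
          by (simp add: sum.cartesian_product)
        also have "\<dots> = (\<Sum>(\<gamma>, a', j, \<delta>, c)\<in>S \<times> {..<n} \<times> UNIV \<times> S \<times> {..<r}.
            matrix_eval n Z (A \<alpha> \<gamma>) a a' * (V j \<gamma> \<delta> * Y j b c * x (\<delta>, a') c))"
          by (rule sum.reindex_bij_witness[of _ "\<lambda>(\<gamma>, a', j, \<delta>, c). (j, \<delta>, a', c, \<gamma>)"
                "\<lambda>(j, \<delta>, a', c, \<gamma>). (\<gamma>, a', j, \<delta>, c)"]) auto
        also have "\<dots> = (\<Sum>\<gamma>\<in>S. \<Sum>a'<n. matrix_eval n Z (A \<alpha> \<gamma>) a a' * y \<gamma> a' b)"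
          by (simp add: sum.cartesian_product[symmetric] y_def sum_distrib_left)
        finally show ?thesis .
      qed
      have A_ev: "(\<Sum>i\<in>UNIV. \<Sum>\<gamma>\<in>S. \<Sum>a'<n. M i \<alpha> \<gamma> * Z i a a' * matrix_eval n Z (A \<gamma> \<beta>) a' c) =
          matrix_eval n Z (A \<alpha> \<beta>) a c - (if \<alpha> = \<beta> \<and> a = c then 1 else 0)"
        if "\<alpha> \<in> S" "\<beta> \<in> S" "a < n" "c < n" for \<alpha> \<beta> a c
      proof -
        have one: "matrix_eval n Z (if \<alpha> = \<beta> then 1 else 0) a c = (if \<alpha> = \<beta> \<and> a = c then 1 else 0)"
          by (simp add: single_one[symmetric] rep_eval_single zero_list_def del: single_one)
        have "matrix_eval n Z (const_poly (M i \<alpha> \<gamma>) * zl i * A \<gamma> \<beta>) a c =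
            (\<Sum>a'<n. M i \<alpha> \<gamma> * Z i a a' * matrix_eval n Z (A \<gamma> \<beta>) a' c)" for i \<gamma>
          using that by (simp add: mult.assoc rep_eval_const_mult matrix_eval_mult zl_def rep_eval_single word_entry_single
              sum_distrib_left del: word_entry.simps)
        then have "(\<Sum>i\<in>UNIV. \<Sum>\<gamma>\<in>S. \<Sum>a'<n. M i \<alpha> \<gamma> * Z i a a' * matrix_eval n Z (A \<gamma> \<beta>) a' c) =
            matrix_eval n Z (A \<alpha> \<beta> - (if \<alpha> = \<beta> then 1 else 0)) a c"
          by (simp add: A(1)[OF that(1,2), symmetric] rep_eval_sum)
        also have "\<dots> + matrix_eval n Z (if \<alpha> = \<beta> then 1 else 0) a c = matrix_eval n Z (A \<alpha> \<beta>) a c"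
          unfolding rep_eval_add[symmetric] by simp
        finally show ?thesis unfolding one by (simp add: algebra_simps)
      qed
      have fix_eq: "x (\<alpha>, a) b =
          (\<Sum>i\<in>UNIV. \<Sum>\<tau>\<in>S. \<Sum>a'<n. M i \<alpha> \<tau> * Z i a a' * x (\<tau>, a') b) +
          (\<Sum>j\<in>UNIV. \<Sum>\<tau>\<in>S. \<Sum>b'<r. V j \<alpha> \<tau> * Y j b b' * x (\<tau>, a) b')"
        if "\<alpha> \<in> S" "a < n" "b < r" for \<alpha> a b
      proof -
        have "(\<Sum>i\<in>UNIV. \<Sum>\<tau>\<in>S. \<Sum>a'<n. M i \<alpha> \<tau> * Z i a a' * x (\<tau>, a') b) =
            (\<Sum>i\<in>UNIV. \<Sum>\<tau>\<in>S. \<Sum>a'<n. \<Sum>\<gamma>\<in>S. \<Sum>c<n. M i \<alpha> \<tau> * Z i a a' * matrix_eval n Z (A \<tau> \<gamma>) a' c * y \<gamma> c b)"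
          using that by (simp add: xy sum_distrib_left mult.assoc)
        also have "\<dots> = (\<Sum>(i, \<tau>, a', \<gamma>, c)\<in>UNIV \<times> S \<times> {..<n} \<times> S \<times> {..<n}.
            M i \<alpha> \<tau> * Z i a a' * matrix_eval n Z (A \<tau> \<gamma>) a' c * y \<gamma> c b)"
          by (simp add: sum.cartesian_product)
        also have "\<dots> = (\<Sum>(\<gamma>, c, i, \<tau>, a')\<in>S \<times> {..<n} \<times> UNIV \<times> S \<times> {..<n}.
            M i \<alpha> \<tau> * Z i a a' * matrix_eval n Z (A \<tau> \<gamma>) a' c * y \<gamma> c b)"
          by (rule sum.reindex_bij_witness[of _ "\<lambda>(\<gamma>, c, i, \<tau>, a'). (i, \<tau>, a', \<gamma>, c)"
                "\<lambda>(i, \<tau>, a', \<gamma>, c). (\<gamma>, c, i, \<tau>, a')"]) auto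
        also have "\<dots> = (\<Sum>\<gamma>\<in>S. \<Sum>c<n. (\<Sum>i\<in>UNIV. \<Sum>\<tau>\<in>S. \<Sum>a'<n.
            M i \<alpha> \<tau> * Z i a a' * matrix_eval n Z (A \<tau> \<gamma>) a' c) * y \<gamma> c b)"
          by (simp add: sum.cartesian_product[symmetric] sum_distrib_right)
        also have "\<dots> = (\<Sum>\<gamma>\<in>S. \<Sum>c<n. (matrix_eval n Z (A \<alpha> \<gamma>) a c - (if \<alpha> = \<gamma> \<and> a = c then 1 else 0)) * y \<gamma> c b)"
          using that by (intro sum.cong refl arg_cong2[of _ _ _ _ times] A_ev) auto
        also have "\<dots> = x (\<alpha>, a) b - (\<Sum>\<gamma>\<in>S. \<Sum>c<n. (if \<alpha> = \<gamma> \<and> a = c then 1 else 0) * y \<gamma> c b)"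
          using that by (simp add: xy left_diff_distrib sum_subtractf)
        also have "(\<Sum>\<gamma>\<in>S. \<Sum>c<n. (if \<alpha> = \<gamma> \<and> a = c then 1 else 0) * y \<gamma> c b) =
            (\<Sum>i\<in>S \<times> {..<n}. if i = (\<alpha>, a) then y \<alpha> a b else 0)"
          unfolding sum.cartesian_product by (intro sum.cong refl) (auto split: if_splits)
        also have "\<dots> = y \<alpha> a b" using that fS by (subst sum.delta) auto
        finally show ?thesis by (simp add: y_def)
      qed
      show "\<forall>\<gamma>\<in>S \<times> {..<n}. \<forall>b<r. x \<gamma> b = 0"
      proof clarify
        fix \<sigma> t a b assume "(\<sigma>, t) \<in> S" "a < n" "b < r"
        then show "x ((\<sigma>, t), a) b = 0"
          by (intro pencil_ns[where x = "\<lambda>\<sigma> a b. x (\<sigma>, a) b" and n = n and r = r and Z = Z and Y = Y,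
                folded S_def M_def V_def] fix_eq) auto
      qed
    qed (use u fS in \<open>auto simp: card_cartesian_product\<close>)
    then show ?thesis using u by (simp add: word_entry_matrix_eval)
  qed
  have T_nil: "word_entry S T u \<alpha> \<beta> = 0" if "length u \<ge> N" "\<alpha> \<in> S" "\<beta> \<in> S" for u \<alpha> \<beta>
    by (rule uniform_nilpotency[OF fS T_local]) (use that N_def in auto)

  define yl :: "'g \<Rightarrow> 'g bipartite_poly" where "yl j = letter (Inr j)" for j
  define E0 where "E0 \<alpha> \<beta> = (\<Sum>u | length u < N. lift_left (word_entry S T u \<alpha> \<beta>) * word_monomial yl u)" for \<alpha> \<beta>
  have E0: "(\<Sum>j\<in>UNIV. \<Sum>\<gamma>\<in>S. lift_left (T j \<alpha> \<gamma>) * yl j * E0 \<gamma> \<beta>) = E0 \<alpha> \<beta> - (if \<alpha> = \<beta> then 1 else 0)"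
      "(\<Sum>j\<in>UNIV. \<Sum>\<gamma>\<in>S. E0 \<alpha> \<gamma> * (lift_left (T j \<gamma> \<beta>) * yl j)) = E0 \<alpha> \<beta> - (if \<alpha> = \<beta> then 1 else 0)"
    if "\<alpha> \<in> S" "\<beta> \<in> S" for \<alpha> \<beta>
    unfolding E0_def
    by (rule nilpotent_pencil_inverse[OF fS _ lift_left_zero lift_left_one lift_left_add lift_left_mult _ that];
        simp add: T_nil yl_def lift_left_commute)+
  define B where "B \<alpha> \<beta> = lift_left (A \<alpha> \<beta>)" for \<alpha> \<beta>
  define C where "C \<alpha> \<beta> = unit_mat \<alpha> \<beta> - (\<Sum>i\<in>UNIV. const_poly (M i \<alpha> \<beta>) * letter (Inl i))" for \<alpha> \<beta>
  define Q where "Q \<alpha> \<beta> = (\<Sum>j\<in>UNIV. const_poly (V j \<alpha> \<beta>) * letter (Inr j))" for \<alpha> \<beta>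
  have lift_const: "lift_left (const_poly c) = const_poly c" for c
    by (simp add: lift_left_single zero_prod_def)
  have lift_zl: "lift_left (zl i) = letter (Inl i)" for i
    by (simp add: zl_def lift_left_single)
  have lift_if: "lift_left (if b then 1 else 0) = (if b then 1 else 0)" for b
    by simp
  have BQ: "mat_prod S B Q \<alpha> \<beta> = (\<Sum>j\<in>UNIV. lift_left (T j \<alpha> \<beta>) * yl j)" for \<alpha> \<beta>
  proof -
    have "mat_prod S B Q \<alpha> \<beta> = (\<Sum>j\<in>UNIV. \<Sum>\<gamma>\<in>S. B \<alpha> \<gamma> * (const_poly (V j \<gamma> \<beta>) * yl j))"
      unfolding mat_prod_def Q_def sum_distrib_left yl_def by (rule sum.swap)
    then show ?thesis
      by (simp add: T_def lift_left_sum lift_left_mult lift_const B_def sum_distrib_right mult.assoc)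
  qed
  have CB: "mat_prod S C B \<alpha> \<beta> = unit_mat \<alpha> \<beta>" if "\<alpha> \<in> S" "\<beta> \<in> S" for \<alpha> \<beta>
  proof -
    have "(\<Sum>\<gamma>\<in>S. (\<Sum>i\<in>UNIV. const_poly (M i \<alpha> \<gamma>) * letter (Inl i)) * B \<gamma> \<beta>) =
        lift_left (\<Sum>i\<in>UNIV. \<Sum>\<gamma>\<in>S. const_poly (M i \<alpha> \<gamma>) * zl i * A \<gamma> \<beta>)"
      by (subst sum.swap) (simp add: lift_left_sum lift_left_mult lift_const lift_zl B_def sum_distrib_right)
    also have "\<dots> = B \<alpha> \<beta> - unit_mat \<alpha> \<beta>"
      unfolding A(1)[OF that] lift_left_diff lift_if B_def unit_mat_def ..
    finally have "mat_prod S (\<lambda>\<alpha> \<beta>. \<Sum>i\<in>UNIV. const_poly (M i \<alpha> \<beta>) * letter (Inl i)) B \<alpha> \<beta> = B \<alpha> \<beta> - unit_mat \<alpha> \<beta>"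
      by (simp add: mat_prod_def)
    moreover have "C = unit_mat - (\<lambda>\<alpha> \<beta>. \<Sum>i\<in>UNIV. const_poly (M i \<alpha> \<beta>) * letter (Inl i))"
      by (simp add: C_def fun_eq_iff)
    ultimately show ?thesis using that by (simp add: mat_prod_distrib mat_prod_unit fS)
  qed
  have BC: "mat_prod S B C \<alpha> \<beta> = unit_mat \<alpha> \<beta>" if "\<alpha> \<in> S" "\<beta> \<in> S" for \<alpha> \<beta>
  proof -
    have "(\<Sum>\<gamma>\<in>S. B \<alpha> \<gamma> * (\<Sum>i\<in>UNIV. const_poly (M i \<gamma> \<beta>) * letter (Inl i))) =
        lift_left (\<Sum>i\<in>UNIV. \<Sum>\<gamma>\<in>S. A \<alpha> \<gamma> * (const_poly (M i \<gamma> \<beta>) * zl i))"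
      by (subst sum.swap) (simp add: lift_left_sum lift_left_mult lift_const lift_zl B_def sum_distrib_left)
    also have "\<dots> = B \<alpha> \<beta> - unit_mat \<alpha> \<beta>"
      unfolding A(2)[OF that] lift_left_diff lift_if B_def unit_mat_def ..
    finally have "mat_prod S B (\<lambda>\<alpha> \<beta>. \<Sum>i\<in>UNIV. const_poly (M i \<alpha> \<beta>) * letter (Inl i)) \<alpha> \<beta> = B \<alpha> \<beta> - unit_mat \<alpha> \<beta>"
      by (simp add: mat_prod_def)
    moreover have "C = unit_mat - (\<lambda>\<alpha> \<beta>. \<Sum>i\<in>UNIV. const_poly (M i \<alpha> \<beta>) * letter (Inl i))"
      by (simp add: C_def fun_eq_iff)
    ultimately show ?thesis using that by (simp add: mat_prod_distrib mat_prod_unit fS)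
  qed
  have PE: "mat_prod S (mat_prod S B Q) E0 \<alpha> \<beta> = E0 \<alpha> \<beta> - unit_mat \<alpha> \<beta>" if "\<alpha> \<in> S" "\<beta> \<in> S" for \<alpha> \<beta>
    using E0(1)[OF that] unfolding mat_prod_def[of S "mat_prod S B Q"] BQ
    by (subst (asm) sum.swap) (simp add: sum_distrib_right unit_mat_def)
  have EP: "mat_prod S E0 (mat_prod S B Q) \<alpha> \<beta> = E0 \<alpha> \<beta> - unit_mat \<alpha> \<beta>" if "\<alpha> \<in> S" "\<beta> \<in> S" for \<alpha> \<beta>
    using E0(2)[OF that] unfolding mat_prod_def[of S E0] BQ
    by (subst (asm) sum.swap) (simp add: sum_distrib_left unit_mat_def)
  define E where "E = mat_prod S E0 B"
  have inverse: "mat_prod S (C - Q) E \<alpha> \<beta> = unit_mat \<alpha> \<beta>" "mat_prod S E (C - Q) \<alpha> \<beta> = unit_mat \<alpha> \<beta>"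
    if "\<alpha> \<in> S" "\<beta> \<in> S" for \<alpha> \<beta>
    unfolding E_def by (rule perturbed_inverse[where N = Q and C = C]; simp add: fS CB BC PE EP that)+

  interpret linearization J m "\<lambda>c v. const_poly c * v" "\<lambda>l v. letter l * v"
    by unfold_locales (auto simp: J_const single_uminus intro: J_deg)
  have CQ: "mat_prod S (C - Q) X \<alpha> \<beta> = X \<alpha> \<beta> -
      (\<Sum>l\<in>UNIV. \<Sum>\<tau>\<in>S. const_poly (pencil J l \<alpha> \<tau>) * (letter l * X \<tau> \<beta>))" if "\<alpha> \<in> S" for X \<alpha> \<beta>
  proof -
    have "C - Q = unit_mat - (\<lambda>\<alpha> \<beta>. \<Sum>l\<in>UNIV. const_poly (pencil J l \<alpha> \<beta>) * letter l)"
      by (simp add: fun_eq_iff C_def Q_def sum_letters M_def V_def)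
    then have "mat_prod S (C - Q) X \<alpha> \<beta> =
        X \<alpha> \<beta> - (\<Sum>\<tau>\<in>S. (\<Sum>l\<in>UNIV. const_poly (pencil J l \<alpha> \<tau>) * letter l) * X \<tau> \<beta>)"
      using that by (simp add: mat_prod_distrib mat_prod_unit fS) (simp add: mat_prod_def)
    also have "\<dots> = X \<alpha> \<beta> - (\<Sum>l\<in>UNIV. \<Sum>\<tau>\<in>S. const_poly (pencil J l \<alpha> \<tau>) * (letter l * X \<tau> \<beta>))"
      by (subst sum.swap) (simp add: sum_distrib_right mult.assoc)
    finally show ?thesis .
  qed
  have J_act: "(\<Sum>z\<in>Poly_Mapping.keys f. const_poly (Poly_Mapping.lookup f z) *
      foldr (\<lambda>l v. letter l * v) (pair_word z) v) = f * v" for f v :: "'g bipartite_poly"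
  proof -
    have "(\<Sum>z\<in>Poly_Mapping.keys f. const_poly (Poly_Mapping.lookup f z) *
        foldr (\<lambda>l v. letter l * v) (pair_word z) v) =
        (\<Sum>z\<in>Poly_Mapping.keys f. Poly_Mapping.single z (Poly_Mapping.lookup f z)) * v"
      by (simp add: foldr_letter_pair_word sum_distrib_right mult.assoc[symmetric] mult_single)
    then show ?thesis by (simp add: monomial_expansion)
  qed
  define K where "K i k = E ([], i) ([], k)" for i k
  have JK: "(\<Sum>i\<in>UNIV. J j i * K i k) = unit_mat j k" for j k
  proof -
    have "(\<Sum>i\<in>UNIV. \<Sum>z\<in>Poly_Mapping.keys (J j i). const_poly (Poly_Mapping.lookup (J j i) z) *
       foldr (\<lambda>l v. letter l * v) (pair_word z) (E ([], i) ([], k))) = unit_mat j k"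
    proof (rule pencil_solution(2)[where x = "\<lambda>\<tau>. E \<tau> ([], k)" and e = "\<lambda>j. unit_mat j k"])
      fix s :: "('g + 'g) list" and j assume "length s < m"
      then have "(s, j) \<in> S" "([], k) \<in> S" using \<open>m > 0\<close> by (auto simp: S_def states_def)
      with inverse(1)[OF this] show "E (s, j) ([], k) = (if s = [] then unit_mat j k else 0) +
          (\<Sum>l\<in>UNIV. \<Sum>\<tau>\<in>states m. const_poly (pencil J l (s, j) \<tau>) * (letter l * E \<tau> ([], k)))"
        by (simp add: CQ S_def[symmetric] algebra_simps) (simp add: unit_mat_def)
    qed (rule \<open>m > 0\<close>)
    then show ?thesis unfolding J_act K_def .
  qed
  have KJ: "(\<Sum>i\<in>UNIV. K j i * J i k) = unit_mat j k" for j k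
  proof -
    \<comment> \<open>\<open>J F = (J K) J - J = 0\<close>, so the column \<open>F\<close> extends to a solution of the homogeneous pencil.\<close>
    define F where "F i = (\<Sum>l\<in>UNIV. K i l * J l k) - unit_mat i k" for i
    have "(\<Sum>i\<in>UNIV. J j i * F i) = 0" for j
    proof -
      have "(\<Sum>i\<in>UNIV. J j i * F i) =
          (\<Sum>i\<in>UNIV. \<Sum>l\<in>UNIV. J j i * K i l * J l k) - (\<Sum>i\<in>UNIV. J j i * unit_mat i k)"
        by (simp add: F_def right_diff_distrib sum_subtractf sum_distrib_left mult.assoc)
      also have "(\<Sum>i\<in>UNIV. \<Sum>l\<in>UNIV. J j i * K i l * J l k) = (\<Sum>l\<in>UNIV. (\<Sum>i\<in>UNIV. J j i * K i l) * J l k)"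
        by (subst sum.swap) (simp add: sum_distrib_right)
      also have "\<dots> - (\<Sum>i\<in>UNIV. J j i * unit_mat i k) = 0"
        unfolding JK by (simp add: unit_mat_def if_distrib[of "\<lambda>t. t * _"] if_distrib[of "\<lambda>t. _ * t"] cong: if_cong)
      finally show ?thesis .
    qed
    then have JF: "(\<Sum>i\<in>UNIV. \<Sum>z\<in>Poly_Mapping.keys (J j i). const_poly (Poly_Mapping.lookup (J j i) z) *
       foldr (\<lambda>l v. letter l * v) (pair_word z) (F i)) = 0" for j
      unfolding J_act .
    define X where "X \<tau> (\<beta> :: ('g + 'g) list \<times> 'g) = foldr (\<lambda>l v. letter l * v) (fst \<tau>) (F (snd \<tau>))" for \<tau> \<beta>
    have "mat_prod S (C - Q) X \<tau> \<beta> = 0" if "\<tau> \<in> S" for \<tau> \<beta>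
    proof -
      obtain s j where \<tau>: "\<tau> = (s, j)" "length s < m" using \<open>\<tau> \<in> S\<close> by (auto simp: S_def states_def)
      show ?thesis
        using pencil_solution_words[OF JF \<tau>(2), of j] unfolding CQ[OF that]
        by (simp add: X_def \<tau>(1) S_def case_prod_beta)
    qed
    moreover have "([], j) \<in> S" using \<open>m > 0\<close> by (simp add: S_def states_def)
    ultimately have "mat_prod S unit_mat X ([], j) ([], j) = 0"
      using mat_prod_cong[of S "mat_prod S E (C - Q)" unit_mat X X "([], j)" "([], j)"] inverse(2)
      unfolding mat_prod_assoc by (simp add: mat_prod_def[of S E])
    then have "F j = 0" using \<open>([], j) \<in> S\<close> by (simp add: mat_prod_unit fS X_def)
    then show ?thesis by (simp add: F_def)
  qed
  from that[OF JK KJ] show ?thesis .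
qed

section \<open>Injectivity in terms of the hypo-Jacobian matrix\<close>

lemma lookup_const_poly_mult:
  fixes f :: "'k::monoid_add \<Rightarrow>\<^sub>0 complex"
  shows "Poly_Mapping.lookup (const_poly c * f) x = c * Poly_Mapping.lookup f x"
  by (induction f rule: poly_mapping_add_induct)
     (simp_all add: distrib_left lookup_add mult_single lookup_single when_def)

lemma lookup_letter_mult:
  fixes f :: "'a free_poly"
  shows "Poly_Mapping.lookup (Poly_Mapping.single [c] 1 * f) u =
    (case u of [] \<Rightarrow> 0 | d # v \<Rightarrow> if d = c then Poly_Mapping.lookup f v else 0)"
  by (induction f rule: poly_mapping_add_induct)
     (auto simp: distrib_left lookup_add mult_single lookup_single when_def plus_list_def split: list.splits)

lemma lookup_word_deriv:
  "Poly_Mapping.lookup (word_deriv w0) (map Inr u @ Inl j # map Inr v) = (if w0 = u @ j # v then 1 else 0)"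
proof (induction w0 arbitrary: u)
  case (Cons i w0)
  have "Poly_Mapping.single [Inl i] 1 * Poly_Mapping.single (map Inr w0) 1 =
      (Poly_Mapping.single (Inl i # map Inr w0) 1 :: ('a + 'a) free_poly)"
    by (simp add: mult_single plus_list_def)
  with Cons show ?case
    by (cases u) (auto simp: lookup_add lookup_letter_mult lookup_single when_def inj_map_eq_map)
qed simp

text \<open>The word \<open>u x\<^sub>j v\<close> of the derivative arises from the single word \<open>u @ j # v\<close>, at the letter that is
marked; so a coefficient of the hypo-Jacobian is a coefficient of \<open>p\<close>.\<close>

lemma lookup_hypo_Jacobian_word:
  "Poly_Mapping.lookup (hypo_Jacobian p $ j $ i) (w, v) = Poly_Mapping.lookup (p i) (rev w @ j # v)"
proof -
  have "free_deriv 0 = (0 :: ('a + 'a) free_poly)" by (simp add: free_deriv_def)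
  then have "Poly_Mapping.lookup (free_deriv f) (hypo_word j (w, v)) = Poly_Mapping.lookup f (rev w @ j # v)" for f
    by (induction f rule: poly_mapping_add_induct)
       (auto simp: free_deriv_add free_deriv_single lookup_add lookup_const_poly_mult lookup_single when_def
         hypo_word_def lookup_word_deriv)
  then show ?thesis by (simp add: lookup_hypo_Jacobian)
qed

lemma word_entry_cong:
  assumes "\<And>l x y. x \<in> D \<Longrightarrow> y \<in> D \<Longrightarrow> T l x y = T' l x y" "x \<in> D" "y \<in> D"
  shows "word_entry D T u x y = word_entry D T' u x y"
  using assms(2) by (induction u arbitrary: x) (simp_all add: assms)

lemma word_entry_rev:
  fixes T :: "'l \<Rightarrow> 'd \<Rightarrow> 'd \<Rightarrow> 'r::comm_semiring_1"
  assumes "finite D" "x \<in> D" "y \<in> D"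
  shows "word_entry D T (rev u) x y = word_entry D (\<lambda>l x y. T l y x) u y x"
  using assms(3) by (induction u arbitrary: y) (auto simp: word_entry_snoc[OF assms(1,2)] mult.commute)

lemma word_eval_word_entry:
  assumes "X \<in> mat_tuples n" "a < n" "b < n"
  shows "word_eval n X w $$ (a, b) = word_entry {..<n} (\<lambda>i a b. X i $$ (a, b)) w a b"
  using assms(2)
proof (induction w arbitrary: a)
  case (Cons i w)
  have "X i \<in> carrier_mat n n" using assms(1) by (simp add: mat_tuples_def)
  then show ?case
    using Cons assms(3) by (simp add: mat_mult_index[OF _ word_eval_carrier[OF assms(1)]])
qed (use assms(3) in simp)

lemma poly_eval_matrix_eval:
  assumes "X \<in> mat_tuples n" "a < n" "b < n"
  shows "poly_eval n X f $$ (a, b) = matrix_eval n (\<lambda>i a b. X i $$ (a, b)) f a b"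
  using assms by (simp add: poly_eval_def rep_eval_def word_eval_word_entry)

text \<open>Injectivity for tuples that are given by their entries, the form used in all evaluations here.\<close>

lemma free_injective_iff:
  "free_injective p \<longleftrightarrow> (\<forall>n\<ge>1. \<forall>A A'.
     (\<forall>i. \<forall>a<n. \<forall>b<n. matrix_eval n A (p i) a b = matrix_eval n A' (p i) a b) \<longrightarrow>
     (\<forall>i. \<forall>a<n. \<forall>b<n. A i a b = A' i a b))"
  (is "_ \<longleftrightarrow> ?R")
proof
  assume inj: "free_injective p"
  show ?R
  proof (intro allI impI)
    fix n A A' i a b
    assume n: "1 \<le> n" and eq: "\<forall>i. \<forall>a<n. \<forall>b<n. matrix_eval n A (p i) a b = matrix_eval n A' (p i) a b" and ab: "a < n" "b < n"
    let ?X = "\<lambda>A i. mat n n (\<lambda>(a, b). A i a b)"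
    have X: "?X A \<in> mat_tuples n" for A by (simp add: mat_tuples_def)
    have dims: "dim_row (poly_eval n X f) = n" "dim_col (poly_eval n X f) = n" for X and f :: "'a free_poly"
      by (simp_all add: poly_eval_def)
    have ev: "poly_eval n (?X A) f $$ (a, b) = matrix_eval n A f a b" if "a < n" "b < n" for A f a b
      unfolding poly_eval_matrix_eval[OF X that] rep_eval_def
      using that by (intro sum.cong refl arg_cong2[of _ _ _ _ times] word_entry_cong) auto
    have pm: "poly_map_eval n p (?X A) = poly_map_eval n p (?X A')"
      unfolding poly_map_eval_def by (intro ext eq_matI) (use eq in \<open>simp_all add: dims ev\<close>)
    have "inj_on (poly_map_eval n p) (mat_tuples n)" using inj n by (simp add: free_injective_def)
    then have "?X A = ?X A'" by (rule inj_onD[OF _ pm X X])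
    then have "?X A i $$ (a, b) = ?X A' i $$ (a, b)" by metis
    then show "A i a b = A' i a b" using ab by simp
  qed
next
  assume R: ?R
  show "free_injective p"
    unfolding free_injective_def
  proof (intro allI impI inj_onI)
    fix n X X'
    assume n: "1 \<le> n" and X: "X \<in> mat_tuples n" "X' \<in> mat_tuples n"
      and eq: "poly_map_eval n p X = poly_map_eval n p X'"
    have "\<forall>i. \<forall>a<n. \<forall>b<n. matrix_eval n (\<lambda>i a b. X i $$ (a, b)) (p i) a b = matrix_eval n (\<lambda>i a b. X' i $$ (a, b)) (p i) a b"
      using eq X unfolding poly_map_eval_def by (metis poly_eval_matrix_eval)
    then have "X i $$ (a, b) = X' i $$ (a, b)" if "a < n" "b < n" for i a b
      using R[rule_format, OF n, of "\<lambda>i a b. X i $$ (a, b)" "\<lambda>i a b. X' i $$ (a, b)" a b i] that by blast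
    moreover have "X i \<in> carrier_mat n n" "X' i \<in> carrier_mat n n" for i
      using X by (simp_all add: mat_tuples_def)
    ultimately show "X = X'" by (intro ext eq_matI) (metis carrier_matD)+
  qed
qed

text \<open>The upper right block of the word at the block triangular tuple with diagonal \<open>Z\<close>, \<open>Y\<close> and corner \<open>h\<close>:
the derivative of the word in direction \<open>h\<close>, with separate base points to the left and to the right of
the marked letter.\<close>

primrec corner :: "nat \<Rightarrow> nat \<Rightarrow> ('g \<Rightarrow> nat \<Rightarrow> nat \<Rightarrow> complex) \<Rightarrow> ('g \<Rightarrow> nat \<Rightarrow> nat \<Rightarrow> complex) \<Rightarrow>
    ('g \<Rightarrow> nat \<Rightarrow> nat \<Rightarrow> complex) \<Rightarrow> 'g list \<Rightarrow> nat \<Rightarrow> nat \<Rightarrow> complex" where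
  "corner n r Z h Y [] a b = 0"
| "corner n r Z h Y (i # w) a b =
     (\<Sum>c<n. Z i a c * corner n r Z h Y w c b) + (\<Sum>c<r. h i a c * word_entry {..<r} Y w c b)"

lemma corner_Leibniz:
  assumes "a < n"
  shows "corner n r Z h Y w a b = (\<Sum>k<length w. \<Sum>x\<in>grid n r.
    word_entry {..<n} Z (take k w) a (fst x) * h (w ! k) (fst x) (snd x) * word_entry {..<r} Y (drop (Suc k) w) (snd x) b)"
  using assms
proof (induction w arbitrary: a)
  case (Cons i w)
  let ?t = "\<lambda>k c x. word_entry {..<n} Z (take k w) c (fst x) * h (w ! k) (fst x) (snd x) *
      word_entry {..<r} Y (drop (Suc k) w) (snd x) b"
  have 0: "(\<Sum>x\<in>grid n r. word_entry {..<n} Z [] a (fst x) * h i (fst x) (snd x) * word_entry {..<r} Y w (snd x) b) =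
      (\<Sum>c<r. h i a c * word_entry {..<r} Y w c b)"
  proof -
    have "(\<Sum>x\<in>grid n r. word_entry {..<n} Z [] a (fst x) * h i (fst x) (snd x) * word_entry {..<r} Y w (snd x) b) =
        (\<Sum>d<n. if d = a then \<Sum>c<r. h i a c * word_entry {..<r} Y w c b else 0)"
      unfolding sum.cartesian_product' fst_conv snd_conv by (intro sum.cong refl) auto
    then show ?thesis using Cons.prems by simp
  qed
  have "(\<Sum>c<n. Z i a c * corner n r Z h Y w c b) =
      (\<Sum>c<n. \<Sum>k<length w. \<Sum>x\<in>grid n r. Z i a c * ?t k c x)"
    using Cons.IH by (simp add: sum_distrib_left)
  also have "\<dots> = (\<Sum>k<length w. \<Sum>c<n. \<Sum>x\<in>grid n r. Z i a c * ?t k c x)"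
    by (rule sum.swap)
  also have "\<dots> = (\<Sum>k<length w. \<Sum>x\<in>grid n r. \<Sum>c<n. Z i a c * ?t k c x)"
    by (rule sum.cong[OF refl], rule sum.swap)
  finally show ?case
    unfolding corner.simps length_Cons sum.lessThan_Suc_shift take_0 nth_Cons_0 drop_Suc_Cons drop_0 0
    by (simp add: sum_distrib_right mult.assoc)
qed simp

text \<open>Marking a letter of a word of \<open>p i\<close> amounts to choosing a letter \<open>j\<close> and a monomial of the entry
\<open>(j, i)\<close>. The prefix is reversed there, which the transposition of \<open>Z\<close> undoes.\<close>

lemma corner_hypo_Jacobian:
  fixes p :: "'g::finite \<Rightarrow> 'g free_poly"
  assumes ab: "a < n" "b < r"
  shows "(\<Sum>w\<in>Poly_Mapping.keys (p i). Poly_Mapping.lookup (p i) w * corner n r Z h Y w a b) =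
    (\<Sum>j\<in>UNIV. \<Sum>x\<in>grid n r. h j (fst x) (snd x) *
       grid_eval n r (\<lambda>i x y. Z i y x) Y (hypo_Jacobian p $ j $ i) x (a, b))"
proof -
  let ?J = "\<lambda>j. hypo_Jacobian p $ j $ i"
  let ?m = "\<lambda>u j v. \<Sum>x\<in>grid n r. word_entry {..<n} Z u a (fst x) * h j (fst x) (snd x) * word_entry {..<r} Y v (snd x) b"
  have "(\<Sum>w\<in>Poly_Mapping.keys (p i). Poly_Mapping.lookup (p i) w * corner n r Z h Y w a b) =
      (\<Sum>(w, k)\<in>(SIGMA w:Poly_Mapping.keys (p i). {..<length w}).
         Poly_Mapping.lookup (p i) w * ?m (take k w) (w ! k) (drop (Suc k) w))"
    by (subst sum.Sigma[symmetric]) (auto simp: corner_Leibniz[OF ab(1)] sum_distrib_left)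
  also have "\<dots> = (\<Sum>(j, z)\<in>(SIGMA j:UNIV. Poly_Mapping.keys (?J j)).
         Poly_Mapping.lookup (?J j) z * ?m (rev (fst z)) j (snd z))"
  proof (rule sum.reindex_bij_witness[of _ "\<lambda>(j, w, v). (rev w @ j # v, length w)"
        "\<lambda>(w, k). (w ! k, rev (take k w), drop (Suc k) w)"])
  qed (auto simp: in_keys_iff lookup_hypo_Jacobian_word id_take_nth_drop[symmetric] min_def nth_append)
  also have "\<dots> = (\<Sum>j\<in>UNIV. \<Sum>z\<in>Poly_Mapping.keys (?J j). Poly_Mapping.lookup (?J j) z * ?m (rev (fst z)) j (snd z))"
    by (subst sum.Sigma) auto
  also have "\<dots> = (\<Sum>j\<in>UNIV. \<Sum>z\<in>Poly_Mapping.keys (?J j). \<Sum>x\<in>grid n r. h j (fst x) (snd x) *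
       (Poly_Mapping.lookup (?J j) z * grid_rep n r (\<lambda>i x y. Z i y x) Y z x (a, b)))"
    unfolding sum_distrib_left
    by (intro sum.cong refl) (use ab in \<open>auto simp: grid_rep_def word_entry_rev mult_ac\<close>)
  also have "\<dots> = (\<Sum>j\<in>UNIV. \<Sum>x\<in>grid n r. h j (fst x) (snd x) *
       grid_eval n r (\<lambda>i x y. Z i y x) Y (?J j) x (a, b))"
    unfolding rep_eval_def sum_distrib_left by (rule sum.cong[OF refl], rule sum.swap)
  finally show ?thesis .
qed

definition upper_block :: "nat \<Rightarrow> (nat \<Rightarrow> nat \<Rightarrow> complex) \<Rightarrow> (nat \<Rightarrow> nat \<Rightarrow> complex) \<Rightarrow> (nat \<Rightarrow> nat \<Rightarrow> complex) \<Rightarrow>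
    nat \<Rightarrow> nat \<Rightarrow> complex" where
  "upper_block n A B C a b =
    (if a < n then if b < n then A a b else B a (b - n) else if b < n then 0 else C (a - n) (b - n))"

lemma sum_split_at: "(\<Sum>c<n + r. f c) = (\<Sum>c<n. f c) + (\<Sum>c<r. f (n + c))" for f :: "nat \<Rightarrow> 'a::comm_monoid_add"
  by (induction r) (simp_all add: add.assoc)

lemma word_entry_upper_block:
  assumes "a < n + r" "b < n + r"
  shows "word_entry {..<n + r} (\<lambda>i. upper_block n (Z i) (h i) (Y i)) w a b =
    upper_block n (word_entry {..<n} Z w) (corner n r Z h Y w) (word_entry {..<r} Y w) a b"
  using assms(1)
proof (induction w arbitrary: a)
  case Nil
  then show ?case using assms(2) by (auto simp: upper_block_def)
next
  case (Cons i w)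
  then show ?case
    using assms(2) by (simp add: sum_split_at upper_block_def)
qed

text \<open>If the corner vanishes, the block triangular tuple and its block diagonal part have the same image
under \<open>p\<close>. The two diagonal blocks may have different sizes.\<close>

lemma row_nonsingular_if_injective:
  fixes p :: "'g::finite \<Rightarrow> 'g free_poly"
  assumes inj: "free_injective p"
    and z: "\<And>i y. y \<in> grid n r \<Longrightarrow>
      (\<Sum>j\<in>UNIV. \<Sum>x\<in>grid n r. h j x * grid_eval n r Z Y (hypo_Jacobian p $ j $ i) x y) = 0"
    and x: "x \<in> grid n r"
  shows "h j x = 0"
proof -
  let ?Z = "\<lambda>i x y. Z i y x" and ?h = "\<lambda>j a b. h j (a, b)"
  let ?X = "\<lambda>h i. upper_block n (?Z i) (h i) (Y i)"
  have c: "(\<Sum>w\<in>Poly_Mapping.keys (p i). Poly_Mapping.lookup (p i) w * corner n r ?Z ?h Y w a b) = 0"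
    if "a < n" "b < r" for i a b
    unfolding corner_hypo_Jacobian[OF that] using z[of "(a, b)"] that by simp
  have c0: "corner n r ?Z (\<lambda>_ _ _. 0) Y w a b = 0" for w a b
    by (induction w arbitrary: a) simp_all
  have "matrix_eval (n + r) (?X ?h) (p i) a b = matrix_eval (n + r) (?X (\<lambda>_ _ _. 0)) (p i) a b"
    if "a < n + r" "b < n + r" for i a b
  proof (cases "a < n \<and> b \<ge> n")
    case True
    then have "a < n" "b - n < r" using that by auto
    with True show ?thesis
      using that c[of a "b - n" i] by (simp add: rep_eval_def word_entry_upper_block upper_block_def c0)
  next
    case False
    then show ?thesis
      unfolding rep_eval_def
      by (intro sum.cong refl) (use that in \<open>auto simp: word_entry_upper_block upper_block_def\<close>)
  qed
  moreover have "n + r \<ge> 1" using x by (cases x) auto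
  ultimately have eq: "?X ?h j a b = ?X (\<lambda>_ _ _. 0) j a b" if "a < n + r" "b < n + r" for a b
    using inj that unfolding free_injective_iff by blast
  obtain a b where "x = (a, b)" "a < n" "b < r" using x by (cases x) auto
  then show ?thesis using eq[of a "n + b"] by (simp add: upper_block_def)
qed

lemma grid_eval_mult:
  assumes "x \<in> grid n r"
  shows "grid_eval n r Z Y (f * g) x y = (\<Sum>z\<in>grid n r. grid_eval n r Z Y f x z * grid_eval n r Z Y g z y)"
proof (rule rep_eval_mult)
  fix k l :: "'a list \<times> 'a list"
  have "grid_rep n r Z Y (k + l) x y = (\<Sum>c<n. \<Sum>d<r. grid_rep n r Z Y k x (c, d) * grid_rep n r Z Y l (c, d) y)"
    using assms by (auto simp: grid_rep_def plus_list_def word_entry_append sum_product mult_ac)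
  then show "grid_rep n r Z Y (k + l) x y = (\<Sum>z\<in>grid n r. grid_rep n r Z Y k x z * grid_rep n r Z Y l z y)"
    by (simp add: sum.cartesian_product')
qed

text \<open>For the direction \<open>h = A - A'\<close> the corner telescopes to the difference of the values at \<open>A\<close> and \<open>A'\<close>.
If these agree, \<open>h\<close> is a row vector in the kernel of the hypo-Jacobian, and evaluating the right
inverse gives \<open>h = 0\<close>.\<close>

lemma injective_if_right_inverse:
  fixes p :: "'g::finite \<Rightarrow> 'g free_poly"
  assumes JK: "\<And>j k. (\<Sum>i\<in>UNIV. hypo_Jacobian p $ j $ i * K i k) = (if j = k then 1 else 0)"
  shows "free_injective p"
  unfolding free_injective_iff
proof (intro allI impI)
  fix n and A A' :: "'g \<Rightarrow> nat \<Rightarrow> nat \<Rightarrow> complex" and k :: 'g and a0 b0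
  assume eq: "\<forall>i. \<forall>a<n. \<forall>b<n. matrix_eval n A (p i) a b = matrix_eval n A' (p i) a b" and ab0: "a0 < n" "b0 < n"
  define h where "h i a b = A i a b - A' i a b" for i a b
  let ?grid_eval = "grid_eval n n (\<lambda>i x y. A i y x) A'" and ?G = "grid n n"
  have corner: "corner n n A h A' w a b = word_entry {..<n} A w a b - word_entry {..<n} A' w a b" if "a < n" "b < n" for w a b
    using that(1)
    by (induction w arbitrary: a)
       (simp_all add: h_def left_diff_distrib right_diff_distrib sum_subtractf)
  have zero: "(\<Sum>j\<in>UNIV. \<Sum>x\<in>?G. h j (fst x) (snd x) * ?grid_eval (hypo_Jacobian p $ j $ i) x y) = 0"
    if y_grid: "y \<in> ?G" for i y
  proof -
    obtain a b where y: "y = (a, b)" "a < n" "b < n" using y_grid by (cases y) auto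
    have "(\<Sum>w\<in>Poly_Mapping.keys (p i). Poly_Mapping.lookup (p i) w * corner n n A h A' w a b) = 0"
      using eq y by (simp add: corner right_diff_distrib sum_subtractf rep_eval_def)
    then show ?thesis unfolding corner_hypo_Jacobian[OF y(2,3)] y(1) .
  qed
  have one: "?grid_eval (if j = k then 1 else 0) x (a0, b0) = (if (j, x) = (k, (a0, b0)) then 1 else 0)" for j x
    by (cases x) (simp add: single_one[symmetric] rep_eval_single grid_rep_def zero_prod_def zero_list_def del: single_one)
  have "h k a0 b0 = (\<Sum>q\<in>UNIV \<times> ?G. if q = (k, (a0, b0)) then h k a0 b0 else 0)"
    using ab0 by simp
  also have "\<dots> = (\<Sum>(j, x)\<in>UNIV \<times> ?G. h j (fst x) (snd x) * ?grid_eval (\<Sum>i\<in>UNIV. hypo_Jacobian p $ j $ i * K i k) x (a0, b0))"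
    unfolding JK one by (intro sum.cong refl) (auto split: if_splits)
  also have "\<dots> = (\<Sum>j\<in>UNIV. \<Sum>x\<in>?G. \<Sum>i\<in>UNIV. \<Sum>y\<in>?G.
      h j (fst x) (snd x) * ?grid_eval (hypo_Jacobian p $ j $ i) x y * ?grid_eval (K i k) y (a0, b0))"
    unfolding sum.cartesian_product[symmetric]
    by (simp add: rep_eval_sum grid_eval_mult sum_distrib_left mult.assoc)
  also have "\<dots> = (\<Sum>(j, x, i, y)\<in>UNIV \<times> ?G \<times> UNIV \<times> ?G.
      h j (fst x) (snd x) * ?grid_eval (hypo_Jacobian p $ j $ i) x y * ?grid_eval (K i k) y (a0, b0))"
    by (simp add: sum.cartesian_product)
  also have "\<dots> = (\<Sum>(i, y, j, x)\<in>UNIV \<times> ?G \<times> UNIV \<times> ?G.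
      h j (fst x) (snd x) * ?grid_eval (hypo_Jacobian p $ j $ i) x y * ?grid_eval (K i k) y (a0, b0))"
    by (rule sum.reindex_bij_witness[of _ "\<lambda>(i, y, j, x). (j, x, i, y)" "\<lambda>(j, x, i, y). (i, y, j, x)"]) auto
  also have "\<dots> = (\<Sum>i\<in>UNIV. \<Sum>y\<in>?G. (\<Sum>j\<in>UNIV. \<Sum>x\<in>?G.
      h j (fst x) (snd x) * ?grid_eval (hypo_Jacobian p $ j $ i) x y) * ?grid_eval (K i k) y (a0, b0))"
    by (simp add: sum.cartesian_product[symmetric] sum_distrib_right)
  also have "\<dots> = 0" by (simp add: zero)
  finally show "A k a0 b0 = A' k a0 b0" by (simp add: h_def)
qed

section \<open>The theorem\<close>

lemma column_nonsingular_if_injective: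
  fixes p :: "'g::finite \<Rightarrow> 'g free_poly"
  assumes "free_injective p"
  shows "column_nonsingular (\<lambda>j i. hypo_Jacobian p $ j $ i)"
  unfolding column_nonsingular_def
proof (intro allI, rule impI)
  fix n r Z Y and h :: "'g \<Rightarrow> nat \<times> nat \<Rightarrow> complex"
  let ?J = "hypo_Jacobian p" and ?D = "(UNIV :: 'g set) \<times> grid n r"
  assume h: "\<forall>j. \<forall>x\<in>grid n r. (\<Sum>i\<in>UNIV. \<Sum>y\<in>grid n r. grid_eval n r Z Y (?J $ j $ i) x y * h i y) = 0"
  have "\<forall>q\<in>?D. (\<lambda>(i, y). h i y) q = 0"
  proof (rule row_kernel_imp_column_kernel[where A = "\<lambda>(j, x) (i, y). grid_eval n r Z Y (?J $ j $ i) x y"])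
    fix q assume "q \<in> ?D"
    then show "(\<Sum>q'\<in>?D. (case q of (j, x) \<Rightarrow> \<lambda>(i, y). grid_eval n r Z Y (?J $ j $ i) x y) q' * (\<lambda>(i, y). h i y) q') = 0"
      using h by (cases q) (simp add: sum.cartesian_product')
  next
    fix k :: "'g \<times> nat \<times> nat \<Rightarrow> complex"
    assume k: "\<And>q. q \<in> ?D \<Longrightarrow>
        (\<Sum>q'\<in>?D. k q' * (case q' of (j, x) \<Rightarrow> \<lambda>(i, y). grid_eval n r Z Y (?J $ j $ i) x y) q) = 0"
    have "k (j, x) = 0" if "x \<in> grid n r" for j x
    proof (rule row_nonsingular_if_injective[OF assms _ that, where h = "\<lambda>j x. k (j, x)" and Z = Z and Y = Y])
      fix i y assume "y \<in> grid n r"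
      then show "(\<Sum>j\<in>UNIV. \<Sum>x\<in>grid n r. k (j, x) * grid_eval n r Z Y (?J $ j $ i) x y) = 0"
        using k[of "(i, y)"] by (simp add: sum.cartesian_product')
    qed
    then show "\<forall>q\<in>?D. k q = 0" by auto
  qed simp
  then show "\<forall>i. \<forall>y\<in>grid n r. h i y = 0" by auto
qed

definition const_mat :: "complex ^ 'g ^ 'g \<Rightarrow> 'g bipartite_poly ^ 'g ^ 'g" where
  "const_mat A = (\<chi> j i. const_poly (A $ j $ i))"

lemma const_poly_sum: "const_poly (\<Sum>i\<in>I. f i) = (\<Sum>i\<in>I. const_poly (f i))"
  by (induction I rule: infinite_finite_induct) (simp_all add: single_add)

lemma const_mat_mult:
  "const_mat (A ** B) = const_mat A ** const_mat (B :: complex ^ 'g ^ 'g::finite)"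
  by (simp add: const_mat_def matrix_matrix_mult_def const_poly_sum mult_single Finite_Cartesian_Product.vec_eq_iff)

lemma const_mat_one: "const_mat (Finite_Cartesian_Product.mat 1) = Finite_Cartesian_Product.mat 1"
  by (simp add: const_mat_def Finite_Cartesian_Product.mat_def Finite_Cartesian_Product.vec_eq_iff)

text \<open>The constant term is the value at the \<open>1 \<times> 1\<close> zero tuples.\<close>

lemma constant_term_invertible:
  fixes J :: "'g::finite bipartite_poly ^ 'g ^ 'g"
  assumes "column_nonsingular (\<lambda>j i. J $ j $ i)"
  shows "\<exists>B. B ** (\<chi> j i. Poly_Mapping.lookup (J $ j $ i) ([], [])) = Finite_Cartesian_Product.mat 1"
  unfolding matrix_left_invertible_ker
proof (intro allI impI)
  let ?C = "\<chi> j i. Poly_Mapping.lookup (J $ j $ i) ([], [])"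
  fix v :: "complex ^ 'g" assume v: "?C *v v = 0"
  let ?O = "\<lambda>_ _ _. 0 :: complex"
  have z: "word_entry {..<1} ?O w 0 0 = (if w = [] then 1 else 0)" for w :: "'g list"
    by (cases w) auto
  have ev: "grid_eval 1 1 ?O ?O f (0, 0) (0, 0) = Poly_Mapping.lookup f ([], [])" for f :: "'g bipartite_poly"
  proof -
    have "grid_eval 1 1 ?O ?O f (0, 0) (0, 0) =
        (\<Sum>k\<in>Poly_Mapping.keys f. if k = ([], []) then Poly_Mapping.lookup f k else 0)"
      unfolding rep_eval_def grid_rep_def by (intro sum.cong refl) (auto simp: z prod_eq_iff simp del: One_nat_def)
    then show ?thesis by (simp add: in_keys_iff)
  qed
  have grid: "grid 1 1 = {(0, 0)}" by auto
  have "\<forall>i. \<forall>y\<in>grid 1 1. (\<lambda>i _. v $ i) i y = 0"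
  proof (rule assms[unfolded column_nonsingular_def, THEN spec[of _ 1], THEN spec[of _ 1], THEN spec[of _ ?O],
        THEN spec[of _ ?O], THEN spec[of _ "\<lambda>i _. v $ i"], THEN mp], intro allI ballI)
    fix j x assume "x \<in> grid 1 1"
    then have x: "x = (0, 0)" unfolding grid by simp
    have "(\<Sum>i\<in>UNIV. Poly_Mapping.lookup (J $ j $ i) ([], []) * v $ i) = 0"
      using arg_cong[OF v, of "\<lambda>u. u $ j"] by (simp add: matrix_vector_mult_def)
    then show "(\<Sum>i\<in>UNIV. \<Sum>y\<in>grid 1 1. grid_eval 1 1 ?O ?O (J $ j $ i) x y * v $ i) = 0"
      unfolding grid x by (simp add: ev del: One_nat_def)
  qed
  then have "v $ i = 0" for i unfolding grid by simp
  then show "v = 0" by (simp add: Finite_Cartesian_Product.vec_eq_iff)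
qed

text \<open>For the direction from left to right, multiplication by the inverse \<open>B\<close> of the constant term
reduces to the case of constant term \<open>1\<close>.\<close>

theorem theorem6p18:
  fixes p :: "'g::finite \<Rightarrow> 'g free_poly"
  shows "free_injective p \<longleftrightarrow> invertible (hypo_Jacobian p)"
proof
  let ?J = "hypo_Jacobian p" and ?one = "Finite_Cartesian_Product.mat 1"
  assume "free_injective p"
  then have ns: "column_nonsingular (\<lambda>j i. ?J $ j $ i)" by (rule column_nonsingular_if_injective)
  define C where "C = (\<chi> j i. Poly_Mapping.lookup (?J $ j $ i) ([], []))"
  obtain B where BC: "B ** C = ?one" using constant_term_invertible[OF ns] unfolding C_def by blast
  then have CB: "C ** B = ?one" by (simp add: matrix_left_right_inverse)
  define J' where "J' = const_mat B ** ?J"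
  have J'_entry: "J' $ j $ i = (\<Sum>k\<in>UNIV. const_poly (B $ j $ k) * ?J $ k $ i)" for j i
    by (simp add: J'_def const_mat_def matrix_matrix_mult_def)
  have ns': "column_nonsingular (\<lambda>j i. J' $ j $ i)"
    unfolding column_nonsingular_def
  proof (intro allI, rule impI)
    fix n r Z Y and h :: "'g \<Rightarrow> nat \<times> nat \<Rightarrow> complex"
    assume h: "\<forall>j. \<forall>x\<in>grid n r. (\<Sum>i\<in>UNIV. \<Sum>y\<in>grid n r. grid_eval n r Z Y (J' $ j $ i) x y * h i y) = 0"
    define q where "q x = (\<chi> k. \<Sum>i\<in>UNIV. \<Sum>y\<in>grid n r. grid_eval n r Z Y (?J $ k $ i) x y * h i y)" for x
    have "q x = 0" if x: "x \<in> grid n r" for x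
    proof -
      have "(B *v q x) $ j = (\<Sum>i\<in>UNIV. \<Sum>y\<in>grid n r. grid_eval n r Z Y (J' $ j $ i) x y * h i y)" for j
      proof -
        have "(B *v q x) $ j = (\<Sum>k\<in>UNIV. \<Sum>i\<in>UNIV. \<Sum>y\<in>grid n r. B $ j $ k * grid_eval n r Z Y (?J $ k $ i) x y * h i y)"
          by (simp add: matrix_vector_mult_def q_def sum_distrib_left mult.assoc)
        also have "\<dots> = (\<Sum>i\<in>UNIV. \<Sum>k\<in>UNIV. \<Sum>y\<in>grid n r. B $ j $ k * grid_eval n r Z Y (?J $ k $ i) x y * h i y)"
          by (rule sum.swap)
        also have "\<dots> = (\<Sum>i\<in>UNIV. \<Sum>y\<in>grid n r. \<Sum>k\<in>UNIV. B $ j $ k * grid_eval n r Z Y (?J $ k $ i) x y * h i y)"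
          by (rule sum.cong[OF refl], rule sum.swap)
        finally show ?thesis by (simp add: J'_entry rep_eval_sum rep_eval_const_mult sum_distrib_right)
      qed
      then have "B *v q x = 0" using h x by (simp add: Finite_Cartesian_Product.vec_eq_iff)
      then have "C *v (B *v q x) = 0" by simp
      then show ?thesis by (simp add: matrix_vector_mul_assoc CB)
    qed
    then have "q x $ k = 0" if "x \<in> grid n r" for x k using that by simp
    then show "\<forall>i. \<forall>y\<in>grid n r. h i y = 0"
      by (intro ns[unfolded column_nonsingular_def, THEN spec[of _ n], THEN spec[of _ r], THEN spec[of _ Z],
            THEN spec[of _ Y], THEN spec[of _ h], THEN mp]) (simp add: q_def)
  qed
  have const: "Poly_Mapping.lookup (J' $ j $ i) ([], []) = (if j = i then 1 else 0)" for j i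
  proof -
    have "Poly_Mapping.lookup (J' $ j $ i) ([], []) = (B ** C) $ j $ i"
      by (simp add: J'_entry lookup_sum lookup_const_poly_mult matrix_matrix_mult_def C_def)
    then show ?thesis unfolding BC by (simp add: Finite_Cartesian_Product.mat_def)
  qed
  obtain K where K: "\<And>j k. (\<Sum>i\<in>UNIV. J' $ j $ i * K i k) = unit_mat j k"
    "\<And>j k. (\<Sum>i\<in>UNIV. K j i * J' $ i $ k) = unit_mat j k"
    by (rule column_nonsingular_imp_invertible[OF ns' const]) blast
  define K' where "K' = (\<chi> i k. K i k)"
  have K': "J' ** K' = ?one" "K' ** J' = ?one"
    using K by (simp_all add: K'_def matrix_matrix_mult_def Finite_Cartesian_Product.vec_eq_iff
        Finite_Cartesian_Product.mat_def unit_mat_def)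
  have J: "const_mat C ** J' = ?J"
    by (simp add: J'_def matrix_mul_assoc const_mat_mult[symmetric] CB const_mat_one)
  have "?J ** (K' ** const_mat B) = const_mat C ** (J' ** K') ** const_mat B"
    unfolding J[symmetric] by (simp only: matrix_mul_assoc)
  also have "\<dots> = ?one" by (simp add: K' const_mat_mult[symmetric] CB const_mat_one)
  finally have "?J ** (K' ** const_mat B) = ?one" .
  moreover have "K' ** const_mat B ** ?J = ?one"
    using K'(2) by (simp add: J'_def matrix_mul_assoc)
  ultimately show "invertible ?J" unfolding invertible_def by blast
next
  assume "invertible (hypo_Jacobian p)"
  then obtain K where "hypo_Jacobian p ** K = Finite_Cartesian_Product.mat 1"
    unfolding invertible_def by blast
  then have "(hypo_Jacobian p ** K) $ j $ k = (if j = k then 1 else 0)" for j k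
    by (simp add: Finite_Cartesian_Product.mat_def)
  then show "free_injective p"
    by (intro injective_if_right_inverse[where K = "\<lambda>i k. K $ i $ k"])
       (simp add: matrix_matrix_mult_def)
qed

end
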